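(* Provided the penalty parameter $\gamma$ is chosen sufficiently large, there exists a constant $\varrho>0$, independent of the mesh size $h$, such that $$a_h(v_h,v_h)\ge\varrho\,|\!|\!|v_h|\!|\!|^2\qquad\forall v_h\in V_h.$$ Furthermore, the discrete problem: find $u_h\in V_h$ such that $a_h(u_h,v_h)=l_h(v_h)$ for all $v_h\in V_h$, possesses a unique solution.
   Context: Surface and mesh. $S\subset\mathbb R^3$ is a compact, connected, oriented, $C^4$ surface with $\partial S=\varnothing$, and $U_\delta=\{x:\mathrm{dist}(x,S)<\delta\}$ is a small tubular neighbourhood of $S$ on which the closest point map $p:U_\delta\to S$ is well defined. $S$ is approximated by a closed polyhedral surface $S_h\subset U_\delta$, the union of the flat triangles of a conforming triangulation $\mathcal T_h$ with all vertices on $S$; $p|_{S_h}:S_h\to S$ is a bijection. $h=\max_{\tau\in\mathcal T_h}\mathrm{diam}\,\tau$, the family of meshes is quasi-uniform, and $h$ is sufficiently small. $\mathcal N_h$ and $\mathcal E_h$ are the sets of vertices and edges. $\mathrm d\sigma$ and $\mathrm d\sigma_h$ are the surface measures on $S$ and $S_h$. For $v$ on $S$, $v^{\mathrm e}=v\circ p$ on $S_h$. Operators on $S_h$. $\mathbf n_h$ is the (piecewise constant) unit outer normal of $S_h$, $\mathbf P_h=\mathbf I-\mathbf n_h\otimes\mathbf n_h$, and, element by element, $\nabla_{S_h}v=\mathbf P_h\nabla v$ and $\mathrm{div}_{S_h}\boldsymbol w=\nabla_{S_h}\cdot\boldsymbol w=\sum_{i=1}^3(\nabla_{S_h}w_i)_i$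 for (not necessarily tangential) $\boldsymbol w:S_h\to\mathbb R^3$. $(\cdot,\cdot)_\Sigma$ and $\|\cdot\|_{0,\Sigma}$ are the $L^2(\Sigma)$ inner product and norm. Edges. For $E=\partial\tau^+\cap\partial\tau^-\in\mathcal E_h$, $\mathbf n_E^\pm$ is the unit conormal of $E$ outward to $\tau^\pm$, lying in the plane of $\tau^\pm$. With traces $w^\pm$ from $\tau^\pm$: $\{\!\!\{w\}\!\!\}=\frac12(w^++w^-)$, and for a vector field $\boldsymbol w$, $[\![\boldsymbol w\cdot\mathbf n_E]\!]=\boldsymbol w^+\cdot\mathbf n_E^++\boldsymbol w^-\cdot\mathbf n_E^-$. Finite elements. $\mathcal V_h=\{v\in C^0(S_h):v|_\tau\in\mathbb P_1(\tau)\ \forall\tau\in\mathcal T_h\}$ with nodal basis $\{\phi_P\}_{P\in\mathcal N_h}$, and $V_h=\mathcal V_h/\mathbb R$, identified with the functions in $\mathcal V_h$ of zero mean over $S_h$. $G_h:\mathcal V_h\to\mathcal V_h^3$ is $G_hv_h=\sum_{P}G_hv_h(P)\phi_P$, $G_hv_h(P)=\frac1{|\Omega_P|}\int_{\Omega_P}\nabla_{S_h}v_h\,\mathrm d\sigma_h$, where $\Omega_P$ is the union of the triangles having $P$ as a vertex. Forms. With $\mathfrak S_h(u_h,v_h)=(\nabla_{S_h}u_h-G_hu_h,\nabla_{S_h}v_h-G_hv_h)_{S_h}$ and parameters $\gamma,\gamma_{\rm stab}>0$ independent of $h$, $$\begin{aligned}a_h(u_h,v_h)=&(\mathrm{div}_{S_h}G_hu_h,\mathrm{div}_{S_h}G_hv_h)_{S_h}-\sum_{E\in\mathcal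 E_h}(\{\!\!\{\mathrm{div}_{S_h}G_hu_h\}\!\!\},[\![G_hv_h\cdot\mathbf n_E]\!])_E\\&-\sum_{E\in\mathcal E_h}(\{\!\!\{\mathrm{div}_{S_h}G_hv_h\}\!\!\},[\![G_hu_h\cdot\mathbf n_E]\!])_E+\frac\gamma h\sum_{E\in\mathcal E_h}([\![G_hu_h\cdot\mathbf n_E]\!],[\![G_hv_h\cdot\mathbf n_E]\!])_E+\gamma_{\rm stab}\mathfrak S_h(u_h,v_h),\end{aligned}$$ $$|\!|\!|v_h|\!|\!|=\Big(\|\mathrm{div}_{S_h}G_hv_h\|_{0,S_h}^2+\sum_{E\in\mathcal E_h}h\|\{\!\!\{\mathrm{div}_{S_h}G_hv_h\}\!\!\}\|_{0,E}^2+\sum_{E\in\mathcal E_h}h^{-1}\|[\![G_hv_h\cdot\mathbf n_E]\!]\|_{0,E}^2+\mathfrak S_h(v_h,v_h)\Big)^{1/2}.$$ $f\in L^2(S)$ satisfies $\int_Sf\,\mathrm d\sigma=0$; $l_h(v_h)=(f_h,v_h)_{S_h}$ with $f_h=f^{\mathrm e}-\frac1{|S_h|}\int_{S_h}f^{\mathrm e}\,\mathrm d\sigma_h$. *)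

theory Defs
  imports "HOL-Analysis.Analysis"
begin

section \<open>Oriented surfaces in three-space\<close>

text \<open>Since the domain is finite-dimensional, continuity of all directional derivatives
  amounts to continuity of the derivative in operator norm.\<close>

primrec Ck_on :: "nat \<Rightarrow> ('a::euclidean_space \<Rightarrow> 'b::real_normed_vector) \<Rightarrow> 'a set \<Rightarrow> bool" where
  "Ck_on 0 F U \<longleftrightarrow> continuous_on U F"
| "Ck_on (Suc k) F U \<longleftrightarrow>
     (\<exists>F'. (\<forall>x\<in>U. (F has_derivative F' x) (at x)) \<and> (\<forall>v. Ck_on k (\<lambda>x. F' x v) U))"

text \<open>A surface without boundary is locally a regular level set (with gradient \<open>g\<close>);
  the orientation is a continuous unit normal field \<open>\<nu>\<close>.\<close>

definition oriented_surface :: "nat \<Rightarrow> (real^3) set \<Rightarrow> (real^3 \<Rightarrow> real^3) \<Rightarrow> bool" where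
  "oriented_surface k S \<nu> \<longleftrightarrow>
     continuous_on S \<nu> \<and>
     (\<forall>x\<in>S. \<exists>U F g. open U \<and> x \<in> U \<and> Ck_on k (F :: real^3 \<Rightarrow> real) U \<and>
        (\<forall>y\<in>U. (F has_derivative (\<lambda>v. g y \<bullet> v)) (at y) \<and> g y \<noteq> 0) \<and>
        S \<inter> U = {y \<in> U. F y = 0} \<and>
        (\<forall>y\<in>S \<inter> U. norm (\<nu> y) = 1 \<and> \<nu> y \<in> span {g y}))"

definition tubular_nbhd :: "(real^3) set \<Rightarrow> real \<Rightarrow> (real^3) set" where
  "tubular_nbhd S \<delta> = {x. infdist x S < \<delta>}"

text \<open>On a set where this holds, \<open>closest_point S\<close> is the closest point map \<open>p\<close>.\<close>

definition closest_point_well_defined_on :: "(real^3) set \<Rightarrow> (real^3) set \<Rightarrow> bool" where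
  "closest_point_well_defined_on S U \<longleftrightarrow>
     (\<forall>x\<in>U. \<exists>!y. y \<in> S \<and> (\<forall>z\<in>S. dist x y \<le> dist x z))"

text \<open>The surface measure on the Borel sets of \<open>S\<close> is determined by the area formula in all regular
  \<open>C\<^sup>1\<close> parametrisations \<open>\<phi> : W \<rightarrow> S\<close>.\<close>

definition is_surface_measure :: "(real^3) set \<Rightarrow> (real^3) measure \<Rightarrow> bool" where
  "is_surface_measure S \<sigma> \<longleftrightarrow>
     sets \<sigma> = sets (restrict_space borel S) \<and>
     (\<forall>W (\<phi> :: real \<times> real \<Rightarrow> real^3) \<phi>'.
        open W \<and> inj_on \<phi> W \<and> \<phi> ` W \<subseteq> S \<and>
        (\<forall>w\<in>W. (\<phi> has_derivative \<phi>' w) (at w) \<and> inj (\<phi>' w)) \<and>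
        (\<forall>v. continuous_on W (\<lambda>w. \<phi>' w v)) \<longrightarrow>
        (\<forall>A\<in>sets borel. A \<subseteq> \<phi> ` W \<longrightarrow>
           emeasure \<sigma> A =
             (\<integral>\<^sup>+ w \<in> {w \<in> W. \<phi> w \<in> A}. ennreal (norm (cross3 (\<phi>' w (1, 0)) (\<phi>' w (0, 1)))) \<partial>lborel)))"

section \<open>Triangulated polyhedral surfaces\<close>

type_synonym triangle = "(real^3) set"
type_synonym mesh = "triangle set"

text \<open>Elementwise defined fields on \<open>S\<^sub>h\<close>: on an edge, \<open>w \<tau> x\<close> is the trace from \<open>\<tau>\<close>.\<close>

type_synonym 'b broken = "triangle \<Rightarrow> real^3 \<Rightarrow> 'b"

definition nodes :: "mesh \<Rightarrow> (real^3) set" where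
  "nodes T = {P. \<exists>\<tau>\<in>T. P extreme_point_of \<tau>}"

definition edges :: "mesh \<Rightarrow> (real^3) set set" where
  "edges T = {E. \<exists>\<tau>\<in>T. E edge_of \<tau>}"

definition mesh_size :: "mesh \<Rightarrow> real" where
  "mesh_size T = Max (diameter ` T)"

definition closed_triangulated_surface :: "mesh \<Rightarrow> bool" where
  "closed_triangulated_surface T \<longleftrightarrow>
     triangulation T \<and> (\<forall>\<tau>\<in>T. 2 simplex \<tau>) \<and>
     (\<forall>E\<in>edges T. card {\<tau>\<in>T. E edge_of \<tau>} = 2)"

definition approximating_mesh :: "(real^3) set \<Rightarrow> real \<Rightarrow> mesh \<Rightarrow> bool" where
  "approximating_mesh S \<delta> T \<longleftrightarrow>
     closed_triangulated_surface T \<and> nodes T \<subseteq> S \<and> \<Union>T \<subseteq> tubular_nbhd S \<delta> \<and>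
     bij_betw (closest_point S) (\<Union>T) S"

text \<open>The inradius of every triangle is bounded below by a fixed multiple of the mesh size.\<close>

definition quasi_uniform :: "mesh set \<Rightarrow> bool" where
  "quasi_uniform \<T> \<longleftrightarrow>
     (\<exists>c>0. \<forall>T\<in>\<T>. \<forall>\<tau>\<in>T. \<exists>x\<in>\<tau>. cball x (c * mesh_size T) \<inter> affine hull \<tau> \<subseteq> \<tau>)"

definition unit_outer_normal :: "mesh \<Rightarrow> (triangle \<Rightarrow> real^3) \<Rightarrow> bool" where
  "unit_outer_normal T n \<longleftrightarrow>
     (\<forall>\<tau>\<in>T. norm (n \<tau>) = 1 \<and> (\<forall>x\<in>\<tau>. \<forall>y\<in>\<tau>. n \<tau> \<bullet> (x - y) = 0) \<and>
        (\<forall>x\<in>rel_interior \<tau>. \<forall>\<^sub>F t in at_right 0. x + t *\<^sub>R n \<tau> \<in> outside (\<Union>T)))"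

definition conormal :: "triangle \<Rightarrow> (real^3) set \<Rightarrow> real^3" where
  "conormal \<tau> E = (THE m. norm m = 1 \<and> m \<in> span {x - y |x y. x \<in> \<tau> \<and> y \<in> \<tau>} \<and>
     (\<forall>x\<in>E. \<forall>y\<in>E. m \<bullet> (x - y) = 0) \<and> (\<forall>x\<in>E. \<forall>y\<in>\<tau>. m \<bullet> (y - x) \<le> 0))"

section \<open>Integration over triangles and edges\<close>

text \<open>Push-forwards of Lebesgue measure on the reference simplex, weighted by the constant area
  (length) element; they do not depend on the chosen enumeration of the vertices.\<close>

definition ref_triangle :: "(real \<times> real) set" where
  "ref_triangle = {(s, t). 0 \<le> s \<and> 0 \<le> t \<and> s + t \<le> 1}"

definition tri_measure :: "triangle \<Rightarrow> (real^3) measure" where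
  "tri_measure \<tau> =
     (let (a, b, c) = (SOME (a, b, c). \<tau> = convex hull {a, b, c}) in
        distr (density (restrict_space lborel ref_triangle)
                 (\<lambda>_. ennreal (norm (cross3 (b - a) (c - a)))))
          (restrict_space borel \<tau>) (\<lambda>(s, t). a + s *\<^sub>R (b - a) + t *\<^sub>R (c - a)))"

definition edge_measure :: "(real^3) set \<Rightarrow> (real^3) measure" where
  "edge_measure E =
     (let (a, b) = (SOME (a, b). E = closed_segment a b) in
        distr (density (restrict_space lborel {0..1}) (\<lambda>_. ennreal (dist a b)))
          (restrict_space borel E) (\<lambda>s. a + s *\<^sub>R (b - a)))"

definition surf_integral :: "mesh \<Rightarrow> 'b::{banach, second_countable_topology} broken \<Rightarrow> 'b" where
  "surf_integral T w = (\<Sum>\<tau>\<in>T. \<integral>x. w \<tau> x \<partial>tri_measure \<tau>)"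

definition surf_area :: "mesh \<Rightarrow> real" where
  "surf_area T = (\<Sum>\<tau>\<in>T. measure (tri_measure \<tau>) \<tau>)"

definition surf_inner :: "mesh \<Rightarrow> 'b::real_inner broken \<Rightarrow> 'b broken \<Rightarrow> real" where
  "surf_inner T w z = surf_integral T (\<lambda>\<tau> x. w \<tau> x \<bullet> z \<tau> x)"

definition edge_inner :: "(real^3) set \<Rightarrow> (real^3 \<Rightarrow> real) \<Rightarrow> (real^3 \<Rightarrow> real) \<Rightarrow> real" where
  "edge_inner E w z = (\<integral>x. w x * z x \<partial>edge_measure E)"

text \<open>Exactly two triangles \<open>\<tau>\<^sup>+\<close>, \<open>\<tau>\<^sup>-\<close> contain an edge of a closed triangulated surface, and average
  and jump are symmetric in them, so both are sums over the triangles containing \<open>E\<close>.\<close>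

definition edge_avg :: "mesh \<Rightarrow> (real^3) set \<Rightarrow> real broken \<Rightarrow> real^3 \<Rightarrow> real" where
  "edge_avg T E w x = (1 / 2) * (\<Sum>\<tau> | \<tau> \<in> T \<and> E edge_of \<tau>. w \<tau> x)"

definition conormal_jump :: "mesh \<Rightarrow> (real^3) set \<Rightarrow> (real^3) broken \<Rightarrow> real^3 \<Rightarrow> real" where
  "conormal_jump T E w x = (\<Sum>\<tau> | \<tau> \<in> T \<and> E edge_of \<tau>. w \<tau> x \<bullet> conormal \<tau> E)"

section \<open>Surface differential operators\<close>

text \<open>In all that follows \<open>n \<tau>\<close> is the unit normal of the triangle \<open>\<tau>\<close>.\<close>

definition tangent_proj :: "real^3 \<Rightarrow> real^3 \<Rightarrow> real^3" where
  "tangent_proj m w = w - (m \<bullet> w) *\<^sub>R m"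

text \<open>A function on \<open>\<tau>\<close> determines its ambient gradient \<open>a\<close> up to multiples of the normal,
  which the projection removes.\<close>

definition surf_grad :: "(triangle \<Rightarrow> real^3) \<Rightarrow> (real^3 \<Rightarrow> real) \<Rightarrow> (real^3) broken" where
  "surf_grad n v \<tau> x =
     tangent_proj (n \<tau>) (SOME a. (v has_derivative (\<lambda>y. a \<bullet> y)) (at x within \<tau>))"

definition surf_div :: "(triangle \<Rightarrow> real^3) \<Rightarrow> (real^3 \<Rightarrow> real^3) \<Rightarrow> real broken" where
  "surf_div n w \<tau> x = (\<Sum>i\<in>UNIV. surf_grad n (\<lambda>y. w y $ i) \<tau> x $ i)"

section \<open>Finite element spaces and the recovered gradient\<close>

text \<open>Functions on \<open>S\<^sub>h\<close> are represented by functions on the whole space vanishing off \<open>S\<^sub>h\<close>.\<close>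

definition fe_space :: "mesh \<Rightarrow> (real^3 \<Rightarrow> real) set" where
  "fe_space T = {v. continuous_on (\<Union>T) v \<and>
     (\<forall>\<tau>\<in>T. \<exists>a b. \<forall>x\<in>\<tau>. v x = a \<bullet> x + b) \<and> (\<forall>x. x \<notin> \<Union>T \<longrightarrow> v x = 0)}"

definition fe_space0 :: "mesh \<Rightarrow> (real^3 \<Rightarrow> real) set" where
  "fe_space0 T = {v \<in> fe_space T. surf_integral T (\<lambda>\<tau>. v) = 0}"

definition nodal_basis :: "mesh \<Rightarrow> real^3 \<Rightarrow> real^3 \<Rightarrow> real" where
  "nodal_basis T P =
     (THE \<phi>. \<phi> \<in> fe_space T \<and> (\<forall>Q\<in>nodes T. \<phi> Q = (if Q = P then 1 else 0)))"

definition patch :: "mesh \<Rightarrow> real^3 \<Rightarrow> mesh" where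
  "patch T P = {\<tau>\<in>T. P extreme_point_of \<tau>}"

definition recovered_grad_at ::
    "mesh \<Rightarrow> (triangle \<Rightarrow> real^3) \<Rightarrow> (real^3 \<Rightarrow> real) \<Rightarrow> real^3 \<Rightarrow> real^3" where
  "recovered_grad_at T n v P =
     (1 / surf_area (patch T P)) *\<^sub>R surf_integral (patch T P) (surf_grad n v)"

definition recovered_grad ::
    "mesh \<Rightarrow> (triangle \<Rightarrow> real^3) \<Rightarrow> (real^3 \<Rightarrow> real) \<Rightarrow> real^3 \<Rightarrow> real^3" where
  "recovered_grad T n v x = (\<Sum>P\<in>nodes T. nodal_basis T P x *\<^sub>R recovered_grad_at T n v P)"

section \<open>The discrete problem\<close>

definition stab_form ::
    "mesh \<Rightarrow> (triangle \<Rightarrow> real^3) \<Rightarrow> (real^3 \<Rightarrow> real) \<Rightarrow> (real^3 \<Rightarrow> real) \<Rightarrow> real" where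
  "stab_form T n u v =
     surf_inner T (\<lambda>\<tau> x. surf_grad n u \<tau> x - recovered_grad T n u x)
                  (\<lambda>\<tau> x. surf_grad n v \<tau> x - recovered_grad T n v x)"

definition div_G :: "mesh \<Rightarrow> (triangle \<Rightarrow> real^3) \<Rightarrow> (real^3 \<Rightarrow> real) \<Rightarrow> real broken" where
  "div_G T n v = surf_div n (recovered_grad T n v)"

definition jump_G ::
    "mesh \<Rightarrow> (triangle \<Rightarrow> real^3) \<Rightarrow> (real^3) set \<Rightarrow> (real^3 \<Rightarrow> real) \<Rightarrow> real^3 \<Rightarrow> real" where
  "jump_G T n E v = conormal_jump T E (\<lambda>\<tau>. recovered_grad T n v)"

definition a_h :: "real \<Rightarrow> real \<Rightarrow> mesh \<Rightarrow> (triangle \<Rightarrow> real^3) \<Rightarrow>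
    (real^3 \<Rightarrow> real) \<Rightarrow> (real^3 \<Rightarrow> real) \<Rightarrow> real" where
  "a_h \<gamma> \<gamma>stab T n u v =
     surf_inner T (div_G T n u) (div_G T n v)
     - (\<Sum>E\<in>edges T. edge_inner E (edge_avg T E (div_G T n u)) (jump_G T n E v))
     - (\<Sum>E\<in>edges T. edge_inner E (edge_avg T E (div_G T n v)) (jump_G T n E u))
     + \<gamma> / mesh_size T * (\<Sum>E\<in>edges T. edge_inner E (jump_G T n E u) (jump_G T n E v))
     + \<gamma>stab * stab_form T n u v"

definition energy_norm :: "mesh \<Rightarrow> (triangle \<Rightarrow> real^3) \<Rightarrow> (real^3 \<Rightarrow> real) \<Rightarrow> real" where
  "energy_norm T n v = sqrt (
     surf_inner T (div_G T n v) (div_G T n v)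
     + (\<Sum>E\<in>edges T. mesh_size T *
          edge_inner E (edge_avg T E (div_G T n v)) (edge_avg T E (div_G T n v)))
     + (\<Sum>E\<in>edges T. inverse (mesh_size T) * edge_inner E (jump_G T n E v) (jump_G T n E v))
     + stab_form T n v v)"

definition f_h :: "(real^3) set \<Rightarrow> mesh \<Rightarrow> (real^3 \<Rightarrow> real) \<Rightarrow> real^3 \<Rightarrow> real" where
  "f_h S T f x = f (closest_point S x)
     - 1 / surf_area T * surf_integral T (\<lambda>\<tau> y. f (closest_point S y))"

definition l_h :: "(real^3) set \<Rightarrow> mesh \<Rightarrow> (real^3 \<Rightarrow> real) \<Rightarrow> (real^3 \<Rightarrow> real) \<Rightarrow> real" where
  "l_h S T f v = surf_inner T (\<lambda>\<tau>. f_h S T f) (\<lambda>\<tau>. v)"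

end

theory Submission
  imports Defs
begin

text \<open>
  Coercivity rests on one inverse inequality. The recovered gradient \<open>G\<^sub>hv\<close> is a continuous
  piecewise linear field, so its divergence is constant on each triangle. Edges are at most \<open>h\<close> long,
  while quasi-uniformity bounds the areas below by a multiple of \<open>h\<^sup>2\<close>; hence the averages of the
  divergence on the edges are controlled, after weighting by \<open>h\<close>, by the divergence on the triangles
  (\<open>edge_average_inverse_inequality\<close>). Young's inequality then absorbs the two consistency terms
  into the divergence and the penalty term (\<open>a_h_coercive\<close>).

  In finite dimension a coercive form gives unique solutions for all linear right-hand sides
  (\<open>definite_form_unique_solution\<close>), provided that the energy norm is a norm and that \<open>l\<^sub>h\<close> is linear.
  Both points need geometry.

  The energy norm is a norm already because of the stabilisation. If \<open>\<nabla>v = G\<^sub>hv\<close>, then this field is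
  both piecewise constant and continuous; \<open>S\<^sub>h\<close> is connected, being homeomorphic to \<open>S\<close> under the
  closest point map, so it is one vector \<open>g\<close>, tangent to every triangle. A closed polyhedral surface
  has no common tangent direction: at a vertex that is highest in the direction \<open>g\<close>, the least steep
  edge lies in two coplanar triangles, and the one above it contributes a still less steep edge
  (\<open>no_common_tangent_direction\<close>). Hence \<open>g = 0\<close>, and \<open>v\<close> is a constant with mean zero.

  The form \<open>l\<^sub>h\<close> is linear once the lift \<open>f \<circ> p\<close> is integrable on every triangle
  (\<open>square_integrable_lift_integrable\<close>). Instead of the Jacobian of \<open>p\<close>, the proof uses its inverse:
  a point of a triangle is the intersection of the plane of the triangle with the normal line of \<open>S\<close>
  at \<open>y = p x\<close>. On fine quasi-uniform meshes these lines are uniformly transversal to the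
  plane (\<open>inball_transversal\<close>), so \<open>x\<close> is locally a Lipschitz function of \<open>y\<close>. In charts of \<open>S\<close>, and
  because Lipschitz maps enlarge Lebesgue measure by a bounded factor only, the preimage under \<open>p\<close> of a set
  \<open>A \<subseteq> S\<close> has area at most a constant times \<open>\<sigma>(A)\<close>.
\<close>

section \<open>Triangles, edges and their measures\<close>

definition tri_map :: "real^3 \<Rightarrow> real^3 \<Rightarrow> real^3 \<Rightarrow> real \<times> real \<Rightarrow> real^3" where
  "tri_map a b c w = a + fst w *\<^sub>R (b - a) + snd w *\<^sub>R (c - a)"

lemma convex_hull_tri_map: "convex hull {a, b, c} = tri_map a b c ` ref_triangle"
  unfolding convex_hull_3_alt ref_triangle_def tri_map_def by (auto simp: image_def Bex_def) 

lemma continuous_on_tri_map [continuous_intros]: "continuous_on A (tri_map a b c)"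
  unfolding tri_map_def by (intro continuous_intros)

lemma ref_triangle_eq_hull: "ref_triangle = convex hull {(0,0), (1,0), (0::real,1::real)}"
  unfolding convex_hull_3_alt ref_triangle_def by auto

lemma compact_ref_triangle: "compact ref_triangle"
  by (metis ref_triangle_eq_hull finite_imp_compact_convex_hull finite.intros)

lemma convex_ref_triangle: "convex ref_triangle"
  by (metis ref_triangle_eq_hull convex_convex_hull)

lemma box_subset_ref_triangle: "cbox (0::real,0::real) (1/2::real,1/2::real) \<subseteq> ref_triangle"
  unfolding ref_triangle_def by (auto simp: cbox_Pair_eq)

lemma interior_ref_triangle_nonempty: "interior ref_triangle \<noteq> {}"
proof -
  have "box (0::real,0::real) (1/2::real,1/2::real) \<subseteq> interior ref_triangle"
    by (rule order.trans[OF _ interior_mono[OF box_subset_ref_triangle]]) simp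
  moreover have "(1/4::real,1/4::real) \<in> box (0::real,0::real) (1/2::real,1/2::real)" 
    by (auto simp: box_def Basis_prod_def)
  ultimately show ?thesis by blast
qed

lemma sets_ref_triangle [measurable]: "ref_triangle \<in> sets borel"
  by (simp add: borel_compact compact_ref_triangle)

lemma measure_ref_triangle_ge: "measure lborel ref_triangle \<ge> 1/4"
proof -
  have "measure lborel (cbox (0::real,0::real) (1/2::real,1/2::real)) \<le> measure lborel ref_triangle"
    using box_subset_ref_triangle compact_ref_triangle
    by (intro measure_mono_fmeasurable) (auto intro!: fmeasurable_compact)
  moreover have "measure lborel (cbox (0::real,0::real) (1/2::real,1/2::real)) = 1/4"
    by (subst measure_lborel_cbox_eq) (auto simp: Basis_prod_def prod.union_disjoint)
  ultimately show ?thesis by simp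
qed

lemma two_simplex_cross:
  assumes "2 simplex (convex hull {a, b, c})"
  shows "cross3 (b - a) (c - a) \<noteq> 0"
proof
  assume "cross3 (b - a) (c - a) = 0"
  hence "collinear {0, b - a, c - a}" by (simp add: cross_eq_0)
  hence "collinear {b, a, c}" by (subst collinear_3) simp
  hence "collinear {a, b, c}" by (simp add: insert_commute)
  moreover have "aff_dim {a, b, c} = 2"
    using aff_dim_simplex[OF assms] by (simp add: aff_dim_convex_hull)
  ultimately show False by (simp add: collinear_aff_dim)
qed

lemma two_simplex_vertices:
  assumes "2 simplex \<tau>"
  obtains a b c where "\<tau> = convex hull {a, b, c}"
proof -
  from assms obtain C where C: "card C = 3" "\<tau> = convex hull C"
    unfolding simplex_def by auto
  thus ?thesis using that by (auto simp: card_3_iff)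
qed

lemma two_simplex_affine_independent:
  fixes a b c :: "real^3"
  assumes "2 simplex (convex hull {a, b, c})"
  shows "\<not> affine_dependent {a, b, c}" "a \<noteq> b" "a \<noteq> c" "b \<noteq> c"
proof -
  have "cross3 (b - a) (c - a) \<noteq> 0" by (rule two_simplex_cross[OF assms])
  thus ne: "a \<noteq> b" "a \<noteq> c" "b \<noteq> c" by auto
  have "aff_dim {a, b, c} = 2"
    using aff_dim_simplex[OF assms] by (simp add: aff_dim_convex_hull)
  thus "\<not> affine_dependent {a, b, c}"
    using ne by (subst affine_independent_iff_card) simp
qed

lemma two_simplex_extreme_points:
  fixes a b c :: "real^3"
  assumes "2 simplex (convex hull {a, b, c})"
  shows "P extreme_point_of (convex hull {a, b, c}) \<longleftrightarrow> P \<in> {a, b, c}"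
  using extreme_point_of_convex_hull_affine_independent[OF two_simplex_affine_independent(1)[OF assms]] .

lemma two_simplex_props:
  assumes "2 simplex \<tau>"
  shows "compact \<tau>" "convex \<tau>" "\<tau> \<noteq> {}"
proof -
  obtain a b c where t: "\<tau> = convex hull {a, b, c}" using two_simplex_vertices[OF assms] .
  show "compact \<tau>" unfolding t by (simp add: finite_imp_compact_convex_hull)
  show "convex \<tau>" "\<tau> \<noteq> {}" unfolding t by simp_all
qed

text \<open>Both \<^const>\<open>tri_measure\<close> and \<^const>\<open>edge_measure\<close> are push-forwards of a
  weighted Lebesgue measure under a continuous map with compact domain. The two facts needed about
  them, finiteness and the Borel \<open>\<sigma>\<close>-algebra of the image, make every continuous function
  integrable.\<close>

definition measure_on_compact :: "'a::euclidean_space measure \<Rightarrow> 'a set \<Rightarrow> bool" where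
  "measure_on_compact M K \<longleftrightarrow>
     compact K \<and> finite_measure M \<and> sets M = sets (restrict_space borel K)"

lemma measure_on_compact_space: "measure_on_compact M K \<Longrightarrow> space M = K"
  unfolding measure_on_compact_def
  by (metis sets_eq_imp_space_eq inf_top.right_neutral space_borel space_restrict_space)

lemma integrable_on_compact:
  fixes f :: "'a::euclidean_space \<Rightarrow> 'b::euclidean_space"
  assumes M: "measure_on_compact M K" and f: "continuous_on K f"
  shows "integrable M f"
proof -
  have K: "compact K" and fin: "finite_measure M" and sM: "sets M = sets (restrict_space borel K)"
    using M by (auto simp: measure_on_compact_def)
  interpret finite_measure M by fact
  have "f \<in> borel_measurable (restrict_space borel K)"
    by (rule borel_measurable_continuous_on_restrict[OF f])
  hence m: "f \<in> borel_measurable M"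
    using measurable_cong_sets[OF sM refl] by blast
  have "bounded (f ` K)" using compact_continuous_image[OF f K] by (rule compact_imp_bounded)
  then obtain B where "\<And>x. x \<in> K \<Longrightarrow> norm (f x) \<le> B" unfolding bounded_iff by auto
  thus ?thesis using measure_on_compact_space[OF M]
    by (intro integrable_const_bound[of _ B] m) auto
qed

lemma distr_param_measure_on_compact:
  fixes K :: "'b::euclidean_space set" and r :: real
  assumes cR: "compact R" and cont: "continuous_on R p" and im: "p ` R = K"
    and M: "M = distr (density (restrict_space lborel R) (\<lambda>_. ennreal r)) (restrict_space borel K) p"
    and r: "r \<ge> 0"
  shows "measure_on_compact M K" "measure M K = r * measure lborel R"
    "p \<in> measurable (density (restrict_space lborel R) (\<lambda>_. ennreal r)) (restrict_space borel K)"
proof -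
  let ?D = "density (restrict_space lborel R) (\<lambda>_. ennreal r)"
  have R: "R \<in> sets borel" using cR by (simp add: borel_compact)
  have cK: "compact K" using compact_continuous_image[OF cont cR] im by simp
  have Kb: "K \<in> sets borel" using cK by (simp add: borel_compact)
  have "p \<in> borel_measurable (restrict_space borel R)"
    by (rule borel_measurable_continuous_on_restrict[OF cont])
  hence "p \<in> measurable (restrict_space borel R) (restrict_space borel K)"
    using im by (intro measurable_restrict_space2) (auto simp: space_restrict_space)
  moreover have "sets (restrict_space borel R) = sets (restrict_space lborel R)"
    by (rule sets_restrict_space_cong) simp
  ultimately show meas: "p \<in> measurable ?D (restrict_space borel K)"
    by (simp add: measurable_def space_restrict_space)
  have emR: "emeasure lborel R = ennreal (measure lborel R)"
    by (rule emeasure_eq_ennreal_measure[OF fmeasurableD2[OF fmeasurable_compact[OF cR]]])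
  have sp: "space M = K" unfolding M by (simp add: space_restrict_space)
  have eD: "emeasure ?D R = ennreal r * emeasure lborel R"
    using R by (subst emeasure_density) (auto simp: nn_integral_cmult_indicator sets_restrict_space_iff emeasure_restrict_space)
  have pre: "p -` K \<inter> R = R" using im by auto
  have "emeasure M K = emeasure ?D (p -` K \<inter> R)"
    unfolding M using meas Kb
    by (subst emeasure_distr) (auto simp: space_restrict_space sets_restrict_space_iff)
  hence em: "emeasure M K = ennreal (r * measure lborel R)"
    unfolding pre using eD by (simp add: emR ennreal_mult r)
  show "measure_on_compact M K"
    unfolding measure_on_compact_def
    using cK em sp by (auto simp: M intro!: finite_measureI)
  show "measure M K = r * measure lborel R" using em r by (simp add: measure_def)
qed

definition tri_area :: "triangle \<Rightarrow> real" where
  "tri_area \<tau> = measure (tri_measure \<tau>) \<tau>"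

definition ref_measure :: "real \<Rightarrow> (real \<times> real) measure" where
  "ref_measure J = density (restrict_space lborel ref_triangle) (\<lambda>_. ennreal J)"

text \<open>The vertices in \<^const>\<open>tri_measure\<close> are chosen by a description operator; all that is
  used of the choice is recorded here.\<close>

lemma tri_measure_parametrised:
  assumes T: "2 simplex \<tau>"
  obtains a b c J where "\<tau> = convex hull {a, b, c}" "J = norm (cross3 (b - a) (c - a))" "J > 0"
    "tri_map a b c ` ref_triangle = \<tau>"
    "tri_measure \<tau> = distr (ref_measure J) (restrict_space borel \<tau>) (tri_map a b c)"
    "tri_map a b c \<in> measurable (ref_measure J) (restrict_space borel \<tau>)"
    "measure_on_compact (tri_measure \<tau>) \<tau>" "tri_area \<tau> = J * measure lborel ref_triangle"
proof -
  \<comment> \<open>the choice made in the definition of the measure\<close>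
  define X where "X = (SOME (a, b, c). \<tau> = convex hull {a, b, c})"
  have "case X of (a, b, c) \<Rightarrow> \<tau> = convex hull {a, b, c}"
    unfolding X_def using two_simplex_vertices[OF T]
    by (metis (mono_tags, lifting) case_prod_conv someI)
  moreover obtain a b c where X: "X = (a, b, c)" by (cases X)
  ultimately have t: "\<tau> = convex hull {a, b, c}" by simp
  define J where "J = norm (cross3 (b - a) (c - a))"
  have "(\<lambda>(s, t). a + s *\<^sub>R (b - a) + t *\<^sub>R (c - a)) = tri_map a b c"
    by (auto simp: tri_map_def fun_eq_iff)
  hence M: "tri_measure \<tau> = distr (ref_measure J) (restrict_space borel \<tau>) (tri_map a b c)"
    unfolding tri_measure_def X_def[symmetric] X ref_measure_def J_def by simp
  have J: "J > 0" unfolding J_def using two_simplex_cross T t by simp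
  have im: "tri_map a b c ` ref_triangle = \<tau>" using t convex_hull_tri_map by simp
  note distr = distr_param_measure_on_compact[OF compact_ref_triangle continuous_on_tri_map im
      M[unfolded ref_measure_def] less_imp_le[OF J]]
  show ?thesis
    by (rule that[OF t J_def J im M]) (use distr in \<open>auto simp: ref_measure_def tri_area_def\<close>)
qed

lemma tri_measure_on_compact:
  assumes "2 simplex \<tau>"
  shows "measure_on_compact (tri_measure \<tau>) \<tau>"
  by (rule tri_measure_parametrised[OF assms])

text \<open>The reference triangle, of area \<open>1/2\<close>, contains a square of area \<open>1/4\<close>.\<close>

lemma tri_area_ge:
  assumes "2 simplex \<tau>"
  obtains a b c where "\<tau> = convex hull {a, b, c}"
    "tri_area \<tau> \<ge> norm (cross3 (b - a) (c - a)) / 4"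
proof -
  obtain a b c J where t: "\<tau> = convex hull {a, b, c}" and J: "J = norm (cross3 (b - a) (c - a))"
    and "tri_area \<tau> = J * measure lborel ref_triangle"
    by (rule tri_measure_parametrised[OF assms])
  moreover have "J * measure lborel ref_triangle \<ge> J * (1/4)"
    unfolding J by (intro mult_left_mono measure_ref_triangle_ge) auto
  ultimately show ?thesis using that by simp
qed

lemma tri_area_pos:
  assumes "2 simplex \<tau>"
  shows "tri_area \<tau> > 0"
proof -
  obtain a b c J where "J > 0" "tri_area \<tau> = J * measure lborel ref_triangle"
    by (rule tri_measure_parametrised[OF assms])
  thus ?thesis using measure_ref_triangle_ge by simp
qed

text \<open>The null set on which \<open>f\<close> might be positive is pulled back to the reference triangle.
  There it misses the interior, because a nonempty open set is not negligible, and the triangle is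
  the closure of its interior.\<close>

lemma integral_tri_measure_eq_0_imp:
  fixes f :: "real^3 \<Rightarrow> real"
  assumes T: "2 simplex \<tau>" and cont: "continuous_on \<tau> f" and nn: "\<And>x. x \<in> \<tau> \<Longrightarrow> f x \<ge> 0"
    and zero: "(\<integral>x. f x \<partial>tri_measure \<tau>) = 0" and x: "x \<in> \<tau>"
  shows "f x = 0"
proof -
  let ?R = "restrict_space lborel ref_triangle :: (real \<times> real) measure"
  obtain a b c J where J: "J > 0" and im: "tri_map a b c ` ref_triangle = \<tau>"
    and M: "tri_measure \<tau> = distr (ref_measure J) (restrict_space borel \<tau>) (tri_map a b c)"
    and meas: "tri_map a b c \<in> measurable (ref_measure J) (restrict_space borel \<tau>)"
    by (rule tri_measure_parametrised[OF T])
  have moc: "measure_on_compact (tri_measure \<tau>) \<tau>" by (rule tri_measure_on_compact[OF T])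
  have int: "integrable (tri_measure \<tau>) f" by (rule integrable_on_compact[OF moc cont])
  have sp: "space (tri_measure \<tau>) = \<tau>" by (rule measure_on_compact_space[OF moc])
  have "AE x in tri_measure \<tau>. f x = 0"
    using integral_nonneg_eq_0_iff_AE[OF int AE_I2] zero nn sp by simp
  moreover have f: "f \<in> borel_measurable (restrict_space borel \<tau>)"
    by (rule borel_measurable_continuous_on_restrict[OF cont])
  ultimately have "AE w in ref_measure J. f (tri_map a b c w) = 0"
    unfolding M using meas by (subst (asm) AE_distr_iff) (auto intro!: measurable_equality_set)
  hence "AE w in ?R. f (tri_map a b c w) = 0"
    unfolding ref_measure_def using J by (subst (asm) AE_density) auto
  hence ae: "AE w in lborel. w \<in> ref_triangle \<longrightarrow> f (tri_map a b c w) = 0"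
    by (subst (asm) AE_restrict_space_iff) auto
  define g where "g = (\<lambda>w. f (tri_map a b c w))"
  have cg: "continuous_on ref_triangle g" unfolding g_def
    by (rule continuous_on_compose2[OF cont continuous_on_tri_map]) (use im in auto)
  have "g w = 0" if w: "w \<in> interior ref_triangle" for w
  proof (rule ccontr)
    assume ne: "g w \<noteq> 0"
    have "open (interior ref_triangle \<inter> g -` (- {0}))"
      by (intro continuous_open_preimage continuous_on_subset[OF cg] interior_subset) auto
    moreover have "interior ref_triangle \<inter> g -` (- {0}) \<noteq> {}" using w ne by auto
    moreover have "AE w in lborel. w \<notin> interior ref_triangle \<inter> g -` (- {0})"
      using ae by eventually_elim (use interior_subset in \<open>auto simp: g_def\<close>)
    hence "interior ref_triangle \<inter> g -` (- {0}) \<in> null_sets lborel"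
      using calculation(1) by (subst (asm) AE_iff_null_sets[symmetric]) auto
    hence "negligible (interior ref_triangle \<inter> g -` (- {0}))"
      by (simp add: null_sets_completionI negligible_iff_null_sets)
    ultimately show False using open_not_negligible by blast
  qed
  moreover have "closure (interior ref_triangle) = ref_triangle"
    using convex_closure_interior[OF convex_ref_triangle interior_ref_triangle_nonempty]
      compact_ref_triangle by (simp add: compact_imp_closed)
  ultimately have "g w = 0" if "w \<in> ref_triangle" for w
    using continuous_constant_on_closure[of "interior ref_triangle" g 0 w] cg that by auto
  thus ?thesis using x im unfolding g_def by auto
qed

lemma edge_of_two_simplex:
  fixes \<tau> :: triangle
  assumes T: "2 simplex \<tau>" and E: "E edge_of \<tau>"
  obtains P Q where "E = closed_segment P Q" "P \<noteq> Q" "P extreme_point_of \<tau>" "Q extreme_point_of \<tau>"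
proof -
  obtain a b c where t: "\<tau> = convex hull {a, b, c}" using two_simplex_vertices[OF T] .
  have F: "E face_of convex hull {a,b,c}" and d: "aff_dim E = 1" using E t by (auto simp: edge_of_def)
  have ai: "\<not> affine_dependent {a,b,c}" using two_simplex_affine_independent(1)[of a b c] T t by simp
  obtain C where C: "C \<subseteq> {a,b,c}" "E = convex hull C"
    using face_of_convex_hull_affine_independent[OF ai] F by auto
  have "aff_dim C = 1" using d C by (simp add: aff_dim_convex_hull)
  moreover have "\<not> affine_dependent C" using ai C affine_independent_subset by blast
  ultimately have "card C = 2" by (auto simp: affine_independent_iff_card)
  then obtain P Q where "C = {P, Q}" "P \<noteq> Q" by (auto simp: card_2_iff)
  thus ?thesis using that[of P Q] C t two_simplex_extreme_points[of a b c] T by (auto simp: segment_convex_hull)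
qed

lemma card_edges_two_simplex:
  fixes \<tau> :: triangle
  assumes T: "2 simplex \<tau>"
  shows "finite {E. E edge_of \<tau>}" "card {E. E edge_of \<tau>} \<le> 8"
proof -
  obtain a b c where t: "\<tau> = convex hull {a, b, c}" using two_simplex_vertices[OF T] .
  have ai: "\<not> affine_dependent {a,b,c}" using two_simplex_affine_independent(1)[of a b c] T t by simp
  have sub: "{E. E edge_of \<tau>} \<subseteq> (\<lambda>C. convex hull C) ` Pow {a,b,c}"
    using face_of_convex_hull_affine_independent[OF ai] t by (auto simp: edge_of_def)
  show "finite {E. E edge_of \<tau>}" by (rule finite_subset[OF sub]) auto
  have "card {E. E edge_of \<tau>} \<le> card (Pow {a,b,c})"
    by (rule surj_card_le[OF _ sub]) auto
  also have "\<dots> = 8" using two_simplex_affine_independent[of a b c] T t by (subst card_Pow) auto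
  finally show "card {E. E edge_of \<tau>} \<le> 8" .
qed

lemma edge_measure_closed_segment:
  assumes "E = closed_segment P Q"
  obtains a b where "E = closed_segment a b" "measure_on_compact (edge_measure E) E"
     "measure (edge_measure E) E = dist a b"
proof -
  define X where "X = (SOME (a, b). E = closed_segment a b)"
  have "case X of (a, b) \<Rightarrow> E = closed_segment a b"
    unfolding X_def using assms by (metis (mono_tags, lifting) case_prod_conv someI)
  moreover obtain a b where X: "X = (a, b)" by (cases X)
  ultimately have E: "E = closed_segment a b" by simp
  have M: "edge_measure E = distr (density (restrict_space lborel {0..1}) (\<lambda>_. ennreal (dist a b)))
          (restrict_space borel E) (\<lambda>s. a + s *\<^sub>R (b - a))"
    unfolding edge_measure_def X_def[symmetric] X by simp
  have im: "(\<lambda>s. a + s *\<^sub>R (b - a)) ` {0..1} = E"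
    unfolding E closed_segment_image_interval by (auto simp: algebra_simps)
  have cont: "continuous_on {0..1} (\<lambda>s. a + s *\<^sub>R (b - a))" by (intro continuous_intros)
  show ?thesis
    using that[OF E] distr_param_measure_on_compact(1,2)[OF compact_Icc cont im M] by simp
qed

section \<open>Finite elements on a closed triangulated surface\<close>

text \<open>In three dimensions, the vectors orthogonal to a triangle are the multiples of the cross
  product of two of its edges.\<close>

lemma orthogonal_to_triangle_imp_multiple:
  fixes \<tau> :: triangle
  assumes T: "2 simplex \<tau>" and m: "norm m = 1" "\<And>x y. x \<in> \<tau> \<Longrightarrow> y \<in> \<tau> \<Longrightarrow> m \<bullet> (x - y) = 0"
    and w: "\<And>x y. x \<in> \<tau> \<Longrightarrow> y \<in> \<tau> \<Longrightarrow> w \<bullet> (x - y) = 0"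
  shows "w = (m \<bullet> w) *\<^sub>R m"
proof -
  obtain a b c where t: "\<tau> = convex hull {a, b, c}" using two_simplex_vertices[OF T] .
  have abc: "a \<in> \<tau>" "b \<in> \<tau>" "c \<in> \<tau>" unfolding t by (auto intro: hull_inc)
  define k where "k = cross3 (b - a) (c - a)"
  have k: "k \<noteq> 0" unfolding k_def using two_simplex_cross T t by simp
  have par: "\<exists>s. z = s *\<^sub>R k" if z: "\<And>x y. x \<in> \<tau> \<Longrightarrow> y \<in> \<tau> \<Longrightarrow> z \<bullet> (x - y) = 0" for z
  proof -
    have "cross3 k z = (z \<bullet> (b - a)) *\<^sub>R (c - a) - (z \<bullet> (c - a)) *\<^sub>R (b - a)"
      unfolding k_def by (simp add: cross3_simps forall_3)
    hence "cross3 k z = 0" using z abc by simp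
    hence "collinear {0, k, z}" by (simp add: cross_eq_0)
    thus ?thesis using k unfolding collinear_lemma by (metis scale_zero_left)
  qed
  obtain s r where sr: "m = s *\<^sub>R k" "w = r *\<^sub>R k" using par[of m] par[of w] m w by metis
  have "s \<noteq> 0" using sr m by auto
  hence w': "w = (r / s) *\<^sub>R m" using sr by simp
  have "m \<bullet> w = r / s" unfolding w' using m(1) by (simp add: norm_eq_1)
  thus ?thesis using w' by simp
qed

text \<open>A convex set with empty interior determines a derivative only in the directions that
  point into the set; these are the ones compared here, along segments.\<close>

lemma has_derivative_within_convex_unique:
  fixes f :: "'a::real_inner \<Rightarrow> real"
  assumes K: "convex K" and xy: "x \<in> K" "y \<in> K"
    and p: "(f has_derivative (\<lambda>z. p \<bullet> z)) (at x within K)"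
    and q: "(f has_derivative (\<lambda>z. q \<bullet> z)) (at x within K)"
  shows "p \<bullet> (y - x) = q \<bullet> (y - x)"
proof -
  define l where "l = (\<lambda>t::real. x + t *\<^sub>R (y - x))"
  have l: "l ` {0..1} \<subseteq> K"
  proof safe
    fix t :: real assume "t \<in> {0..1}"
    hence "(1 - t) *\<^sub>R x + t *\<^sub>R y \<in> K" using K xy by (intro convexD) auto
    thus "l t \<in> K" by (simp add: l_def algebra_simps)
  qed
  have dl: "(l has_derivative (\<lambda>t. t *\<^sub>R (y - x))) (at 0 within {0..1})"
    unfolding l_def by (auto intro!: derivative_eq_intros)
  have *: "((f \<circ> l) has_vector_derivative (r \<bullet> (y - x))) (at 0 within {0..1})"
    if r: "(f has_derivative (\<lambda>z. r \<bullet> z)) (at x within K)" for r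
  proof -
    have "(f has_derivative (\<lambda>z. r \<bullet> z)) (at (l 0) within l ` {0..1})"
      using has_derivative_subset[OF r l] by (simp add: l_def)
    from diff_chain_within[OF dl this] show ?thesis
      by (simp add: has_vector_derivative_def o_def)
  qed
  show ?thesis
    by (rule vector_derivative_unique_within[OF _ *[OF p] *[OF q]])
       (simp add: trivial_limit_within islimpt_Icc)
qed

text \<open>The description operator in \<^const>\<open>surf_grad\<close> selects some ambient gradient. Two such
  gradients agree in the directions of the triangle, so they differ by a multiple of the normal, which
  the projection removes.\<close>

lemma surf_grad_affine:
  assumes T: "2 simplex \<tau>" and m: "norm (n \<tau>) = 1" "\<And>x y. x \<in> \<tau> \<Longrightarrow> y \<in> \<tau> \<Longrightarrow> n \<tau> \<bullet> (x - y) = 0"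
    and v: "\<And>x. x \<in> \<tau> \<Longrightarrow> v x = g \<bullet> x + \<beta>" and x: "x \<in> \<tau>"
  shows "surf_grad n v \<tau> x = tangent_proj (n \<tau>) g"
proof -
  have d: "(v has_derivative (\<lambda>y. g \<bullet> y)) (at x within \<tau>)"
  proof (rule has_derivative_transform_within[where f = "\<lambda>x. g \<bullet> x + \<beta>" and d = 1])
    show "((\<lambda>x. g \<bullet> x + \<beta>) has_derivative (\<bullet>) g) (at x within \<tau>)"
      by (auto intro!: derivative_eq_intros)
  qed (use x v in auto)
  define g' where "g' = (SOME a. (v has_derivative (\<lambda>y. a \<bullet> y)) (at x within \<tau>))"
  have d': "(v has_derivative (\<lambda>y. g' \<bullet> y)) (at x within \<tau>)"
    unfolding g'_def by (rule someI[of _ g]) (rule d)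
  have e: "(g' - g) \<bullet> (y - x) = 0" if "y \<in> \<tau>" for y
    using has_derivative_within_convex_unique[OF two_simplex_props(2)[OF T] x that d d']
    by (simp add: inner_diff_left)
  have "(g' - g) \<bullet> (y - z) = 0" if "y \<in> \<tau>" "z \<in> \<tau>" for y z
    using e[OF that(1)] e[OF that(2)] by (simp add: inner_diff_right)
  hence "g' - g = (n \<tau> \<bullet> (g' - g)) *\<^sub>R n \<tau>"
    by (intro orthogonal_to_triangle_imp_multiple[OF T m])
  hence "tangent_proj (n \<tau>) g' = tangent_proj (n \<tau>) g"
    unfolding tangent_proj_def by (simp add: algebra_simps inner_diff_right)
  thus ?thesis unfolding surf_grad_def g'_def .
qed

text \<open>With the edges \<open>u\<close>, \<open>w\<close> at the vertex \<open>a\<close> and \<open>k = u \<times> w\<close>, the vectors \<open>w \<times> k\<close> and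
  \<open>k \<times> u\<close> are, up to the factor \<open>k \<bullet> k\<close>, the dual basis of \<open>u\<close> and \<open>w\<close>.\<close>

lemma affine_interpolation_triangle:
  fixes val :: "real^3 \<Rightarrow> real"
  assumes T: "2 simplex \<tau>"
  shows "\<exists>g \<beta>. \<forall>Q. Q extreme_point_of \<tau> \<longrightarrow> g \<bullet> Q + \<beta> = val Q"
proof -
  obtain a b c where t: "\<tau> = convex hull {a, b, c}" using two_simplex_vertices[OF T] .
  define u where "u = b - a" define w where "w = c - a"
  define k where "k = cross3 u w"
  have k: "k \<bullet> k \<noteq> 0" unfolding k_def u_def w_def using two_simplex_cross T t by simp
  define g where "g = (1 / (k \<bullet> k)) *\<^sub>R ((val b - val a) *\<^sub>R cross3 w k + (val c - val a) *\<^sub>R cross3 k u)"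
  have "cross3 w k \<bullet> u = k \<bullet> k" "cross3 k u \<bullet> w = k \<bullet> k"
    unfolding k_def by (simp_all add: cross3_simps)
  hence g: "g \<bullet> u = val b - val a" "g \<bullet> w = val c - val a"
    unfolding g_def using k by (simp_all only: inner_add_left dot_cross_self inner_scaleR_left) auto
  have "\<forall>Q. Q extreme_point_of \<tau> \<longrightarrow> g \<bullet> Q + (val a - g \<bullet> a) = val Q"
    using two_simplex_extreme_points[of a b c] T t g by (auto simp: u_def w_def inner_diff_right)
  thus ?thesis by blast
qed

lemma affine_eq_from_extreme_points:
  fixes K :: "(real^3) set"
  assumes "compact K" "convex K" and "\<And>Q. Q extreme_point_of K \<Longrightarrow> g \<bullet> Q + \<beta> = h \<bullet> Q + \<eta>" and "x \<in> K"
  shows "g \<bullet> x + \<beta> = h \<bullet> x + \<eta>"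
proof -
  have eq: "{x. g \<bullet> x + \<beta> = h \<bullet> x + \<eta>} = {x. (g - h) \<bullet> x = \<eta> - \<beta>}"
    by (auto simp: inner_diff_left algebra_simps)
  have "convex hull {Q. Q extreme_point_of K} \<subseteq> {x. g \<bullet> x + \<beta> = h \<bullet> x + \<eta>}"
    using assms(3) by (intro hull_minimal) (auto simp only: eq[symmetric] mem_Collect_eq, simp add: eq convex_hyperplane)
  thus ?thesis using Krein_Milman_Minkowski[OF assms(1,2)] assms(4) by auto
qed

locale mesh_with_normals =
  fixes T :: mesh and n :: "triangle \<Rightarrow> real^3"
  assumes surface: "closed_triangulated_surface T"
    and unit_normal: "\<tau> \<in> T \<Longrightarrow> norm (n \<tau>) = 1"
    and normal_orthogonal: "\<tau> \<in> T \<Longrightarrow> x \<in> \<tau> \<Longrightarrow> y \<in> \<tau> \<Longrightarrow> n \<tau> \<bullet> (x - y) = 0"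
begin

abbreviation "G \<equiv> recovered_grad T n"
abbreviation "divG \<equiv> div_G T n"
abbreviation "avg E v \<equiv> edge_avg T E (div_G T n v)"
abbreviation "jump \<equiv> jump_G T n"
abbreviation "stab \<equiv> stab_form T n"

lemma finite_mesh: "finite T" and simplex: "\<tau> \<in> T \<Longrightarrow> 2 simplex \<tau>"
  and face: "\<tau> \<in> T \<Longrightarrow> \<tau>' \<in> T \<Longrightarrow> \<tau> \<inter> \<tau>' face_of \<tau>"
  using surface by (auto simp: closed_triangulated_surface_def triangulation_def)

lemmas tri_compact = two_simplex_props(1)[OF simplex]
lemmas tri_convex = two_simplex_props(2)[OF simplex]
lemmas tri_nonempty = two_simplex_props(3)[OF simplex]

lemma compact_mesh_union: "compact (\<Union>T)"
  by (intro compact_Union finite_mesh tri_compact)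

lemma finite_nodes: "finite (nodes T)"
proof -
  have "nodes T = (\<Union>\<tau>\<in>T. {P. P extreme_point_of \<tau>})" by (auto simp: nodes_def)
  moreover have "finite {P. P extreme_point_of \<tau>}" if T: "\<tau> \<in> T" for \<tau>
  proof -
    obtain a b c where t: "\<tau> = convex hull {a, b, c}" using two_simplex_vertices[OF simplex[OF T]] .
    thus ?thesis using two_simplex_extreme_points[of a b c] simplex[OF T] by simp
  qed
  ultimately show ?thesis using finite_mesh by auto
qed

lemma continuous_on_mesh_union:
  fixes f :: "real^3 \<Rightarrow> 'b::topological_space"
  assumes "\<And>\<tau>. \<tau> \<in> T \<Longrightarrow> continuous_on \<tau> f"
  shows "continuous_on (\<Union>T) f"
proof -
  have "continuous_on (\<Union>\<tau>\<in>T. id \<tau>) f"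
    by (rule continuous_on_closed_Union) (use finite_mesh tri_compact assms in \<open>auto intro: compact_imp_closed\<close>)
  thus ?thesis by simp
qed

text \<open>This is where conformity of the mesh enters. Two triangles meet in a common face, which is
  the hull of its extreme points; these are vertices of both triangles, so the two affine interpolants
  agree on the face and the pieces fit together continuously.\<close>

lemma fe_space_interpolant:
  obtains v where "v \<in> fe_space T" "\<And>Q. Q \<in> nodes T \<Longrightarrow> v Q = val Q"
proof -
  have "\<forall>\<tau>\<in>T. \<exists>g \<beta>. \<forall>Q. Q extreme_point_of \<tau> \<longrightarrow> g \<bullet> Q + \<beta> = val Q"
    using affine_interpolation_triangle[OF simplex] by blast
  then obtain g \<beta> where gb: "\<And>\<tau> Q. \<tau> \<in> T \<Longrightarrow> Q extreme_point_of \<tau> \<Longrightarrow> g \<tau> \<bullet> Q + \<beta> \<tau> = val Q"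
    by metis
  have agree: "g \<tau> \<bullet> x + \<beta> \<tau> = g \<tau>' \<bullet> x + \<beta> \<tau>'" if t: "\<tau> \<in> T" "\<tau>' \<in> T" and x: "x \<in> \<tau>" "x \<in> \<tau>'" for \<tau> \<tau>' x
  proof (rule affine_eq_from_extreme_points[where K = "\<tau> \<inter> \<tau>'"])
    show "compact (\<tau> \<inter> \<tau>')" "convex (\<tau> \<inter> \<tau>')"
      using t tri_compact tri_convex by (auto intro: compact_Int convex_Int)
    fix Q assume "Q extreme_point_of \<tau> \<inter> \<tau>'"
    hence "Q extreme_point_of \<tau>" "Q extreme_point_of \<tau>'"
      using extreme_point_of_face[OF face] t by (blast, metis Int_commute)
    thus "g \<tau> \<bullet> Q + \<beta> \<tau> = g \<tau>' \<bullet> Q + \<beta> \<tau>'" using gb t by simp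
  qed (use x in auto)
  define v where "v = (\<lambda>x. if x \<in> \<Union>T then let \<tau> = (SOME \<tau>. \<tau> \<in> T \<and> x \<in> \<tau>) in g \<tau> \<bullet> x + \<beta> \<tau> else 0)"
  have v: "v x = g \<tau> \<bullet> x + \<beta> \<tau>" if "\<tau> \<in> T" "x \<in> \<tau>" for x \<tau>
  proof -
    let ?s = "SOME \<tau>. \<tau> \<in> T \<and> x \<in> \<tau>"
    have s: "?s \<in> T \<and> x \<in> ?s"
      by (rule someI[of _ \<tau>]) (use that in blast)
    have "x \<in> \<Union>T" using that by blast
    hence "v x = g ?s \<bullet> x + \<beta> ?s" unfolding v_def Let_def by (rule if_P)
    also have "\<dots> = g \<tau> \<bullet> x + \<beta> \<tau>" using s that by (intro agree) blast+
    finally show ?thesis .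
  qed
  have "continuous_on (\<Union>T) v"
  proof (rule continuous_on_mesh_union)
    fix \<tau> assume "\<tau> \<in> T"
    hence "continuous_on \<tau> v \<longleftrightarrow> continuous_on \<tau> (\<lambda>x. g \<tau> \<bullet> x + \<beta> \<tau>)"
      by (intro continuous_on_cong) (auto simp: v)
    thus "continuous_on \<tau> v" by (auto intro!: continuous_intros)
  qed
  moreover have "v x = 0" if "x \<notin> \<Union>T" for x unfolding v_def using that by (rule if_not_P)
  ultimately have "v \<in> fe_space T" unfolding fe_space_def using v by blast
  moreover have "v Q = val Q" if Q: "Q \<in> nodes T" for Q
  proof -
    obtain \<tau> where t: "\<tau> \<in> T" "Q extreme_point_of \<tau>" using Q by (auto simp: nodes_def)
    hence "Q \<in> \<tau>" by (simp add: extreme_point_of_def)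
    thus ?thesis using gb[OF t] v[OF t(1)] by simp
  qed
  ultimately show ?thesis using that by blast
qed

lemma fe_space_affine:
  assumes "v \<in> fe_space T" "\<tau> \<in> T"
  obtains g \<beta> where "\<And>x. x \<in> \<tau> \<Longrightarrow> v x = g \<bullet> x + \<beta>"
proof -
  have "\<exists>g \<beta>. \<forall>x\<in>\<tau>. v x = g \<bullet> x + \<beta>" using assms unfolding fe_space_def by blast
  thus ?thesis using that by blast
qed

lemma fe_space_eqI:
  assumes u: "u \<in> fe_space T" and v: "v \<in> fe_space T" and eq: "\<And>Q. Q \<in> nodes T \<Longrightarrow> u Q = v Q"
  shows "u = v"
proof
  fix x show "u x = v x"
  proof (cases "x \<in> \<Union>T")
    case False thus ?thesis using u v by (auto simp: fe_space_def)
  next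
    case True
    then obtain \<tau> where t: "\<tau> \<in> T" "x \<in> \<tau>" by auto
    obtain g \<beta> where g: "\<And>x. x \<in> \<tau> \<Longrightarrow> u x = g \<bullet> x + \<beta>" using fe_space_affine[OF u t(1)] by blast
    obtain h \<eta> where h: "\<And>x. x \<in> \<tau> \<Longrightarrow> v x = h \<bullet> x + \<eta>" using fe_space_affine[OF v t(1)] by blast
    have "g \<bullet> x + \<beta> = h \<bullet> x + \<eta>"
      using tri_compact[OF t(1)] tri_convex[OF t(1)]
    proof (rule affine_eq_from_extreme_points)
      fix Q assume Q: "Q extreme_point_of \<tau>"
      hence "Q \<in> nodes T" "Q \<in> \<tau>" using t by (auto simp: nodes_def extreme_point_of_def)
      thus "g \<bullet> Q + \<beta> = h \<bullet> Q + \<eta>" using eq[of Q] g[of Q] h[of Q] by linarith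
    qed fact
    thus ?thesis using g[OF t(2)] h[OF t(2)] by linarith
  qed
qed

text \<open>Existence and uniqueness give meaning to the definite description in
  \<^const>\<open>nodal_basis\<close>.\<close>

lemma nodal_basis:
  assumes "P \<in> nodes T"
  shows "nodal_basis T P \<in> fe_space T"
    and "Q \<in> nodes T \<Longrightarrow> nodal_basis T P Q = (if Q = P then 1 else 0)"
proof -
  let ?p = "\<lambda>\<phi>. \<phi> \<in> fe_space T \<and> (\<forall>Q\<in>nodes T. \<phi> Q = (if Q = P then 1 else 0))"
  obtain v where v: "v \<in> fe_space T" "\<And>Q. Q \<in> nodes T \<Longrightarrow> v Q = (if Q = P then 1 else 0)"
    using fe_space_interpolant[of "\<lambda>Q. if Q = P then 1 else 0"] by blast
  have "\<exists>!\<phi>. ?p \<phi>"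
  proof (rule ex1I[of _ v])
    show "?p v" using v by simp
    fix w assume w: "?p w"
    show "w = v" by (rule fe_space_eqI) (use v w in simp_all)
  qed
  hence "?p (nodal_basis T P)" unfolding nodal_basis_def by (rule theI')
  thus "nodal_basis T P \<in> fe_space T"
    and "Q \<in> nodes T \<Longrightarrow> nodal_basis T P Q = (if Q = P then 1 else 0)" by auto
qed

lemma fe_space_lincomb:
  assumes "u \<in> fe_space T" "v \<in> fe_space T"
  shows "(\<lambda>x. a * u x + b * v x) \<in> fe_space T"
  unfolding fe_space_def
proof (rule CollectI, intro conjI ballI allI impI)
  show "continuous_on (\<Union>T) (\<lambda>x. a * u x + b * v x)"
    using assms by (auto simp: fe_space_def intro!: continuous_intros)
  fix \<tau> assume t: "\<tau> \<in> T"
  obtain g \<beta> where g: "\<And>x. x \<in> \<tau> \<Longrightarrow> u x = g \<bullet> x + \<beta>" using fe_space_affine[OF assms(1) t] by blast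
  obtain h \<eta> where h: "\<And>x. x \<in> \<tau> \<Longrightarrow> v x = h \<bullet> x + \<eta>" using fe_space_affine[OF assms(2) t] by blast
  have "\<forall>x\<in>\<tau>. a * u x + b * v x = (a *\<^sub>R g + b *\<^sub>R h) \<bullet> x + (a * \<beta> + b * \<eta>)"
    by (simp add: g h inner_add_left algebra_simps)
  thus "\<exists>aa ba. \<forall>x\<in>\<tau>. a * u x + b * v x = aa \<bullet> x + ba" by blast
qed (use assms in \<open>auto simp: fe_space_def\<close>)

lemma fe_space_zero: "(\<lambda>x. 0) \<in> fe_space T"
  unfolding fe_space_def by (auto intro: exI[of _ 0])

lemma fe_space_sum:
  assumes "finite I" "\<And>i. i \<in> I \<Longrightarrow> b i \<in> fe_space T"
  shows "(\<lambda>x. \<Sum>i\<in>I. c i * b i x) \<in> fe_space T"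
  using assms
proof (induction I rule: finite_induct)
  case empty thus ?case by (simp add: fe_space_zero)
next
  case (insert i I)
  have "(\<lambda>x. c i * b i x + 1 * (\<Sum>i\<in>I. c i * b i x)) \<in> fe_space T"
    by (rule fe_space_lincomb) (use insert in auto)
  thus ?case using insert by simp
qed

lemma fe_space_one: "(\<lambda>x. if x \<in> \<Union>T then 1 else 0) \<in> fe_space T"
  unfolding fe_space_def
proof (rule CollectI, intro conjI ballI allI impI)
  show "continuous_on (\<Union> T) (\<lambda>x. if x \<in> \<Union> T then 1 else (0::real))"
    by (subst continuous_on_cong[OF refl, where g = "\<lambda>_. 1"]) auto
  fix \<tau> assume "\<tau> \<in> T"
  hence "\<forall>x\<in>\<tau>. (if x \<in> \<Union> T then 1 else 0) = 0 \<bullet> x + (1::real)" by auto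
  thus "\<exists>a b. \<forall>x\<in>\<tau>. (if x \<in> \<Union> T then 1 else 0) = a \<bullet> x + (b::real)" by blast
qed auto

lemma nodal_expansion:
  assumes "v \<in> fe_space T"
  shows "v = (\<lambda>x. \<Sum>P\<in>nodes T. v P * nodal_basis T P x)"
proof (rule fe_space_eqI[OF assms])
  show "(\<lambda>x. \<Sum>P\<in>nodes T. v P * nodal_basis T P x) \<in> fe_space T"
    by (rule fe_space_sum) (auto simp: finite_nodes nodal_basis)
  fix Q assume Q: "Q \<in> nodes T"
  have "(\<Sum>P\<in>nodes T. v P * nodal_basis T P Q) = (\<Sum>P\<in>nodes T. if P = Q then v P else 0)"
    by (rule sum.cong) (auto simp: nodal_basis(2) Q)
  thus "v Q = (\<Sum>P\<in>nodes T. v P * nodal_basis T P Q)" using Q finite_nodes by (simp add: sum.delta)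
qed

lemma surf_grad_of_affine:
  assumes t: "\<tau> \<in> T" and v: "\<And>x. x \<in> \<tau> \<Longrightarrow> v x = g \<bullet> x + \<beta>" and x: "x \<in> \<tau>"
  shows "surf_grad n v \<tau> x = tangent_proj (n \<tau>) g"
  by (rule surf_grad_affine[where g = g and \<beta> = \<beta>])
     (use simplex[OF t] unit_normal[OF t] normal_orthogonal[OF t] v x in blast)+

lemma fe_surf_grad:
  assumes v: "v \<in> fe_space T" and t: "\<tau> \<in> T"
  shows "\<exists>g. n \<tau> \<bullet> g = 0 \<and> (\<forall>x\<in>\<tau>. surf_grad n v \<tau> x = g) \<and>
    (\<forall>x\<in>\<tau>. \<forall>y\<in>\<tau>. v x - v y = g \<bullet> (x - y))"
proof -
  obtain g \<beta> where g: "\<And>x. x \<in> \<tau> \<Longrightarrow> v x = g \<bullet> x + \<beta>" using fe_space_affine[OF v t] by blast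
  show ?thesis
  proof (intro exI[of _ "tangent_proj (n \<tau>) g"] conjI ballI)
    show "n \<tau> \<bullet> tangent_proj (n \<tau>) g = 0"
      using unit_normal[OF t] by (simp add: tangent_proj_def inner_diff_right norm_eq_1)
    show "surf_grad n v \<tau> x = tangent_proj (n \<tau>) g" if "x \<in> \<tau>" for x
      by (rule surf_grad_of_affine[OF t g that])
    show "v x - v y = tangent_proj (n \<tau>) g \<bullet> (x - y)" if "x \<in> \<tau>" "y \<in> \<tau>" for x y
      unfolding tangent_proj_def inner_diff_left inner_scaleR_left normal_orthogonal[OF t that]
      using that by (simp add: g inner_diff_right)
  qed
qed

lemma surf_grad_lincomb:
  assumes u: "u \<in> fe_space T" and v: "v \<in> fe_space T" and t: "\<tau> \<in> T" and x: "x \<in> \<tau>"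
  shows "surf_grad n (\<lambda>x. a * u x + b * v x) \<tau> x = a *\<^sub>R surf_grad n u \<tau> x + b *\<^sub>R surf_grad n v \<tau> x"
proof -
  obtain g \<beta> where g: "\<And>x. x \<in> \<tau> \<Longrightarrow> u x = g \<bullet> x + \<beta>" using fe_space_affine[OF u t] by blast
  obtain h \<eta> where h: "\<And>x. x \<in> \<tau> \<Longrightarrow> v x = h \<bullet> x + \<eta>" using fe_space_affine[OF v t] by blast
  have gh: "a * u x + b * v x = (a *\<^sub>R g + b *\<^sub>R h) \<bullet> x + (a * \<beta> + b * \<eta>)" if "x \<in> \<tau>" for x
    using that by (simp add: g h inner_add_left algebra_simps)
  have "surf_grad n u \<tau> x = tangent_proj (n \<tau>) g" "surf_grad n v \<tau> x = tangent_proj (n \<tau>) h"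
    "surf_grad n (\<lambda>x. a * u x + b * v x) \<tau> x = tangent_proj (n \<tau>) (a *\<^sub>R g + b *\<^sub>R h)"
    using surf_grad_of_affine[OF t g x] surf_grad_of_affine[OF t h x] surf_grad_of_affine[OF t gh x] by blast+
  thus ?thesis by (simp only: tangent_proj_def) (simp add: algebra_simps inner_add_right)
qed

end

section \<open>The bilinear form and its coercivity\<close>

context mesh_with_normals
begin

lemma tri_integrable:
  fixes f :: "real^3 \<Rightarrow> 'b::euclidean_space"
  assumes "\<tau> \<in> T" "continuous_on \<tau> f"
  shows "integrable (tri_measure \<tau>) f"
  by (rule integrable_on_compact[OF tri_measure_on_compact[OF simplex[OF assms(1)]] assms(2)])

lemma space_tri_measure: "\<tau> \<in> T \<Longrightarrow> space (tri_measure \<tau>) = \<tau>"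
  by (rule measure_on_compact_space[OF tri_measure_on_compact[OF simplex]])

lemma surf_integral_cong:
  assumes "\<And>\<tau> x. \<tau> \<in> A \<Longrightarrow> x \<in> \<tau> \<Longrightarrow> w \<tau> x = z \<tau> x" "A \<subseteq> T"
  shows "surf_integral A w = surf_integral A z"
  unfolding surf_integral_def
  by (intro sum.cong Bochner_Integration.integral_cong refl) (use assms space_tri_measure in auto)

lemma surf_integral_lincomb:
  fixes w z :: "'b::euclidean_space broken"
  assumes A: "A \<subseteq> T"
    and "\<And>\<tau>. \<tau> \<in> A \<Longrightarrow> continuous_on \<tau> (w \<tau>)" "\<And>\<tau>. \<tau> \<in> A \<Longrightarrow> continuous_on \<tau> (z \<tau>)"
  shows "surf_integral A (\<lambda>\<tau> x. a *\<^sub>R w \<tau> x + b *\<^sub>R z \<tau> x) = a *\<^sub>R surf_integral A w + b *\<^sub>R surf_integral A z"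
proof -
  have "(\<integral>x. a *\<^sub>R w \<tau> x + b *\<^sub>R z \<tau> x \<partial>tri_measure \<tau>) =
      a *\<^sub>R (\<integral>x. w \<tau> x \<partial>tri_measure \<tau>) + b *\<^sub>R (\<integral>x. z \<tau> x \<partial>tri_measure \<tau>)" if "\<tau> \<in> A" for \<tau>
  proof -
    have "integrable (tri_measure \<tau>) (w \<tau>)" "integrable (tri_measure \<tau>) (z \<tau>)"
      using that assms by (auto intro!: tri_integrable)
    thus ?thesis by simp
  qed
  thus ?thesis unfolding surf_integral_def
    by (simp add: sum.distrib scaleR_sum_right)
qed

lemma integral_const_on_triangle:
  fixes c :: "'b::euclidean_space"
  assumes "\<tau> \<in> T" "\<And>x. x \<in> \<tau> \<Longrightarrow> f x = c"
  shows "(\<integral>x. f x \<partial>tri_measure \<tau>) = tri_area \<tau> *\<^sub>R c"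
proof -
  have "(\<integral>x. f x \<partial>tri_measure \<tau>) = (\<integral>x. c \<partial>tri_measure \<tau>)"
    by (rule Bochner_Integration.integral_cong) (use assms space_tri_measure in auto)
  also have "\<dots> = tri_area \<tau> *\<^sub>R c"
    using assms(1) by (simp add: space_tri_measure tri_area_def)
  finally show ?thesis .
qed

lemma surf_area_eq: "surf_area A = (\<Sum>\<tau>\<in>A. tri_area \<tau>)"
  unfolding surf_area_def tri_area_def ..

text \<open>The pointwise relation is required on the triangles only, since surface gradients are
  linear in their argument only there.\<close>

lemma surf_inner_lincomb:
  fixes f g h k :: "'b::euclidean_space broken"
  assumes "\<And>\<tau> x. \<tau> \<in> T \<Longrightarrow> x \<in> \<tau> \<Longrightarrow> f \<tau> x = a *\<^sub>R g \<tau> x + b *\<^sub>R h \<tau> x"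
    and "\<And>\<tau>. \<tau> \<in> T \<Longrightarrow> continuous_on \<tau> (g \<tau>)" "\<And>\<tau>. \<tau> \<in> T \<Longrightarrow> continuous_on \<tau> (h \<tau>)"
    "\<And>\<tau>. \<tau> \<in> T \<Longrightarrow> continuous_on \<tau> (k \<tau>)"
  shows "surf_inner T f k = a * surf_inner T g k + b * surf_inner T h k"
proof -
  have "surf_inner T f k = surf_integral T (\<lambda>\<tau> x. a *\<^sub>R (g \<tau> x \<bullet> k \<tau> x) + b *\<^sub>R (h \<tau> x \<bullet> k \<tau> x))"
    unfolding surf_inner_def by (rule surf_integral_cong) (auto simp: assms(1) inner_add_left)
  also have "\<dots> = a *\<^sub>R surf_inner T g k + b *\<^sub>R surf_inner T h k"
    unfolding surf_inner_def
    by (rule surf_integral_lincomb) (auto intro!: continuous_intros assms(2-))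
  finally show ?thesis by simp
qed

lemma surf_inner_commute: "surf_inner A f g = surf_inner A g f"
  unfolding surf_inner_def by (simp add: inner_commute)

lemma surf_inner_nonneg: 
  assumes "\<And>\<tau>. \<tau> \<in> T \<Longrightarrow> continuous_on \<tau> (f \<tau>)"
  shows "surf_inner T f f \<ge> 0"
  unfolding surf_inner_def surf_integral_def by (intro sum_nonneg integral_nonneg_AE AE_I2) auto

lemma surf_inner_self_eq_0:
  fixes f :: "'b::euclidean_space broken"
  assumes c: "\<And>\<tau>. \<tau> \<in> T \<Longrightarrow> continuous_on \<tau> (f \<tau>)" and z: "surf_inner T f f = 0"
    and t: "\<tau> \<in> T" and x: "x \<in> \<tau>"
  shows "f \<tau> x = 0"
proof -
  have nn: "(\<integral>x. f \<tau> x \<bullet> f \<tau> x \<partial>tri_measure \<tau>) \<ge> 0" for \<tau>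
    by (intro integral_nonneg_AE AE_I2) auto
  have "(\<integral>x. f \<tau> x \<bullet> f \<tau> x \<partial>tri_measure \<tau>) = 0"
    using z t finite_mesh nn unfolding surf_inner_def surf_integral_def
    by (subst (asm) sum_nonneg_eq_0_iff) auto
  hence "f \<tau> x \<bullet> f \<tau> x = 0"
    by (rule integral_tri_measure_eq_0_imp[OF simplex[OF t] _ _ _ x, rotated 2])
       (auto intro!: continuous_intros c t)
  thus ?thesis by simp
qed

lemma surf_grad_const_on:
  assumes "v \<in> fe_space T" "\<tau> \<in> T"
  shows "\<exists>g. \<forall>x\<in>\<tau>. surf_grad n v \<tau> x = g"
  using fe_surf_grad[OF assms] by blast

lemma continuous_on_surf_grad:
  assumes "v \<in> fe_space T" "\<tau> \<in> T"
  shows "continuous_on \<tau> (surf_grad n v \<tau>)"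
proof -
  obtain g where "\<forall>x\<in>\<tau>. surf_grad n v \<tau> x = g" using surf_grad_const_on[OF assms] ..
  hence "continuous_on \<tau> (surf_grad n v \<tau>) \<longleftrightarrow> continuous_on \<tau> (\<lambda>_. g)"
    by (intro continuous_on_cong) auto
  thus ?thesis by simp
qed

lemma recovered_grad_at_lincomb:
  assumes "u \<in> fe_space T" "v \<in> fe_space T"
  shows "recovered_grad_at T n (\<lambda>x. a * u x + b * v x) P =
     a *\<^sub>R recovered_grad_at T n u P + b *\<^sub>R recovered_grad_at T n v P"
proof -
  have sub: "patch T P \<subseteq> T" by (auto simp: patch_def)
  have "surf_integral (patch T P) (surf_grad n (\<lambda>x. a * u x + b * v x)) =
    surf_integral (patch T P) (\<lambda>\<tau> x. a *\<^sub>R surf_grad n u \<tau> x + b *\<^sub>R surf_grad n v \<tau> x)"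
    by (rule surf_integral_cong[OF _ sub]) (use assms sub surf_grad_lincomb in blast)
  also have "\<dots> = a *\<^sub>R surf_integral (patch T P) (surf_grad n u) + b *\<^sub>R surf_integral (patch T P) (surf_grad n v)"
    by (rule surf_integral_lincomb[OF sub]) (use assms sub continuous_on_surf_grad in blast)+
  finally show ?thesis
    unfolding recovered_grad_at_def by (simp add: algebra_simps)
qed

lemma recovered_grad_lincomb:
  assumes "u \<in> fe_space T" "v \<in> fe_space T"
  shows "G (\<lambda>x. a * u x + b * v x) x =
     a *\<^sub>R G u x + b *\<^sub>R G v x"
  unfolding recovered_grad_def recovered_grad_at_lincomb[OF assms]
  by (simp add: scaleR_sum_right sum.distrib scaleR_add_right mult.commute)

text \<open>The components being finite element functions, the divergence of a recovered gradient
  is constant on each triangle.\<close>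

lemma recovered_grad_component: "(\<lambda>x. G v x $ i) \<in> fe_space T"
proof -
  have "(\<lambda>x. \<Sum>P\<in>nodes T. (recovered_grad_at T n v P $ i) * nodal_basis T P x) \<in> fe_space T"
    by (rule fe_space_sum) (auto simp: finite_nodes nodal_basis)
  thus ?thesis by (simp add: recovered_grad_def mult.commute)
qed

lemma fe_space_continuous: "v \<in> fe_space T \<Longrightarrow> continuous_on (\<Union>T) v"
  by (simp add: fe_space_def)

lemma continuous_on_recovered_grad: "continuous_on (\<Union>T) (G v)"
  unfolding recovered_grad_def
  by (intro continuous_intros fe_space_continuous nodal_basis)

lemma div_G_lincomb:
  assumes "u \<in> fe_space T" "v \<in> fe_space T" "\<tau> \<in> T" "x \<in> \<tau>"
  shows "divG (\<lambda>x. a * u x + b * v x) \<tau> x = a * divG u \<tau> x + b * divG v \<tau> x"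
proof -
  have "surf_grad n (\<lambda>y. G (\<lambda>x. a * u x + b * v x) y $ i) \<tau> x =
      a *\<^sub>R surf_grad n (\<lambda>y. G u y $ i) \<tau> x +
      b *\<^sub>R surf_grad n (\<lambda>y. G v y $ i) \<tau> x" for i
    using surf_grad_lincomb[OF recovered_grad_component[of u i] recovered_grad_component[of v i] assms(3,4), of a b]
    unfolding recovered_grad_lincomb[OF assms(1,2)] by simp
  thus ?thesis unfolding div_G_def surf_div_def
    by (simp add: sum.distrib sum_distrib_left)
qed

lemma div_G_constant:
  assumes "\<tau> \<in> T"
  obtains d where "\<And>x. x \<in> \<tau> \<Longrightarrow> divG v \<tau> x = d"
proof -
  have "\<exists>g. \<forall>x\<in>\<tau>. surf_grad n (\<lambda>y. G v y $ i) \<tau> x = g" for i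
    by (rule surf_grad_const_on[OF recovered_grad_component assms])
  hence "\<exists>g. \<forall>i. \<forall>x\<in>\<tau>. surf_grad n (\<lambda>y. G v y $ i) \<tau> x = g i" by (intro choice allI)
  then obtain g where "\<forall>i. \<forall>x\<in>\<tau>. surf_grad n (\<lambda>y. G v y $ i) \<tau> x = g i" ..
  thus ?thesis using that[of "\<Sum>i\<in>UNIV. g i $ i"] by (simp add: div_G_def surf_div_def)
qed

lemma continuous_on_div_G:
  assumes "\<tau> \<in> T"
  shows "continuous_on \<tau> (divG v \<tau>)"
proof -
  obtain d where "\<And>x. x \<in> \<tau> \<Longrightarrow> divG v \<tau> x = d" using div_G_constant[OF assms] by blast
  hence "continuous_on \<tau> (divG v \<tau>) \<longleftrightarrow> continuous_on \<tau> (\<lambda>_. d)"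
    by (intro continuous_on_cong) auto
  thus ?thesis by simp
qed

lemma edges_D:
  assumes "E \<in> edges T"
  obtains \<tau>1 \<tau>2 where "\<tau>1 \<noteq> \<tau>2" "{\<tau>\<in>T. E edge_of \<tau>} = {\<tau>1, \<tau>2}"
  using assms surface unfolding closed_triangulated_surface_def card_2_iff by blast

lemma edge_subset: "E edge_of \<tau> \<Longrightarrow> \<tau> \<in> T \<Longrightarrow> E \<subseteq> \<tau> \<and> E \<subseteq> \<Union>T"
  using edge_of_imp_subset by blast

lemma dist_le_mesh_size:
  assumes "\<tau> \<in> T" "x \<in> \<tau>" "y \<in> \<tau>"
  shows "dist x y \<le> mesh_size T"
proof -
  have "dist x y \<le> diameter \<tau>"
    using assms by (intro diameter_bounded_bound compact_imp_bounded tri_compact)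
  moreover have "diameter \<tau> \<le> mesh_size T" unfolding mesh_size_def using assms finite_mesh by auto
  ultimately show ?thesis by linarith
qed

lemma edge_props:
  assumes "E \<in> edges T"
  shows "measure_on_compact (edge_measure E) E" "measure (edge_measure E) E \<le> mesh_size T" "E \<subseteq> \<Union>T"
proof -
  obtain \<tau> where t: "\<tau> \<in> T" "E edge_of \<tau>" using assms by (auto simp: edges_def)
  obtain P Q where "E = closed_segment P Q" using edge_of_two_simplex[OF simplex t(2)] t by metis
  then obtain a b where E: "E = closed_segment a b" and 1: "measure_on_compact (edge_measure E) E"
     and 2: "measure (edge_measure E) E = dist a b" by (rule edge_measure_closed_segment)
  show "measure_on_compact (edge_measure E) E" by fact
  have "a \<in> \<tau>" "b \<in> \<tau>" using edge_of_imp_subset[OF t(2)] E by auto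
  thus "measure (edge_measure E) E \<le> mesh_size T" using dist_le_mesh_size[OF t(1)] 2 by simp
  show "E \<subseteq> \<Union>T" using edge_of_imp_subset[OF t(2)] t by auto
qed

lemma finite_edges: "finite (edges T)"
proof -
  have "edges T = (\<Union>\<tau>\<in>T. {E. E edge_of \<tau>})" by (auto simp: edges_def)
  thus ?thesis using finite_mesh card_edges_two_simplex(1)[OF simplex] by simp
qed

lemma edge_integrable:
  assumes "E \<in> edges T" "continuous_on E (f :: _ \<Rightarrow> real)"
  shows "integrable (edge_measure E) f"
  by (rule integrable_on_compact[OF edge_props(1)[OF assms(1)] assms(2)])

lemma space_edge_measure: "E \<in> edges T \<Longrightarrow> space (edge_measure E) = E"
  by (rule measure_on_compact_space[OF edge_props(1)])

lemma edge_inner_lincomb: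
  assumes E: "E \<in> edges T" and "\<And>x. x \<in> E \<Longrightarrow> f x = a * g x + b * h x"
    and "continuous_on E g" "continuous_on E h" "continuous_on E k"
  shows "edge_inner E f k = a * edge_inner E g k + b * edge_inner E h k"
proof -
  have "edge_inner E f k = (\<integral>x. a * (g x * k x) + b * (h x * k x) \<partial>edge_measure E)"
    unfolding edge_inner_def
    by (rule Bochner_Integration.integral_cong) (auto simp: space_edge_measure[OF E] assms(2) algebra_simps)
  also have "\<dots> = a * edge_inner E g k + b * edge_inner E h k"
  proof -
    have "integrable (edge_measure E) (\<lambda>x. g x * k x)" "integrable (edge_measure E) (\<lambda>x. h x * k x)"
      by (intro edge_integrable[OF E] continuous_intros assms(3-))+
    thus ?thesis unfolding edge_inner_def by simp
  qed
  finally show ?thesis .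
qed

lemma edge_inner_commute: "edge_inner E f g = edge_inner E g f"
  unfolding edge_inner_def by (simp add: mult.commute)

lemma edge_inner_nonneg: "edge_inner E f f \<ge> 0"
  unfolding edge_inner_def by (intro integral_nonneg_AE AE_I2) auto

lemma edge_inner_young:
  assumes E: "E \<in> edges T" and f: "continuous_on E f" and g: "continuous_on E g" and e: "\<epsilon> > 0"
  shows "2 * edge_inner E f g \<le> \<epsilon> * edge_inner E f f + edge_inner E g g / \<epsilon>"
proof -
  have i: "integrable (edge_measure E) (\<lambda>x. f x * g x)" "integrable (edge_measure E) (\<lambda>x. f x * f x)"
    "integrable (edge_measure E) (\<lambda>x. g x * g x)"
    by (intro edge_integrable[OF E] continuous_intros f g)+
  have y: "2 * (f x * g x) \<le> \<epsilon> * (f x * f x) + (g x * g x) / \<epsilon>" for x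
  proof -
    have "0 \<le> (\<epsilon> * f x - g x)\<^sup>2 / \<epsilon>" using e by simp
    also have "\<dots> = \<epsilon> * (f x * f x) + (g x * g x) / \<epsilon> - 2 * (f x * g x)"
      using e by (simp add: field_simps power2_eq_square)
    finally show ?thesis by simp
  qed
  have "2 * edge_inner E f g = (\<integral>x. 2 * (f x * g x) \<partial>edge_measure E)"
    by (simp add: edge_inner_def)
  also have "\<dots> \<le> (\<integral>x. \<epsilon> * (f x * f x) + (g x * g x) / \<epsilon> \<partial>edge_measure E)"
    by (rule integral_mono) (use i y in auto)
  also have "\<dots> = \<epsilon> * edge_inner E f f + edge_inner E g g / \<epsilon>"
    using i by (simp add: edge_inner_def)
  finally show ?thesis .
qed

lemma continuous_on_jump_G:
  assumes "E \<in> edges T"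
  shows "continuous_on E (jump E v)"
  unfolding jump_G_def conormal_jump_def
  by (intro continuous_intros continuous_on_subset[OF continuous_on_recovered_grad] edge_props(3) assms)

lemma continuous_on_edge_avg:
  assumes "E \<in> edges T"
  shows "continuous_on E (avg E v)"
  unfolding edge_avg_def using edge_subset
  by (intro continuous_intros continuous_on_subset[OF continuous_on_div_G]) auto

lemma jump_G_lincomb:
  assumes "u \<in> fe_space T" "v \<in> fe_space T"
  shows "jump E (\<lambda>x. a * u x + b * v x) x = a * jump E u x + b * jump E v x"
  unfolding jump_G_def conormal_jump_def recovered_grad_lincomb[OF assms]
  by (simp add: inner_add_left sum.distrib sum_distrib_left)

lemma edge_avg_lincomb:
  assumes "u \<in> fe_space T" "v \<in> fe_space T" "E \<in> edges T" "x \<in> E"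
  shows "avg E (\<lambda>x. a * u x + b * v x) x =
     a * avg E u x + b * avg E v x"
proof -
  have "(\<Sum>\<tau> | \<tau> \<in> T \<and> E edge_of \<tau>. divG (\<lambda>x. a * u x + b * v x) \<tau> x) =
    (\<Sum>\<tau> | \<tau> \<in> T \<and> E edge_of \<tau>. a * divG u \<tau> x + b * divG v \<tau> x)"
    by (rule sum.cong) (use assms(4) in \<open>auto intro!: div_G_lincomb assms dest: edge_of_imp_subset\<close>)
  thus ?thesis unfolding edge_avg_def
    by (simp add: sum.distrib sum_distrib_left[symmetric] add_divide_distrib)
qed

lemma continuous_on_stab:
  assumes "v \<in> fe_space T" "\<tau> \<in> T"
  shows "continuous_on \<tau> (\<lambda>x. surf_grad n v \<tau> x - G v x)"
  by (intro continuous_intros continuous_on_surf_grad assms continuous_on_subset[OF continuous_on_recovered_grad])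
     (use assms in auto)

lemma stab_form_lincomb:
  assumes "u \<in> fe_space T" "v \<in> fe_space T" "w \<in> fe_space T"
  shows "stab (\<lambda>x. a * u x + b * v x) w = a * stab u w + b * stab v w"
  unfolding stab_form_def
  by (rule surf_inner_lincomb)
     (use assms in \<open>auto intro!: continuous_on_stab simp: surf_grad_lincomb recovered_grad_lincomb algebra_simps\<close>)

lemma a_h_lincomb:
  assumes u: "u \<in> fe_space T" and v: "v \<in> fe_space T" and w: "w \<in> fe_space T"
  shows "a_h \<gamma> s T n (\<lambda>x. a * u x + b * v x) w = a * a_h \<gamma> s T n u w + b * a_h \<gamma> s T n v w"
proof -
  let ?l = "\<lambda>x. a * u x + b * v x"
  have 1: "surf_inner T (divG ?l) (divG w) =
     a * surf_inner T (divG u) (divG w) + b * surf_inner T (divG v) (divG w)"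
    by (rule surf_inner_lincomb) (auto intro!: continuous_on_div_G simp: div_G_lincomb u v)
  have 2: "(\<Sum>E\<in>edges T. edge_inner E (avg E ?l) (jump E w)) =
      a * (\<Sum>E\<in>edges T. edge_inner E (avg E u) (jump E w)) +
      b * (\<Sum>E\<in>edges T. edge_inner E (avg E v) (jump E w))"
    unfolding sum_distrib_left sum.distrib[symmetric]
    by (intro sum.cong refl edge_inner_lincomb edge_avg_lincomb continuous_on_edge_avg continuous_on_jump_G u v)
  have 3: "(\<Sum>E\<in>edges T. edge_inner E (avg E w) (jump E ?l)) =
      a * (\<Sum>E\<in>edges T. edge_inner E (avg E w) (jump E u)) +
      b * (\<Sum>E\<in>edges T. edge_inner E (avg E w) (jump E v))"
    unfolding sum_distrib_left sum.distrib[symmetric] edge_inner_commute[of _ "edge_avg _ _ _"]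
    by (intro sum.cong refl edge_inner_lincomb jump_G_lincomb continuous_on_edge_avg continuous_on_jump_G u v)
  have 4: "(\<Sum>E\<in>edges T. edge_inner E (jump E ?l) (jump E w)) =
      a * (\<Sum>E\<in>edges T. edge_inner E (jump E u) (jump E w)) +
      b * (\<Sum>E\<in>edges T. edge_inner E (jump E v) (jump E w))"
    unfolding sum_distrib_left sum.distrib[symmetric]
    by (intro sum.cong refl edge_inner_lincomb jump_G_lincomb continuous_on_jump_G u v)
  show ?thesis
    unfolding a_h_def 1 2 3 4 stab_form_lincomb[OF u v w] by (simp add: algebra_simps)
qed

lemma a_h_commute: "a_h \<gamma> s T n u v = a_h \<gamma> s T n v u"
  unfolding a_h_def stab_form_def
  by (simp add: surf_inner_commute[of T "divG u"] edge_inner_commute[of _ "jump _ u" "jump _ v"]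
     surf_inner_commute[of T "\<lambda>\<tau> x. surf_grad n u \<tau> x - G u x"])

text \<open>The divergence is constant on each triangle, so on an edge the square of its average is at
  most the mean of two such constants squared. The length of the edge contributes one factor \<open>h\<close>, the
  weight another, and \<open>h\<^sup>2\<close> is at most \<open>1/\<kappa>\<close> times the area of each adjacent triangle. The count of at
  most 8 edges per triangle (one for each set of vertices) gives the factor \<open>4 = 8/2\<close>.\<close>

lemma edge_average_inverse_inequality:
  assumes \<kappa>: "\<kappa> > 0" "\<And>\<tau>. \<tau> \<in> T \<Longrightarrow> \<kappa> * (mesh_size T)\<^sup>2 \<le> tri_area \<tau>" and h: "mesh_size T > 0"
  shows "(\<Sum>E\<in>edges T. mesh_size T * edge_inner E (avg E v) (avg E v))
     \<le> 4 / \<kappa> * surf_inner T (divG v) (divG v)"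
proof -
  define h where "h = mesh_size T"
  have h0: "h > 0" using h by (simp add: h_def)
  have "\<forall>\<tau>\<in>T. \<exists>d. \<forall>x\<in>\<tau>. divG v \<tau> x = d" using div_G_constant by metis
  then obtain d where d: "\<And>\<tau> x. \<tau> \<in> T \<Longrightarrow> x \<in> \<tau> \<Longrightarrow> divG v \<tau> x = d \<tau>" by metis
  have E: "h * edge_inner E (avg E v) (avg E v)
     \<le> h\<^sup>2 / 2 * (\<Sum>\<tau> | \<tau> \<in> T \<and> E edge_of \<tau>. (d \<tau>)\<^sup>2)" if E: "E \<in> edges T" for E
  proof -
    obtain \<tau>1 \<tau>2 where t: "\<tau>1 \<noteq> \<tau>2" "{\<tau>\<in>T. E edge_of \<tau>} = {\<tau>1, \<tau>2}" using edges_D[OF E] .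
    have mem: "\<tau>1 \<in> T" "\<tau>2 \<in> T" "E edge_of \<tau>1" "E edge_of \<tau>2" using t by auto
    define m where "m = (d \<tau>1 + d \<tau>2) / 2"
    have avg: "avg E v x = m" if "x \<in> E" for x
    proof -
      have "x \<in> \<tau>1" "x \<in> \<tau>2" using that mem edge_of_imp_subset by blast+
      thus ?thesis using t mem d by (simp add: edge_avg_def m_def)
    qed
    have "edge_inner E (avg E v) (avg E v) = (\<integral>x. m\<^sup>2 \<partial>edge_measure E)"
      unfolding edge_inner_def
      by (rule Bochner_Integration.integral_cong) (auto simp: space_edge_measure[OF E] avg power2_eq_square)
    also have "\<dots> = measure (edge_measure E) E * m\<^sup>2" by (simp add: space_edge_measure[OF E])
    also have "\<dots> \<le> h * (((d \<tau>1)\<^sup>2 + (d \<tau>2)\<^sup>2) / 2)"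
    proof (rule mult_mono)
      show "measure (edge_measure E) E \<le> h" unfolding h_def by (rule edge_props(2)[OF E])
      have "0 \<le> ((d \<tau>1 - d \<tau>2) / 2)\<^sup>2" by simp
      also have "\<dots> = ((d \<tau>1)\<^sup>2 + (d \<tau>2)\<^sup>2) / 2 - m\<^sup>2" unfolding m_def by (simp add: power2_eq_square field_simps)
      finally show "m\<^sup>2 \<le> ((d \<tau>1)\<^sup>2 + (d \<tau>2)\<^sup>2) / 2" by simp
    qed (use h0 in auto)
    finally have "h * edge_inner E (avg E v) (avg E v) \<le> h * (h * (((d \<tau>1)\<^sup>2 + (d \<tau>2)\<^sup>2) / 2))"
      using h0 by (intro mult_left_mono) auto
    also have "\<dots> = h\<^sup>2 / 2 * (\<Sum>\<tau>\<in>{\<tau>1, \<tau>2}. (d \<tau>)\<^sup>2)" using t(1) by (simp add: power2_eq_square)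
    finally show ?thesis unfolding t(2) .
  qed
  have "(\<Sum>E\<in>edges T. h * edge_inner E (avg E v) (avg E v))
     \<le> (\<Sum>E\<in>edges T. h\<^sup>2 / 2 * (\<Sum>\<tau> | \<tau> \<in> T \<and> E edge_of \<tau>. (d \<tau>)\<^sup>2))"
    by (rule sum_mono) (rule E)
  also have "\<dots> = h\<^sup>2 / 2 * (\<Sum>E\<in>edges T. \<Sum>\<tau> | \<tau> \<in> T \<and> E edge_of \<tau>. (d \<tau>)\<^sup>2)"
    by (simp add: sum_distrib_left)
  also have "(\<Sum>E\<in>edges T. \<Sum>\<tau> | \<tau> \<in> T \<and> E edge_of \<tau>. (d \<tau>)\<^sup>2) =
     (\<Sum>\<tau>\<in>T. \<Sum>E | E \<in> edges T \<and> E edge_of \<tau>. (d \<tau>)\<^sup>2)"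
    by (rule sum.swap_restrict) (use finite_edges finite_mesh in auto)
  also have "\<dots> \<le> (\<Sum>\<tau>\<in>T. 8 * (d \<tau>)\<^sup>2)"
  proof (rule sum_mono)
    fix \<tau> assume t: "\<tau> \<in> T"
    have "card {E. E \<in> edges T \<and> E edge_of \<tau>} \<le> card {E. E edge_of \<tau>}"
      using card_edges_two_simplex(1)[OF simplex[OF t]] by (intro card_mono) auto
    hence "real (card {E. E \<in> edges T \<and> E edge_of \<tau>}) \<le> 8"
      using card_edges_two_simplex(2)[OF simplex[OF t]] by linarith
    thus "(\<Sum>E | E \<in> edges T \<and> E edge_of \<tau>. (d \<tau>)\<^sup>2) \<le> 8 * (d \<tau>)\<^sup>2"
      by (simp add: mult_right_mono)
  qed
  also have "h\<^sup>2 / 2 * (\<Sum>\<tau>\<in>T. 8 * (d \<tau>)\<^sup>2) = 4 / \<kappa> * (\<Sum>\<tau>\<in>T. (\<kappa> * h\<^sup>2) * (d \<tau>)\<^sup>2)"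
    using \<kappa> by (simp add: sum_distrib_left[symmetric])
  also have "\<dots> \<le> 4 / \<kappa> * (\<Sum>\<tau>\<in>T. tri_area \<tau> * (d \<tau>)\<^sup>2)"
    using \<kappa> by (intro mult_left_mono sum_mono mult_right_mono) (auto simp: h_def)
  also have "(\<Sum>\<tau>\<in>T. tri_area \<tau> * (d \<tau>)\<^sup>2) = surf_inner T (divG v) (divG v)"
    unfolding surf_inner_def surf_integral_def
    by (intro sum.cong refl) (subst integral_const_on_triangle[where c = "(d _)\<^sup>2"], auto simp: d power2_eq_square)
  finally show ?thesis using h0 by (simp add: h_def mult_left_mono)
qed

lemma energy_norm_squared:
  assumes v: "v \<in> fe_space T" and h: "mesh_size T > 0"
  shows "(energy_norm T n v)\<^sup>2 = surf_inner T (divG v) (divG v)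
      + (\<Sum>E\<in>edges T. mesh_size T * edge_inner E (avg E v) (avg E v))
      + (\<Sum>E\<in>edges T. inverse (mesh_size T) * edge_inner E (jump E v) (jump E v)) + stab v v"
    and "surf_inner T (divG v) (divG v) \<ge> 0" "stab v v \<ge> 0"
    and "(\<Sum>E\<in>edges T. mesh_size T * edge_inner E (avg E v) (avg E v)) \<ge> 0"
    and "(\<Sum>E\<in>edges T. inverse (mesh_size T) * edge_inner E (jump E v) (jump E v)) \<ge> 0"
proof -
  show "surf_inner T (divG v) (divG v) \<ge> 0" "stab v v \<ge> 0"
    "(\<Sum>E\<in>edges T. mesh_size T * edge_inner E (avg E v) (avg E v)) \<ge> 0"
    "(\<Sum>E\<in>edges T. inverse (mesh_size T) * edge_inner E (jump E v) (jump E v)) \<ge> 0"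
    using h unfolding stab_form_def
    by (auto intro!: surf_inner_nonneg continuous_on_div_G continuous_on_stab v sum_nonneg
        mult_nonneg_nonneg edge_inner_nonneg)
  thus "(energy_norm T n v)\<^sup>2 = surf_inner T (divG v) (divG v)
      + (\<Sum>E\<in>edges T. mesh_size T * edge_inner E (avg E v) (avg E v))
      + (\<Sum>E\<in>edges T. inverse (mesh_size T) * edge_inner E (jump E v) (jump E v)) + stab v v"
    unfolding energy_norm_def by (subst real_sqrt_pow2) auto
qed

text \<open>Young's inequality with the weight \<open>\<epsilon> = \<kappa>/8\<close> splits the consistency terms so that the
  averages cost exactly half of the divergence, by the inverse inequality, and the jumps cost \<open>8/\<kappa>\<close>
  times the weighted jump norm, which the penalty pays.\<close>

lemma a_h_coercive:
  assumes \<kappa>: "\<kappa> > 0" "\<And>\<tau>. \<tau> \<in> T \<Longrightarrow> \<kappa> * (mesh_size T)\<^sup>2 \<le> tri_area \<tau>" and h: "mesh_size T > 0"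
    and \<gamma>: "\<gamma> \<ge> 8 / \<kappa> + 1" and s: "s > 0" and v: "v \<in> fe_space T"
  shows "a_h \<gamma> s T n v v \<ge> min (min (1/4) (\<kappa>/16)) (min 1 s) * (energy_norm T n v)\<^sup>2"
proof -
  define h where "h = mesh_size T"
  have h0: "h > 0" using h by (simp add: h_def)
  let ?avg = "\<lambda>E. avg E v" and ?j = "\<lambda>E. jump E v"
  define D where "D = surf_inner T (divG v) (divG v)"
  define A where "A = (\<Sum>E\<in>edges T. h * edge_inner E (?avg E) (?avg E))"
  define J where "J = (\<Sum>E\<in>edges T. inverse h * edge_inner E (?j E) (?j E))"
  define S where "S = stab v v"
  define X where "X = (\<Sum>E\<in>edges T. edge_inner E (?avg E) (?j E))"
  define \<epsilon> where "\<epsilon> = \<kappa> / 8"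
  note en = energy_norm_squared[OF v h, folded D_def A_def[unfolded h_def] J_def[unfolded h_def] S_def]
  have D: "D \<ge> 0" and S: "S \<ge> 0" and A: "A \<ge> 0" and J: "J \<ge> 0" by (fact en(2-5))+
  have AD: "A \<le> 4 / \<kappa> * D" unfolding A_def D_def h_def by (rule edge_average_inverse_inequality[OF assms(1-3)])
  have e0: "\<epsilon> > 0" using \<kappa> by (simp add: \<epsilon>_def)
  have "2 * X \<le> (\<Sum>E\<in>edges T. \<epsilon> * (h * edge_inner E (?avg E) (?avg E)) + (inverse h * edge_inner E (?j E) (?j E)) / \<epsilon>)"
    unfolding X_def sum_distrib_left
  proof (rule sum_mono)
    fix E assume E: "E \<in> edges T"
    have "2 * edge_inner E (?avg E) (?j E) \<le>
       (\<epsilon> * h) * edge_inner E (?avg E) (?avg E) + edge_inner E (?j E) (?j E) / (\<epsilon> * h)"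
      using e0 h0 by (intro edge_inner_young[OF E] continuous_on_edge_avg continuous_on_jump_G E) auto
    thus "2 * edge_inner E (?avg E) (?j E) \<le> \<epsilon> * (h * edge_inner E (?avg E) (?avg E)) + (inverse h * edge_inner E (?j E) (?j E)) / \<epsilon>"
      by (simp add: field_simps)
  qed
  also have "\<dots> = \<epsilon> * A + J / \<epsilon>"
    unfolding A_def J_def by (simp add: sum.distrib sum_distrib_left sum_divide_distrib)
  also have "\<epsilon> * A \<le> D / 2" using AD \<kappa> unfolding \<epsilon>_def by (simp add: field_simps)
  finally have X: "2 * X \<le> D / 2 + 8 / \<kappa> * J" by (simp add: \<epsilon>_def mult.commute)
  have ah: "a_h \<gamma> s T n v v = D - 2 * X + \<gamma> * J + s * S"
  proof -
    have "J = inverse h * (\<Sum>E\<in>edges T. edge_inner E (?j E) (?j E))"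
      unfolding J_def by (simp add: sum_distrib_left)
    thus ?thesis unfolding a_h_def D_def X_def S_def h_def by (simp add: divide_inverse)
  qed
  define \<rho> where "\<rho> = min (min (1/4) (\<kappa>/16)) (min 1 s)"
  have r: "\<rho> \<le> 1/4" "\<rho> \<le> \<kappa>/16" "\<rho> \<le> 1" "\<rho> \<le> s" by (auto simp: \<rho>_def)
  have "\<rho> * D \<le> 1/4 * D" "\<rho> * A \<le> \<kappa> / 16 * A" "\<rho> * J \<le> 1 * J" "\<rho> * S \<le> s * S"
    using r D A J S by (intro mult_right_mono; simp)+
  moreover have "\<kappa> / 16 * A \<le> D / 4" using AD \<kappa> by (simp add: field_simps)
  moreover have "(8 / \<kappa> + 1) * J \<le> \<gamma> * J" using \<gamma> J by (rule mult_right_mono)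
  ultimately show ?thesis
    unfolding ah en(1) \<rho>_def[symmetric] using X by (simp add: algebra_simps)
qed

end

section \<open>Definite forms on finite-dimensional function spaces\<close>

text \<open>The elements of \<open>V\<close> are plain functions, so linear combinations are formed
  pointwise.\<close>

definition linear_functional_on :: "('a \<Rightarrow> real) set \<Rightarrow> (('a \<Rightarrow> real) \<Rightarrow> real) \<Rightarrow> bool" where
  "linear_functional_on V L \<longleftrightarrow>
     (\<forall>u\<in>V. \<forall>v\<in>V. \<forall>a c. L (\<lambda>x. a * u x + c * v x) = a * L u + c * L v)"

definition function_subspace :: "('a \<Rightarrow> real) set \<Rightarrow> bool" where
  "function_subspace V \<longleftrightarrow>
     (\<lambda>x. 0) \<in> V \<and> (\<forall>u\<in>V. \<forall>v\<in>V. \<forall>a c. (\<lambda>x. a * u x + c * v x) \<in> V)"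

lemma linear_functional_onD:
  "linear_functional_on V L \<Longrightarrow> u \<in> V \<Longrightarrow> v \<in> V \<Longrightarrow>
     L (\<lambda>x. a * u x + c * v x) = a * L u + c * L v"
  unfolding linear_functional_on_def by blast

lemma function_subspaceD:
  "function_subspace V \<Longrightarrow> u \<in> V \<Longrightarrow> v \<in> V \<Longrightarrow> (\<lambda>x. a * u x + c * v x) \<in> V"
  unfolding function_subspace_def by blast

lemma function_subspace_sum:
  assumes V: "function_subspace V" and "finite I" "\<And>i. i \<in> I \<Longrightarrow> b i \<in> V"
  shows "(\<lambda>x. \<Sum>i\<in>I. c i * b i x) \<in> V"
  using assms(2,3)
proof (induction I rule: finite_induct)
  case empty thus ?case using V by (simp add: function_subspace_def)
next
  case (insert i I)
  have "(\<lambda>x. c i * b i x + 1 * (\<Sum>i\<in>I. c i * b i x)) \<in> V"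
    by (rule function_subspaceD[OF V]) (use insert in auto)
  thus ?case using insert by simp
qed

lemma linear_functional_on_sum:
  assumes V: "function_subspace V" and L: "linear_functional_on V L"
    and I: "finite I" "\<And>i. i \<in> I \<Longrightarrow> b i \<in> V"
  shows "L (\<lambda>x. \<Sum>i\<in>I. c i * b i x) = (\<Sum>i\<in>I. c i * L (b i))"
  using I
proof (induction I rule: finite_induct)
  case empty
  have z: "(\<lambda>x. 0) \<in> V" using V by (simp add: function_subspace_def)
  show ?case using linear_functional_onD[OF L z z, of 0 0] by simp
next
  case (insert i I)
  have s: "(\<lambda>x. \<Sum>i\<in>I. c i * b i x) \<in> V" by (rule function_subspace_sum[OF V]) (use insert in auto)
  have "b i \<in> V" using insert by simp
  hence "L (\<lambda>x. c i * b i x + 1 * (\<Sum>i\<in>I. c i * b i x)) = c i * L (b i) + 1 * L (\<lambda>x. \<Sum>i\<in>I. c i * b i x)"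
    by (rule linear_functional_onD[OF L _ s])
  thus ?case using insert by simp
qed

text \<open>Induction over the family, as in the Gram--Schmidt process: a new member is made
  \<open>B\<close>-orthogonal to the span of the previous ones, which turns the correction of the solution
  into a single scalar equation. The family may be linearly dependent; the residual \<open>r\<close> then vanishes
  and linearity of \<open>l\<close> makes the new equation automatic.\<close>

lemma definite_form_solvable_on_family:
  assumes V: "function_subspace V"
    and B1: "\<And>w. w \<in> V \<Longrightarrow> linear_functional_on V (\<lambda>u. B u w)"
    and B2: "\<And>u. u \<in> V \<Longrightarrow> linear_functional_on V (B u)"
    and pos: "\<And>v. v \<in> V \<Longrightarrow> B v v = 0 \<Longrightarrow> v = (\<lambda>x. 0)"
    and I: "finite I" "\<And>i. i \<in> I \<Longrightarrow> b i \<in> V"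
    and l: "linear_functional_on V l"
  shows "\<exists>c. \<forall>j\<in>I. B (\<lambda>x. \<Sum>i\<in>I. c i * b i x) (b j) = l (b j)"
  using I l
proof (induction I arbitrary: l rule: finite_induct)
  case empty thus ?case by simp
next
  case (insert k I)
  define lc where "lc = (\<lambda>c x. \<Sum>i\<in>I. c i * b i x)"
  have bV: "\<And>i. i \<in> I \<Longrightarrow> b i \<in> V" and bk: "b k \<in> V" using insert by auto
  have lcV: "lc c \<in> V" for c unfolding lc_def
    by (rule function_subspace_sum[OF V insert(1)]) (rule bV)
  have lcL: "L (lc c) = (\<Sum>i\<in>I. c i * L (b i))" if "linear_functional_on V L" for L c
    unfolding lc_def by (rule linear_functional_on_sum[OF V that insert(1) bV])
  obtain cu where cu: "\<And>j. j \<in> I \<Longrightarrow> B (lc cu) (b j) = l (b j)"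
    using insert.IH[OF bV insert.prems(2)] unfolding lc_def by blast
  obtain cw where cw: "\<And>j. j \<in> I \<Longrightarrow> B (lc cw) (b j) = B (b k) (b j)"
    using insert.IH[OF bV B2[OF bk]] unfolding lc_def by blast
  define r where "r = (\<lambda>x. 1 * b k x + (-1) * lc cw x)"
  have rV: "r \<in> V" unfolding r_def by (rule function_subspaceD[OF V bk lcV])
  have Br: "B r w = 1 * B (b k) w + (-1) * B (lc cw) w" if "w \<in> V" for w
    unfolding r_def by (rule linear_functional_onD[OF B1[OF that] bk lcV])
  have r0: "B r (b j) = 0" if "j \<in> I" for j using Br[OF bV[OF that]] cw[OF that] by simp
  have "B r (lc cw) = 0" using lcL[OF B2[OF rV], of cw] r0 by simp
  moreover have "B r r = 1 * B r (b k) + (-1) * B r (lc cw)"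
    by (subst (2) r_def) (rule linear_functional_onD[OF B2[OF rV] bk lcV])
  ultimately have rr: "B r r = B r (b k)" by simp
  define t where "t = (if r = (\<lambda>x. 0) then 0 else (l (b k) - B (lc cu) (b k)) / B r r)"
  define c where "c = (\<lambda>i. if i = k then t else cu i - t * cw i)"
  have "(\<lambda>x. \<Sum>i\<in>insert k I. c i * b i x) = (\<lambda>x. 1 * lc cu x + t * r x)"
  proof
    fix x
    have "(\<Sum>i\<in>I. c i * b i x) = (\<Sum>i\<in>I. cu i * b i x - t * (cw i * b i x))"
      by (rule sum.cong) (use insert(2) in \<open>auto simp: c_def algebra_simps\<close>)
    also have "\<dots> = lc cu x - t * lc cw x"
      by (simp add: lc_def sum_subtractf sum_distrib_left)
    finally show "(\<Sum>i\<in>insert k I. c i * b i x) = 1 * lc cu x + t * r x"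
      using insert(1,2) by (simp add: r_def algebra_simps) (simp add: c_def)
  qed
  moreover have "B (\<lambda>x. 1 * lc cu x + t * r x) w = 1 * B (lc cu) w + t * B r w" if "w \<in> V" for w
    by (rule linear_functional_onD[OF B1[OF that] lcV rV])
  ultimately have Bc: "B (\<lambda>x. \<Sum>i\<in>insert k I. c i * b i x) w = B (lc cu) w + t * B r w" if "w \<in> V" for w
    using that by simp
  have "B (lc cu) (b k) + t * B r (b k) = l (b k)"
  proof (cases "r = (\<lambda>x. 0)")
    case True
    hence bk': "b k = lc cw" unfolding r_def by (auto simp: fun_eq_iff)
    have "B (lc cu) (b k) = l (b k)"
      unfolding bk' lcL[OF insert.prems(2)] lcL[OF B2[OF lcV]] using cu by simp
    thus ?thesis using True by (simp add: t_def)
  next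
    case False
    hence "B r r \<noteq> 0" using pos[OF rV] by blast
    thus ?thesis using False rr by (simp add: t_def)
  qed
  moreover have "B (lc cu) (b j) + t * B r (b j) = l (b j)" if "j \<in> I" for j using cu r0 that by simp
  ultimately show ?case using Bc bk bV by (intro exI[of _ c]) simp
qed

lemma definite_form_unique_solution:
  assumes V: "function_subspace V"
    and B1: "\<And>w. w \<in> V \<Longrightarrow> linear_functional_on V (\<lambda>u. B u w)"
    and B2: "\<And>u. u \<in> V \<Longrightarrow> linear_functional_on V (B u)"
    and pos: "\<And>v. v \<in> V \<Longrightarrow> B v v = 0 \<Longrightarrow> v = (\<lambda>x. 0)"
    and I: "finite I" "\<And>i. i \<in> I \<Longrightarrow> b i \<in> V"
    and span: "\<And>v. v \<in> V \<Longrightarrow> \<exists>c. v = (\<lambda>x. \<Sum>i\<in>I. c i * b i x)"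
    and l: "linear_functional_on V l"
  shows "\<exists>!u. u \<in> V \<and> (\<forall>v\<in>V. B u v = l v)"
proof -
  have "\<exists>c. \<forall>j\<in>I. B (\<lambda>x. \<Sum>i\<in>I. c i * b i x) (b j) = l (b j)"
    by (rule definite_form_solvable_on_family[where V = V]; fact)
  then obtain c where c: "\<And>j. j \<in> I \<Longrightarrow> B (\<lambda>x. \<Sum>i\<in>I. c i * b i x) (b j) = l (b j)" by blast
  define u where "u = (\<lambda>x. \<Sum>i\<in>I. c i * b i x)"
  have uV: "u \<in> V" unfolding u_def by (rule function_subspace_sum[OF V I])
  have Bu: "B u v = l v" if v: "v \<in> V" for v
  proof -
    obtain d where d: "v = (\<lambda>x. \<Sum>i\<in>I. d i * b i x)" using span[OF v] by blast
    have "B u v = (\<Sum>i\<in>I. d i * B u (b i))"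
      unfolding d by (rule linear_functional_on_sum[OF V B2[OF uV] I])
    also have "\<dots> = (\<Sum>i\<in>I. d i * l (b i))" using c by (simp add: u_def)
    also have "\<dots> = l v"
      unfolding d by (rule linear_functional_on_sum[OF V l I, symmetric])
    finally show ?thesis .
  qed
  show ?thesis
  proof (rule ex1I[of _ u])
    show "u \<in> V \<and> (\<forall>v\<in>V. B u v = l v)" using uV Bu by blast
    fix w assume w: "w \<in> V \<and> (\<forall>v\<in>V. B w v = l v)"
    define z where "z = (\<lambda>x. 1 * w x + (-1) * u x)"
    have zV: "z \<in> V" unfolding z_def using function_subspaceD[OF V conjunct1[OF w] uV] .
    have "B z z = 1 * B w z + (-1) * B u z"
      by (subst (1) z_def) (rule linear_functional_onD[OF B1[OF zV] conjunct1[OF w] uV])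
    hence "B z z = 0" using w Bu[OF zV] zV by simp
    hence "z = (\<lambda>x. 0)" by (rule pos[OF zV])
    thus "w = u" unfolding z_def by (auto simp: fun_eq_iff)
  qed
qed

section \<open>The stabilisation form is definite\<close>

lemma two_simplex_third_vertex:
  fixes \<tau> :: triangle
  assumes T: "2 simplex \<tau>" and P: "P extreme_point_of \<tau>" and Q: "Q extreme_point_of \<tau>" and ne: "P \<noteq> Q"
  obtains R where "\<tau> = convex hull {P, Q, R}" "R extreme_point_of \<tau>"
proof -
  obtain a b c where t: "\<tau> = convex hull {a, b, c}" using two_simplex_vertices[OF T] .
  have e: "x extreme_point_of \<tau> \<longleftrightarrow> x \<in> {a,b,c}" for x
    using two_simplex_extreme_points[of a b c] T t by simp
  have "P \<in> {a,b,c}" "Q \<in> {a,b,c}" using e P Q by auto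
  then obtain R where "R \<in> {a,b,c}" "{P,Q,R} = {a,b,c}"
    using ne by (elim insertE emptyE) (auto simp: insert_commute)
  thus ?thesis using that[of R] t e by metis
qed

text \<open>Expansion of \<open>x\<close> through the double cross product \<open>(k \<times> x) \<times> k = (k \<bullet> k) x - (x \<bullet> k) k\<close>,
  where \<open>k = d \<times> g\<close>.\<close>

lemma cramer_in_plane:
  fixes d g x :: "real^3"
  assumes k: "cross3 d g \<noteq> 0" and x: "x \<bullet> cross3 d g = 0"
  obtains \<alpha> \<beta> where "x = \<alpha> *\<^sub>R d + \<beta> *\<^sub>R g"
proof -
  define k where "k = cross3 d g"
  have kk: "k \<bullet> k \<noteq> 0" using k by (simp add: k_def)
  have "cross3 (cross3 k x) k = (k \<bullet> k) *\<^sub>R x - (x \<bullet> k) *\<^sub>R k"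
    by (simp add: cross3_simps forall_3)
  hence 1: "cross3 (cross3 k x) k = (k \<bullet> k) *\<^sub>R x" using x by (simp add: k_def)
  have 2: "cross3 k x = (x \<bullet> d) *\<^sub>R g - (x \<bullet> g) *\<^sub>R d"
    unfolding k_def by (simp add: cross3_simps forall_3)
  have 3: "cross3 g k = (g \<bullet> g) *\<^sub>R d - (g \<bullet> d) *\<^sub>R g" "cross3 d k = (d \<bullet> g) *\<^sub>R d - (d \<bullet> d) *\<^sub>R g"
    unfolding k_def by (simp_all add: cross3_simps forall_3)
  have "(k \<bullet> k) *\<^sub>R x = (x \<bullet> d) *\<^sub>R cross3 g k - (x \<bullet> g) *\<^sub>R cross3 d k"
    unfolding 1[symmetric] 2 by (simp add: Cross3.left_diff_distrib cross_mult_left)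
  also have "\<dots> = ((x \<bullet> d) * (g \<bullet> g) - (x \<bullet> g) * (d \<bullet> g)) *\<^sub>R d + ((x \<bullet> g) * (d \<bullet> d) - (x \<bullet> d) * (g \<bullet> d)) *\<^sub>R g"
    unfolding 3 by (simp add: algebra_simps)
  finally have "(k \<bullet> k) *\<^sub>R x = \<dots>" .
  hence "(1 / (k \<bullet> k)) *\<^sub>R (k \<bullet> k) *\<^sub>R x = (1 / (k \<bullet> k)) *\<^sub>R (((x \<bullet> d) * (g \<bullet> g) - (x \<bullet> g) * (d \<bullet> g)) *\<^sub>R d + ((x \<bullet> g) * (d \<bullet> d) - (x \<bullet> d) * (g \<bullet> d)) *\<^sub>R g)"
    by simp
  hence "x = (((x \<bullet> d) * (g \<bullet> g) - (x \<bullet> g) * (d \<bullet> g)) / (k \<bullet> k)) *\<^sub>R d + (((x \<bullet> g) * (d \<bullet> d) - (x \<bullet> d) * (g \<bullet> d)) / (k \<bullet> k)) *\<^sub>R g"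
    using kk by (simp add: scaleR_add_right)
  thus ?thesis by (rule that)
qed

context mesh_with_normals
begin

text \<open>Two coplanar triangles of the mesh on the same side (\<open>\<beta>1 \<beta>2 > 0\<close>) of a common edge overlap
  near the midpoint of the edge. An overlap is a common face, and a face that meets the relative interior
  of a triangle is the whole triangle.\<close>

lemma third_vertex_in_neighbour:
  assumes t: "\<tau>1 \<in> T" "\<tau>2 \<in> T" and h: "\<tau>1 = convex hull {P, Q, R1}" "\<tau>2 = convex hull {P, Q, R2}"
    and R: "R1 - P = \<alpha>1 *\<^sub>R (Q - P) + \<beta>1 *\<^sub>R w" "R2 - P = \<alpha>2 *\<^sub>R (Q - P) + \<beta>2 *\<^sub>R w" and b: "\<beta>1 * \<beta>2 > 0"
  shows "\<tau>1 \<subseteq> \<tau>2"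
proof -
  \<comment> \<open>small enough for \<open>z\<close> below to have positive barycentric coordinates in both triangles\<close>
  define s where "s = 1 / (4 * (1 + \<bar>\<alpha>1\<bar> + \<bar>\<alpha>2\<bar>) * (\<bar>\<beta>1\<bar> + \<bar>\<beta>2\<bar>))"
  define t1 where "t1 = s * \<bar>\<beta>2\<bar>" define t2 where "t2 = s * \<bar>\<beta>1\<bar>"
  have b0: "\<bar>\<beta>1\<bar> > 0" "\<bar>\<beta>2\<bar> > 0" using b by auto
  have s0: "s > 0" unfolding s_def using b0 by (intro divide_pos_pos mult_pos_pos) auto
  have t0: "t1 > 0" "t2 > 0" using s0 b0 by (auto simp: t1_def t2_def)
  have s1: "s * (\<bar>\<beta>1\<bar> + \<bar>\<beta>2\<bar>) * (1 + \<bar>\<alpha>1\<bar> + \<bar>\<alpha>2\<bar>) = 1 / 4"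
  proof -
    define p where "p = 1 + \<bar>\<alpha>1\<bar> + \<bar>\<alpha>2\<bar>" define q where "q = \<bar>\<beta>1\<bar> + \<bar>\<beta>2\<bar>"
    have "p > 0" "q > 0" using b0 unfolding p_def q_def by auto
    thus ?thesis unfolding s_def p_def[symmetric] q_def[symmetric] by simp
  qed
  have bnd: "t * (1 + \<bar>\<alpha>\<bar>) \<le> 1/4" if "t \<le> s * (\<bar>\<beta>1\<bar> + \<bar>\<beta>2\<bar>)" "\<bar>\<alpha>\<bar> \<le> \<bar>\<alpha>1\<bar> + \<bar>\<alpha>2\<bar>" "t \<ge> 0" for t \<alpha>
    unfolding s1[symmetric] using that b0 s0 by (intro mult_mono) auto
  have c1: "t1 * (1 + \<bar>\<alpha>1\<bar>) \<le> 1/4" using s0 b0 by (intro bnd) (auto simp: t1_def)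
  have c2: "t2 * (1 + \<bar>\<alpha>2\<bar>) \<le> 1/4" using s0 b0 by (intro bnd) (auto simp: t2_def)
  have ta: "\<bar>t * \<alpha>\<bar> \<le> 1/4 - t" if "t * (1 + \<bar>\<alpha>\<bar>) \<le> 1/4" "t > 0" for t \<alpha> :: real
    using that by (simp add: abs_mult algebra_simps)
  have ta1: "\<bar>t1 * \<alpha>1\<bar> \<le> 1/4 - t1" and ta2: "\<bar>t2 * \<alpha>2\<bar> \<le> 1/4 - t2" using ta c1 c2 t0 by auto
  have "\<bar>\<beta>2\<bar> * \<beta>1 = \<bar>\<beta>1\<bar> * \<beta>2" using b by (auto simp: zero_less_mult_iff abs_if)
  hence tb: "t1 * \<beta>1 = t2 * \<beta>2" unfolding t1_def t2_def by (simp add: mult.assoc)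
  \<comment> \<open>the midpoint of the common edge, moved by \<open>t1 \<beta>1 w = t2 \<beta>2 w\<close> into both triangles\<close>
  define z where "z = (1/2 - t1 + t1 * \<alpha>1) *\<^sub>R P + (1/2 - t1 * \<alpha>1) *\<^sub>R Q + t1 *\<^sub>R R1"
  have R1: "R1 = P + \<alpha>1 *\<^sub>R (Q - P) + \<beta>1 *\<^sub>R w" and R2: "R2 = P + \<alpha>2 *\<^sub>R (Q - P) + \<beta>2 *\<^sub>R w"
    using R by (simp_all add: algebra_simps)
  have "z = (1/2) *\<^sub>R P + (1/2) *\<^sub>R Q + (t1 * \<beta>1) *\<^sub>R w"
    unfolding z_def R1 by (simp add: algebra_simps)
  also have "\<dots> = (1/2 - t2 + t2 * \<alpha>2) *\<^sub>R P + (1/2 - t2 * \<alpha>2) *\<^sub>R Q + t2 *\<^sub>R R2"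
    unfolding tb R2 by (simp add: algebra_simps)
  finally have z2: "z = (1/2 - t2 + t2 * \<alpha>2) *\<^sub>R P + (1/2 - t2 * \<alpha>2) *\<^sub>R Q + t2 *\<^sub>R R2" .
  have "z \<in> \<tau>2" unfolding h(2) convex_hull_3 mem_Collect_eq
    by (rule exI[of _ "1/2 - t2 + t2 * \<alpha>2"], rule exI[of _ "1/2 - t2 * \<alpha>2"], rule exI[of _ t2])
       (use z2 ta2 t0 in auto)
  moreover have "z \<in> \<tau>1" unfolding h(1) convex_hull_3 mem_Collect_eq
    by (rule exI[of _ "1/2 - t1 + t1 * \<alpha>1"], rule exI[of _ "1/2 - t1 * \<alpha>1"], rule exI[of _ t1])
       (use z_def ta1 t0 in auto)
  ultimately have zF: "z \<in> \<tau>1 \<inter> \<tau>2" by simp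
  \<comment> \<open>the point of the common edge from which \<open>z\<close> lies in the direction of the third vertex\<close>
  define y where "y = ((1/2 - t1 + t1 * \<alpha>1) / (1 - t1)) *\<^sub>R P + ((1/2 - t1 * \<alpha>1) / (1 - t1)) *\<^sub>R Q"
  have t1': "1 - t1 > 0" using ta1 by linarith
  have y: "y \<in> \<tau>1"
  proof -
    have "(1/2 - t1 + t1 * \<alpha>1) / (1 - t1) + (1/2 - t1 * \<alpha>1) / (1 - t1) = 1"
      using t1' by (simp add: field_simps)
    thus ?thesis unfolding h(1) convex_hull_3 y_def mem_Collect_eq
      by (intro exI[of _ "(1/2 - t1 + t1 * \<alpha>1) / (1 - t1)"] exI[of _ "(1/2 - t1 * \<alpha>1) / (1 - t1)"] exI[of _ 0])
         (use t1' ta1 t0 in auto)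
  qed
  have zy: "z = (1 - t1) *\<^sub>R y + t1 *\<^sub>R R1"
    unfolding z_def y_def using t1' by (simp add: scaleR_add_right)
  have R1t: "R1 \<in> \<tau>1" unfolding h(1) by (rule hull_inc) simp
  have "R1 \<in> \<tau>1 \<inter> \<tau>2"
  proof (cases "y = R1")
    case True
    hence "z = R1" unfolding zy by (simp add: algebra_simps)
    thus ?thesis using zF by simp
  next
    case False
    hence "z \<in> open_segment y R1" unfolding in_segment using zy t0 t1' by auto
    thus ?thesis using face[OF t] zF y R1t unfolding face_of_def by blast
  qed
  moreover have "P \<in> \<tau>2" "Q \<in> \<tau>2" unfolding h(2) by (auto intro: hull_inc)
  ultimately show ?thesis unfolding h(1) using tri_convex[OF t(2)] by (intro hull_minimal) auto
qed

text \<open>Among the edges from a vertex \<open>P\<close> that is highest in the direction \<open>g\<close>, take an edge \<open>PQ\<close>,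
  not parallel to \<open>g\<close>, whose descent \<open>s\<close> per horizontal length \<open>\<parallel>w\<parallel>\<close> is least. Both triangles at
  \<open>PQ\<close> lie in the plane spanned by the edge and \<open>g\<close>, on different sides of the edge. The third vertex
  of the upper one is not above \<open>P\<close>, so it is reached by an edge that descends even less.\<close>

lemma no_common_tangent_direction:
  assumes ne: "T \<noteq> {}" and tang: "\<And>\<tau>. \<tau> \<in> T \<Longrightarrow> n \<tau> \<bullet> g = 0"
  shows "g = 0"
proof (rule ccontr)
  assume g: "g \<noteq> 0"
  hence gg: "g \<bullet> g > 0" by simp
  have ext: "P \<in> \<tau>" if "P extreme_point_of \<tau>" for P and \<tau> :: triangle using that by (simp add: extreme_point_of_def)
  obtain \<tau>0 where t0: "\<tau>0 \<in> T" using ne by auto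
  obtain a b c where "\<tau>0 = convex hull {a, b, c}" using two_simplex_vertices[OF simplex[OF t0]] .
  hence "a \<in> nodes T" using two_simplex_extreme_points[of a b c] simplex[OF t0] t0 by (auto simp: nodes_def)
  then obtain P where P: "P \<in> nodes T" and top: "\<And>Q. Q \<in> nodes T \<Longrightarrow> g \<bullet> Q \<le> g \<bullet> P"
    using finite_nodes ex_is_arg_min_if_finite[of "nodes T" "\<lambda>Q. - (g \<bullet> Q)"] unfolding is_arg_min_linorder
    by (metis empty_iff neg_le_iff_le)
  \<comment> \<open>the horizontal part of an edge from \<open>P\<close>, and its descent\<close>
  define w where "w = (\<lambda>Q. (Q - P) - (((Q - P) \<bullet> g) / (g \<bullet> g)) *\<^sub>R g)"
  define s where "s = (\<lambda>Q. (P - Q) \<bullet> g)"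
  have s0: "s Q \<ge> 0" if "Q \<in> nodes T" for Q using top[OF that] by (simp add: s_def inner_diff_right inner_commute[of _ g])
  define N where "N = {Q. w Q \<noteq> 0 \<and> (\<exists>\<tau>\<in>T. P extreme_point_of \<tau> \<and> Q extreme_point_of \<tau>)}"
  have Nn: "N \<subseteq> nodes T" unfolding N_def nodes_def by auto
  have N: "finite N" using Nn finite_nodes finite_subset by blast
  have w0: "\<exists>c. Q - P = c *\<^sub>R g" if "w Q = 0" for Q using that unfolding w_def by auto
  have "N \<noteq> {}"
  proof -
    obtain \<tau> where t: "\<tau> \<in> T" "P extreme_point_of \<tau>" using P by (auto simp: nodes_def)
    obtain a b c where abc: "\<tau> = convex hull {a, b, c}" using two_simplex_vertices[OF simplex[OF t(1)]] .
    have e: "x extreme_point_of \<tau> \<longleftrightarrow> x \<in> {a,b,c}" for x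
      using two_simplex_extreme_points[of a b c] simplex[OF t(1)] abc by simp
    have "\<exists>Q. Q extreme_point_of \<tau> \<and> Q \<noteq> P" using e two_simplex_affine_independent(2)[of a b c] simplex[OF t(1)] abc by auto
    then obtain Q where Q: "Q extreme_point_of \<tau>" "Q \<noteq> P" by blast
    obtain R where R: "\<tau> = convex hull {P, Q, R}" "R extreme_point_of \<tau>"
      using two_simplex_third_vertex[OF simplex[OF t(1)] t(2) Q(1)] Q(2) by metis
    have cr: "cross3 (Q - P) (R - P) \<noteq> 0" using two_simplex_cross[of P Q R] simplex[OF t(1)] R by simp
    have "w Q \<noteq> 0 \<or> w R \<noteq> 0"
    proof (rule ccontr)
      assume "\<not> (w Q \<noteq> 0 \<or> w R \<noteq> 0)"
      then obtain c1 c2 where "Q - P = c1 *\<^sub>R g" "R - P = c2 *\<^sub>R g" using w0 by blast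
      thus False using cr by (simp add: cross_mult_left cross_mult_right)
    qed
    thus ?thesis using t Q R unfolding N_def by auto
  qed
  then obtain Q where Q: "Q \<in> N" and minim: "\<And>R. R \<in> N \<Longrightarrow> s Q / norm (w Q) \<le> s R / norm (w R)"
    using ex_is_arg_min_if_finite[OF N, of "\<lambda>Q. s Q / norm (w Q)"] unfolding is_arg_min_linorder by blast
  obtain \<tau>0 where t0: "\<tau>0 \<in> T" "P extreme_point_of \<tau>0" "Q extreme_point_of \<tau>0" and wQ: "w Q \<noteq> 0"
    using Q by (auto simp: N_def)
  have PQ: "P \<noteq> Q" using wQ unfolding w_def by auto
  define E where "E = closed_segment P Q"
  have "E edge_of \<tau>0"
  proof -
    obtain R where R: "\<tau>0 = convex hull {P, Q, R}"
      using two_simplex_third_vertex[OF simplex[OF t0(1)] t0(2,3) PQ] by metis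
    have "\<not> affine_dependent {P,Q,R}" using two_simplex_affine_independent(1)[of P Q R] simplex[OF t0(1)] R by simp
    hence "convex hull {P, Q} face_of convex hull {P, Q, R}"
      by (subst face_of_convex_hull_affine_independent) (auto intro!: exI[of _ "{P, Q}"])
    hence "E face_of \<tau>0" unfolding R E_def segment_convex_hull .
    moreover have "aff_dim E = 1" using PQ unfolding E_def segment_convex_hull by (simp add: aff_dim_convex_hull aff_dim_2)
    ultimately show ?thesis by (simp add: edge_of_def)
  qed
  hence E: "E \<in> edges T" using t0 by (auto simp: edges_def)
  obtain \<tau>1 \<tau>2 where t12: "\<tau>1 \<noteq> \<tau>2" "{\<tau>\<in>T. E edge_of \<tau>} = {\<tau>1, \<tau>2}" using edges_D[OF E] .
  have mem: "\<tau>1 \<in> T" "\<tau>2 \<in> T" "E edge_of \<tau>1" "E edge_of \<tau>2" using t12(2) by auto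
  \<comment> \<open>the edge and \<open>g\<close> span the plane of every triangle that contains the edge\<close>
  have kdg: "cross3 (Q - P) g \<noteq> 0"
  proof
    assume "cross3 (Q - P) g = 0"
    hence "collinear {0, g, Q - P}" using cross_eq_0[of g "Q - P"] cross_skew[of g "Q - P"] by simp
    then obtain c where "Q - P = c *\<^sub>R g" using g PQ unfolding collinear_lemma by auto
    thus False using wQ g by (simp add: w_def)
  qed
  have third: "\<exists>R \<alpha> \<beta>. \<tau> = convex hull {P, Q, R} \<and> R extreme_point_of \<tau> \<and>
      R - P = \<alpha> *\<^sub>R (Q - P) + \<beta> *\<^sub>R g \<and> \<beta> \<le> 0 \<and> \<beta> \<noteq> 0" if t: "\<tau> \<in> T" "E edge_of \<tau>" for \<tau>
  proof -
    have "P extreme_point_of E" "Q extreme_point_of E" unfolding E_def using extreme_point_of_segment by auto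
    hence PQt: "P extreme_point_of \<tau>" "Q extreme_point_of \<tau>"
      using t(2) extreme_point_of_face by (auto simp: edge_of_def)
    obtain R where R: "\<tau> = convex hull {P, Q, R}" "R extreme_point_of \<tau>"
      using two_simplex_third_vertex[OF simplex[OF t(1)] PQt PQ] .
    have cr: "cross3 (Q - P) (R - P) \<noteq> 0" using two_simplex_cross[of P Q R] simplex[OF t(1)] R by simp
    have o: "n \<tau> \<bullet> (Q - P) = 0" "n \<tau> \<bullet> (R - P) = 0" "n \<tau> \<bullet> g = 0"
      using normal_orthogonal[OF t(1)] tang[OF t(1)] ext PQt R(2) by auto
    have "cross3 (cross3 (Q - P) g) (n \<tau>) = (n \<tau> \<bullet> (Q - P)) *\<^sub>R g - (n \<tau> \<bullet> g) *\<^sub>R (Q - P)"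
      by (simp add: cross3_simps forall_3)
    hence "cross3 (cross3 (Q - P) g) (n \<tau>) = 0" using o by simp
    hence "collinear {0, n \<tau>, cross3 (Q - P) g}"
      using cross_eq_0[of "n \<tau>" "cross3 (Q - P) g"] cross_skew[of "n \<tau>"] by simp
    then obtain c where "cross3 (Q - P) g = c *\<^sub>R n \<tau>"
      using kdg unit_normal[OF t(1)] unfolding collinear_lemma by auto
    hence "(R - P) \<bullet> cross3 (Q - P) g = 0" using o(2) by (simp add: inner_commute)
    then obtain \<alpha> \<beta> where ab: "R - P = \<alpha> *\<^sub>R (Q - P) + \<beta> *\<^sub>R g" using cramer_in_plane[OF kdg] by metis
    have "\<beta> \<noteq> 0" using cr unfolding ab by (auto simp: cross_mult_right)
    moreover have "\<not> \<beta> > 0"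
    proof
      assume b: "\<beta> > 0"
      have Rn: "R \<in> nodes T" using R t by (auto simp: nodes_def)
      have Qn: "Q \<in> nodes T" using Q Nn by auto
      have "(\<alpha> *\<^sub>R d + \<beta> *\<^sub>R g) - (((\<alpha> *\<^sub>R d + \<beta> *\<^sub>R g) \<bullet> g) / (g \<bullet> g)) *\<^sub>R g =
          \<alpha> *\<^sub>R (d - ((d \<bullet> g) / (g \<bullet> g)) *\<^sub>R g)" for d
      proof -
        have "((\<alpha> *\<^sub>R d + \<beta> *\<^sub>R g) \<bullet> g) / (g \<bullet> g) = \<alpha> * ((d \<bullet> g) / (g \<bullet> g)) + \<beta>"
          using gg by (simp add: inner_add_left add_divide_distrib)
        thus ?thesis by (simp only:) (simp add: algebra_simps)
      qed
      hence wR: "w R = \<alpha> *\<^sub>R w Q" unfolding w_def ab .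
      have "s R = - ((R - P) \<bullet> g)" "s Q = - ((Q - P) \<bullet> g)" unfolding s_def by (simp_all add: inner_diff_left)
      hence sR: "s R = \<alpha> * s Q - \<beta> * (g \<bullet> g)" unfolding ab by (simp add: inner_add_left)
      hence "\<alpha> * s Q \<ge> \<beta> * (g \<bullet> g)" using s0[OF Rn] by simp
      hence "\<alpha> * s Q > 0" using mult_pos_pos[OF b gg] by linarith
      hence a: "\<alpha> > 0" using s0[OF Qn] by (auto simp: zero_less_mult_iff)
      hence "R \<in> N" unfolding N_def using wR wQ t PQt R by auto
      from minim[OF this] have "s Q / norm (w Q) \<le> (\<alpha> * s Q - \<beta> * (g \<bullet> g)) / (\<alpha> * norm (w Q))"
        using wR a sR by simp
      also have "\<dots> = s Q / norm (w Q) - \<beta> * (g \<bullet> g) / (\<alpha> * norm (w Q))"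
        using a wQ by (simp add: diff_divide_distrib)
      also have "\<dots> < s Q / norm (w Q)" using a b gg wQ by simp
      finally show False by simp
    qed
    ultimately show ?thesis using R ab by (intro exI[of _ R] exI[of _ \<alpha>] exI[of _ \<beta>]) linarith
  qed
  obtain R1 \<alpha>1 \<beta>1 where 1: "\<tau>1 = convex hull {P, Q, R1}" "R1 - P = \<alpha>1 *\<^sub>R (Q - P) + \<beta>1 *\<^sub>R g" "\<beta>1 \<le> 0" "\<beta>1 \<noteq> 0"
    using third[OF mem(1,3)] by blast
  obtain R2 \<alpha>2 \<beta>2 where 2: "\<tau>2 = convex hull {P, Q, R2}" "R2 - P = \<alpha>2 *\<^sub>R (Q - P) + \<beta>2 *\<^sub>R g" "\<beta>2 \<le> 0" "\<beta>2 \<noteq> 0"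
    using third[OF mem(2,4)] by blast
  have "\<beta>1 * \<beta>2 > 0" "\<beta>2 * \<beta>1 > 0" using 1 2 by (auto simp: zero_less_mult_iff)
  hence "\<tau>1 \<subseteq> \<tau>2" "\<tau>2 \<subseteq> \<tau>1"
    using third_vertex_in_neighbour[OF mem(1,2) 1(1) 2(1) 1(2) 2(2)]
      third_vertex_in_neighbour[OF mem(2,1) 2(1) 1(1) 2(2) 1(2)] by auto
  thus False using t12(1) by auto
qed

lemma constant_on_connected_mesh:
  fixes f :: "real^3 \<Rightarrow> real"
  assumes con: "connected (\<Union>T)" and cont: "continuous_on (\<Union>T) f"
    and const: "\<And>\<tau>. \<tau> \<in> T \<Longrightarrow> \<exists>c. \<forall>x\<in>\<tau>. f x = c"
  shows "\<exists>c. \<forall>x\<in>\<Union>T. f x = c"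
proof -
  obtain c where "\<And>\<tau> x. \<tau> \<in> T \<Longrightarrow> x \<in> \<tau> \<Longrightarrow> f x = c \<tau>" using const by metis
  hence "f ` (\<Union>T) \<subseteq> c ` T" by auto
  hence "finite (f ` (\<Union>T))" using finite_mesh finite_subset by blast
  from continuous_finite_range_constant[OF con cont this] show ?thesis
    unfolding constant_on_def by blast
qed

lemma surf_integral_constant:
  assumes "\<And>x. x \<in> \<Union>T \<Longrightarrow> v x = c"
  shows "surf_integral T (\<lambda>\<tau>. v) = surf_area T * (c::real)"
proof -
  have "surf_integral T (\<lambda>\<tau>. v) = (\<Sum>\<tau>\<in>T. tri_area \<tau> * c)"
    unfolding surf_integral_def
    by (intro sum.cong refl) (subst integral_const_on_triangle[where c = c], use assms in auto)
  thus ?thesis by (simp add: surf_area_eq sum_distrib_right)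
qed

lemma surf_area_pos: "T \<noteq> {} \<Longrightarrow> surf_area T > 0"
  unfolding surf_area_eq by (intro sum_pos finite_mesh tri_area_pos simplex)

text \<open>Vanishing stabilisation makes the surface gradient agree with the continuous field
  \<open>G\<^sub>hv\<close>, and a continuous field with finitely many values is constant on a connected set.\<close>

lemma stab_form_definite:
  assumes con: "connected (\<Union>T)" and v: "v \<in> fe_space0 T" and z: "stab v v = 0"
  shows "v = (\<lambda>x. 0)"
proof (cases "T = {}")
  case True
  thus ?thesis using v by (auto simp: fe_space0_def fe_space_def)
next
  case ne: False
  have vf: "v \<in> fe_space T" and mean: "surf_integral T (\<lambda>\<tau>. v) = 0" using v by (auto simp: fe_space0_def)
  have eq: "surf_grad n v \<tau> x = G v x" if "\<tau> \<in> T" "x \<in> \<tau>" for \<tau> x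
    using surf_inner_self_eq_0[OF continuous_on_stab[OF vf] z[unfolded stab_form_def] that] by simp
  have "\<exists>c. \<forall>x\<in>\<Union>T. G v x $ i = c" for i
  proof (rule constant_on_connected_mesh[OF con])
    show "continuous_on (\<Union>T) (\<lambda>x. G v x $ i)"
      by (intro continuous_intros continuous_on_recovered_grad)
    fix \<tau> assume t: "\<tau> \<in> T"
    obtain g where "\<forall>x\<in>\<tau>. surf_grad n v \<tau> x = g" using surf_grad_const_on[OF vf t] ..
    thus "\<exists>c. \<forall>x\<in>\<tau>. G v x $ i = c" using eq[OF t] by metis
  qed
  then obtain c where c: "\<And>i x. x \<in> \<Union>T \<Longrightarrow> G v x $ i = c i" by metis
  define g where "g = (\<chi> i. c i)"
  have g: "G v x = g" if "x \<in> \<Union>T" for x using c[OF that] by (simp add: g_def vec_eq_iff)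
  have tri: "n \<tau> \<bullet> g = 0 \<and> (\<forall>x\<in>\<tau>. \<forall>y\<in>\<tau>. v x - v y = g \<bullet> (x - y))" if t: "\<tau> \<in> T" for \<tau>
  proof -
    obtain g' where g': "n \<tau> \<bullet> g' = 0" "\<forall>x\<in>\<tau>. surf_grad n v \<tau> x = g'" "\<forall>x\<in>\<tau>. \<forall>y\<in>\<tau>. v x - v y = g' \<bullet> (x - y)"
      using fe_surf_grad[OF vf t] by blast
    obtain x where "x \<in> \<tau>" using tri_nonempty[OF t] by auto
    hence "g' = g" using g' eq[OF t] g[of x] t by auto
    thus ?thesis using g' by simp
  qed
  have g0: "g = 0" by (rule no_common_tangent_direction[OF ne]) (use tri in auto)
  have "\<exists>c. \<forall>x\<in>\<Union>T. v x = c"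
  proof (rule constant_on_connected_mesh[OF con fe_space_continuous[OF vf]])
    fix \<tau> assume t: "\<tau> \<in> T"
    obtain x where x: "x \<in> \<tau>" using tri_nonempty[OF t] by auto
    have "v y = v x" if "y \<in> \<tau>" for y
    proof -
      have "v y - v x = g \<bullet> (y - x)" using tri[OF t] that x by blast
      thus ?thesis by (simp add: g0)
    qed
    thus "\<exists>c. \<forall>x\<in>\<tau>. v x = c" by blast
  qed
  then obtain c0 where c0: "\<And>x. x \<in> \<Union>T \<Longrightarrow> v x = c0" by blast
  have "surf_area T * c0 = 0" using surf_integral_constant[OF c0] mean by simp
  hence "c0 = 0" using surf_area_pos[OF ne] by simp
  hence "v x = 0" if "x \<in> \<Union>T" for x using c0[OF that] by simp
  moreover have "v x = 0" if "x \<notin> \<Union>T" for x using vf that unfolding fe_space_def by blast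
  ultimately show ?thesis by blast
qed

end

section \<open>Lipschitz images and charts of level sets\<close>

text \<open>An open set containing \<open>B\<close> of almost the same measure is divided into cubes that meet \<open>B\<close>.
  A cube with side \<open>s\<close> has diameter at most \<open>d s\<close>, so its part in \<open>B\<close> is mapped into a cube with
  side \<open>2 L d s\<close>.\<close>

lemma emeasure_lipschitz_image_le:
  fixes f :: "'a::euclidean_space \<Rightarrow> 'a"
  assumes B: "B \<in> sets borel" "bounded B" and X: "X \<in> sets borel" "X \<subseteq> f ` B"
    and lip: "\<And>x y. x \<in> B \<Longrightarrow> y \<in> B \<Longrightarrow> dist (f x) (f y) \<le> L * dist x y" and L: "L \<ge> 0"
  shows "emeasure lborel X \<le> ennreal ((2 * L * DIM('a)) ^ DIM('a)) * emeasure lborel B"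
proof -
  let ?d = "DIM('a)"
  define C where "C = (2 * L * ?d) ^ ?d"
  have C0: "C \<ge> 0" using L by (simp add: C_def)
  obtain R where R: "R > 0" "\<And>x. x \<in> B \<Longrightarrow> norm x \<le> R" using B(2) unfolding bounded_pos by auto
  have Bbox: "B \<subseteq> cbox (- (R *\<^sub>R One)) (R *\<^sub>R One)"
  proof
    fix x assume x: "x \<in> B"
    have "\<bar>x \<bullet> i\<bar> \<le> R" if "i \<in> Basis" for i using Basis_le_norm[OF that, of x] R(2)[OF x] by linarith
    thus "x \<in> cbox (- (R *\<^sub>R One)) (R *\<^sub>R One)" by (force simp: mem_box abs_le_iff)
  qed
  have box: "box (- (R *\<^sub>R One)) (R *\<^sub>R One :: 'a) \<noteq> {}" using R(1) by (simp add: box_ne_empty)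
  have main: "emeasure lborel X \<le> ennreal C * emeasure lborel U" if U: "open U" "B \<subseteq> U" for U
  proof -
    have ga: "gauge (\<lambda>x. if x \<in> U then U else UNIV)" using U unfolding gauge_def by auto
    obtain \<D> where D: "countable \<D>"
      "\<And>K. K \<in> \<D> \<Longrightarrow> interior K \<noteq> {} \<and> (\<exists>c d. K = cbox c d)"
      "pairwise (\<lambda>A B. interior A \<inter> interior B = {}) \<D>"
      "\<And>K. K \<in> \<D> \<Longrightarrow> \<exists>x \<in> B \<inter> K. K \<subseteq> (if x \<in> U then U else UNIV)"
      "\<And>u v. cbox u v \<in> \<D> \<Longrightarrow> \<exists>n. \<forall>i \<in> Basis. v \<bullet> i - u \<bullet> i = ((R *\<^sub>R One) \<bullet> i - (- (R *\<^sub>R One)) \<bullet> i) / 2^n"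
      "B \<subseteq> \<Union>\<D>"
      using covering_lemma[OF Bbox box ga] by metis
    have KU: "K \<subseteq> U" if "K \<in> \<D>" for K using D(4)[OF that] U by (auto split: if_splits)
    \<comment> \<open>each cube of the covering is mapped into a cube of comparable volume\<close>
    have "\<exists>Q. Q \<in> sets borel \<and> f ` (B \<inter> K) \<subseteq> Q \<and> emeasure lborel Q = ennreal C * emeasure lborel (interior K)"
      if K: "K \<in> \<D>" for K
    proof -
      obtain u v where uv: "K = cbox u v" using D(2)[OF K] by blast
      obtain n where n: "\<And>i. i \<in> Basis \<Longrightarrow> v \<bullet> i - u \<bullet> i = ((R *\<^sub>R One) \<bullet> i - (- (R *\<^sub>R One)) \<bullet> i) / 2^n"
        using D(5)[of u v] K uv by blast
      define s where "s = 2 * R / 2 ^ n"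
      have s0: "s \<ge> 0" using R by (simp add: s_def)
      have s: "v \<bullet> i - u \<bullet> i = s" if "i \<in> Basis" for i using n[OF that] that by (simp add: s_def)
      obtain x where x: "x \<in> B" "x \<in> K" using D(4)[OF K] by blast
      define \<rho> where "\<rho> = L * (?d * s)"
      have \<rho>0: "\<rho> \<ge> 0" using L s0 by (simp add: \<rho>_def)
      define Q where "Q = cbox (f x - \<rho> *\<^sub>R One) (f x + \<rho> *\<^sub>R One)"
      have "f y \<in> Q" if y: "y \<in> B" "y \<in> K" for y
      proof -
        have "norm (y - x) \<le> (\<Sum>i\<in>Basis. \<bar>(y - x) \<bullet> i\<bar>)" by (rule norm_le_l1)
        also have "\<dots> \<le> (\<Sum>i\<in>(Basis::'a set). s)"
        proof (rule sum_mono)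
          fix i :: 'a assume i: "i \<in> Basis"
          have "u \<bullet> i \<le> x \<bullet> i" "x \<bullet> i \<le> v \<bullet> i" "u \<bullet> i \<le> y \<bullet> i" "y \<bullet> i \<le> v \<bullet> i"
            using x y i unfolding uv mem_box by auto
          thus "\<bar>(y - x) \<bullet> i\<bar> \<le> s" using s[OF i] by (simp add: inner_diff_left)
        qed
        finally have "dist y x \<le> ?d * s" by (simp add: dist_norm)
        hence "dist (f y) (f x) \<le> \<rho>" unfolding \<rho>_def
          using lip[OF y(1) x(1)] mult_left_mono[OF _ L] by (meson order_trans)
        hence "norm (f y - f x) \<le> \<rho>" by (simp add: dist_norm)
        hence "\<bar>(f y - f x) \<bullet> i\<bar> \<le> \<rho>" if "i \<in> Basis" for i using Basis_le_norm[OF that, of "f y - f x"] by linarith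
        thus ?thesis unfolding Q_def mem_box by (auto simp: inner_diff_left inner_add_left abs_le_iff algebra_simps)
      qed
      moreover have "emeasure lborel Q = ennreal C * emeasure lborel (interior K)"
      proof -
        have "emeasure lborel Q = ennreal (\<Prod>i\<in>(Basis::'a set). 2 * \<rho>)"
          unfolding Q_def using \<rho>0
          by (subst emeasure_lborel_cbox) (auto simp: inner_diff_left inner_add_left intro!: arg_cong[where f = ennreal] prod.cong)
        also have "\<dots> = ennreal (C * s ^ ?d)"
          by (simp add: \<rho>_def C_def power_mult_distrib mult_ac)
        also have "\<dots> = ennreal C * ennreal (s ^ ?d)" using C0 s0 by (simp add: ennreal_mult)
        also have "ennreal (s ^ ?d) = emeasure lborel (interior K)"
        proof -
          have le: "u \<bullet> i \<le> v \<bullet> i" if "i \<in> Basis" for i using s[OF that] s0 by linarith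
          have "emeasure lborel (box u v) = ennreal (\<Prod>i\<in>Basis. (v - u) \<bullet> i)"
            using le by (rule emeasure_lborel_box)
          also have "(\<Prod>i\<in>Basis. (v - u) \<bullet> i) = (\<Prod>i\<in>(Basis::'a set). s)"
            by (rule prod.cong) (auto simp: inner_diff_left s)
          finally show ?thesis unfolding uv by simp
        qed
        finally show ?thesis .
      qed
      ultimately show ?thesis by (intro exI[of _ Q]) (auto simp: Q_def)
    qed
    then obtain Q where Q: "\<And>K. K \<in> \<D> \<Longrightarrow> Q K \<in> sets borel" "\<And>K. K \<in> \<D> \<Longrightarrow> f ` (B \<inter> K) \<subseteq> Q K"
      "\<And>K. K \<in> \<D> \<Longrightarrow> emeasure lborel (Q K) = ennreal C * emeasure lborel (interior K)" by metis
    \<comment> \<open>the cubes as a sequence, to apply countable additivity to their disjoint interiors\<close>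
    define I where "I = to_nat_on \<D> ` \<D>"
    define D' where "D' = (\<lambda>i. if i \<in> I then interior (from_nat_into \<D> i) else {})"
    define Q' where "Q' = (\<lambda>i. if i \<in> I then Q (from_nat_into \<D> i) else {})"
    have ID: "from_nat_into \<D> i \<in> \<D>" if "i \<in> I" for i using that D(1) by (auto simp: I_def)
    have "X \<subseteq> (\<Union>i. Q' i)"
    proof
      fix z assume "z \<in> X"
      then obtain x where x: "x \<in> B" "z = f x" using X by auto
      then obtain K where K: "K \<in> \<D>" "x \<in> K" using D(6) by auto
      have "z \<in> Q K" using Q(2)[OF K(1)] x K by auto
      hence "z \<in> Q' (to_nat_on \<D> K)" unfolding Q'_def I_def using K D(1) by simp
      thus "z \<in> (\<Union>i. Q' i)" by blast
    qed
    hence "emeasure lborel X \<le> emeasure lborel (\<Union>i. Q' i)"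
      by (rule emeasure_mono) (auto simp: Q'_def intro!: sets.countable_UN Q ID)
    also have "\<dots> \<le> (\<Sum>i. emeasure lborel (Q' i))"
      by (rule emeasure_subadditive_countably) (auto simp: Q'_def intro!: Q ID)
    also have "\<dots> = (\<Sum>i. ennreal C * emeasure lborel (D' i))"
      by (intro suminf_cong) (auto simp: Q'_def D'_def Q ID)
    also have "\<dots> = ennreal C * (\<Sum>i. emeasure lborel (D' i))" by simp
    also have "(\<Sum>i. emeasure lborel (D' i)) = emeasure lborel (\<Union>i. D' i)"
    proof (rule suminf_emeasure)
      show "range D' \<subseteq> sets lborel" by (auto simp: D'_def)
      show "disjoint_family D'"
        unfolding disjoint_family_on_def
      proof (intro ballI impI)
        fix i j :: nat assume ij: "i \<noteq> j"
        show "D' i \<inter> D' j = {}"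
        proof (cases "i \<in> I \<and> j \<in> I")
          case True
          hence "from_nat_into \<D> i \<noteq> from_nat_into \<D> j" using ij D(1) unfolding I_def by auto
          thus ?thesis using pairwiseD[OF D(3) ID ID, of i j] True by (simp add: D'_def)
        qed (auto simp: D'_def)
      qed
    qed
    also have "\<dots> \<le> emeasure lborel U"
    proof (rule emeasure_mono)
      show "(\<Union>i. D' i) \<subseteq> U" using KU ID interior_subset by (fastforce simp: D'_def split: if_splits)
    qed (use U in auto)
    finally show ?thesis by (simp add: mult_left_mono)
  qed
  have "emeasure lborel X \<le> ennreal C * emeasure lborel B + ennreal e" if e: "e > 0" for e
  proof -
    have e': "e / (C + 1) > 0" using e C0 by simp
    obtain U where U: "open U" "B \<subseteq> U" "emeasure lborel (U - B) < ennreal (e / (C + 1))"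
      using outer_regular_lborel[OF B(1) e'] .
    have "emeasure lborel U \<le> emeasure lborel B + emeasure lborel (U - B)"
    proof -
      have "U = B \<union> (U - B)" using U by auto
      hence "emeasure lborel U = emeasure lborel (B \<union> (U - B))" by simp
      also have "\<dots> \<le> emeasure lborel B + emeasure lborel (U - B)"
        by (rule emeasure_subadditive) (use B U in auto)
      finally show ?thesis .
    qed
    also have "\<dots> \<le> emeasure lborel B + ennreal (e / (C + 1))" using U(3) by (intro add_left_mono) simp
    finally have "ennreal C * emeasure lborel U \<le> ennreal C * (emeasure lborel B + ennreal (e / (C + 1)))"
      by (rule mult_left_mono) simp
    also have "\<dots> = ennreal C * emeasure lborel B + ennreal (C * (e / (C + 1)))"
      unfolding distrib_left using ennreal_mult[OF C0 less_imp_le[OF e']] by simp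
    also have "\<dots> \<le> ennreal C * emeasure lborel B + ennreal e"
      using C0 e by (intro add_left_mono ennreal_leI) (simp add: field_simps)
    finally show ?thesis using main[OF U(1,2)] by (rule order_trans[rotated])
  qed
  hence "emeasure lborel X \<le> ennreal C * emeasure lborel B" by (rule ennreal_le_epsilon)
  thus ?thesis by (simp add: C_def)
qed

lemma orthonormal_frame_containing:
  fixes e :: "real^3"
  assumes "norm e = 1"
  obtains E1 E2 where "norm E1 = 1" "norm E2 = 1" "E1 \<bullet> E2 = 0" "E1 \<bullet> e = 0" "E2 \<bullet> e = 0"
    "\<And>x. x = (x \<bullet> E1) *\<^sub>R E1 + (x \<bullet> E2) *\<^sub>R E2 + (x \<bullet> e) *\<^sub>R e"
proof -
  have "norm (axis 3 1 :: real^3) = 1" by simp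
  then obtain f :: "real^3 \<Rightarrow> real^3" where f: "orthogonal_transformation f" "f (axis 3 1) = e"
    using orthogonal_transformation_exists_1 assms by metis
  have ip: "f x \<bullet> f y = x \<bullet> y" for x y using f(1) by (simp add: orthogonal_transformation_def)
  have lin: "linear f" using f(1) by (simp add: orthogonal_transformation_def)
  show ?thesis
  proof (rule that[of "f (axis 1 1)" "f (axis 2 1)"])
    show "norm (f (axis 1 1)) = 1" "norm (f (axis 2 1)) = 1"
      using f(1) by (simp_all add: orthogonal_transformation_norm)
    show "f (axis 1 1) \<bullet> f (axis 2 1) = 0" "f (axis 1 1) \<bullet> e = 0" "f (axis 2 1) \<bullet> e = 0"
      unfolding f(2)[symmetric] ip by (simp_all add: inner_axis_axis)
    fix x
    obtain z where z: "x = f z" using orthogonal_transformation_surj[OF f(1)] by (metis surjD)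
    have "z = z $ 1 *\<^sub>R axis 1 1 + z $ 2 *\<^sub>R axis 2 1 + z $ 3 *\<^sub>R axis 3 1"
      by (simp add: vec_eq_iff forall_3 axis_def)
    hence "f z = f (z $ 1 *\<^sub>R axis 1 1 + z $ 2 *\<^sub>R axis 2 1 + z $ 3 *\<^sub>R axis 3 1)" by simp
    also have "\<dots> = z $ 1 *\<^sub>R f (axis 1 1) + z $ 2 *\<^sub>R f (axis 2 1) + z $ 3 *\<^sub>R f (axis 3 1)"
      using lin by (simp add: linear_add linear_scale)
    finally show "x = (x \<bullet> f (axis 1 1)) *\<^sub>R f (axis 1 1) + (x \<bullet> f (axis 2 1)) *\<^sub>R f (axis 2 1) + (x \<bullet> e) *\<^sub>R e"
      unfolding z f(2)[symmetric] ip by (simp add: inner_axis)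
  qed
qed

locale regular_level_set =
  fixes S U :: "(real^3) set" and F :: "real^3 \<Rightarrow> real" and g :: "real^3 \<Rightarrow> real^3"
  assumes open_U: "open U"
    and der: "y \<in> U \<Longrightarrow> (F has_derivative (\<lambda>v. g y \<bullet> v)) (at y)"
    and regular: "y \<in> U \<Longrightarrow> g y \<noteq> 0"
    and contg: "continuous_on U g"
    and SU: "S \<inter> U = {y \<in> U. F y = 0}"
begin

text \<open>Subtracting the linear part at \<open>y0\<close> leaves a function with a small derivative near \<open>y0\<close>,
  and \<open>F a = F b\<close> turns the mean value inequality for it into a bound for the chord.\<close>

lemma chords_almost_tangent:
  assumes y0: "y0 \<in> U" and \<epsilon>: "\<epsilon> > 0"
  shows "\<exists>r>0. ball y0 r \<subseteq> U \<and>
    (\<forall>y\<in>ball y0 r. \<forall>a\<in>ball y0 r. \<forall>b\<in>ball y0 r. F a = F b \<longrightarrow>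
       \<bar>g y \<bullet> (b - a)\<bar> \<le> \<epsilon> * (norm (g y) * norm (b - a)))"
proof -
  \<comment> \<open>the second bound keeps \<open>\<parallel>g y\<parallel> \<ge> \<parallel>g y0\<parallel> / 2\<close> near \<open>y0\<close>\<close>
  define \<eta> where "\<eta> = min (\<epsilon> / 4 * norm (g y0)) (norm (g y0) / 2)"
  have \<eta>: "\<eta> > 0" using \<epsilon> regular[OF y0] by (simp add: \<eta>_def)
  have "isCont g y0" using contg open_U y0 by (simp add: continuous_on_eq_continuous_at)
  then obtain d where d: "d > 0" "\<And>y. dist y y0 < d \<Longrightarrow> dist (g y) (g y0) < \<eta>"
    using \<eta> unfolding continuous_at_eps_delta by blast
  obtain d' where d': "d' > 0" "ball y0 d' \<subseteq> U" using open_U y0 open_contains_ball by blast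
  define r where "r = min d d'"
  have near: "norm (g y - g y0) \<le> \<eta>" if "y \<in> ball y0 r" for y
    using d(2)[of y] that by (simp add: r_def dist_norm norm_minus_commute)
  have sub: "ball y0 r \<subseteq> U" using d'(2) by (auto simp: r_def)
  have main: "\<bar>g y \<bullet> (b - a)\<bar> \<le> \<epsilon> * (norm (g y) * norm (b - a))"
    if y: "y \<in> ball y0 r" and a: "a \<in> ball y0 r" and b: "b \<in> ball y0 r" and F: "F a = F b" for y a b
  proof -
    have "norm ((F b - g y0 \<bullet> b) - (F a - g y0 \<bullet> a)) \<le> \<eta> * norm (b - a)"
    proof (rule differentiable_bound[OF convex_ball _ _ b a])
      fix x assume x: "x \<in> ball y0 r"
      show "((\<lambda>x. F x - g y0 \<bullet> x) has_derivative (\<lambda>v. (g x - g y0) \<bullet> v)) (at x within ball y0 r)"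
      proof -
        have "(F has_derivative (\<lambda>v. g x \<bullet> v)) (at x within ball y0 r)"
          using der x sub by (blast intro: has_derivative_at_withinI)
        moreover have "((\<lambda>x. g y0 \<bullet> x) has_derivative (\<lambda>v. g y0 \<bullet> v)) (at x within ball y0 r)"
          by (intro derivative_eq_intros) auto
        ultimately show ?thesis unfolding inner_diff_left by (rule has_derivative_diff)
      qed
      show "onorm (\<lambda>v. (g x - g y0) \<bullet> v) \<le> \<eta>"
      proof (rule onorm_le)
        fix v
        have "\<bar>(g x - g y0) \<bullet> v\<bar> \<le> norm (g x - g y0) * norm v" by (rule Cauchy_Schwarz_ineq2)
        also have "\<dots> \<le> \<eta> * norm v" by (rule mult_right_mono[OF near[OF x]]) simp
        finally show "norm ((g x - g y0) \<bullet> v) \<le> \<eta> * norm v" by simp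
      qed
    qed
    hence 1: "\<bar>g y0 \<bullet> (b - a)\<bar> \<le> \<eta> * norm (b - a)" using F by (simp add: inner_diff_right abs_minus_commute)
    have "\<bar>(g y - g y0) \<bullet> (b - a)\<bar> \<le> norm (g y - g y0) * norm (b - a)" by (rule Cauchy_Schwarz_ineq2)
    also have "\<dots> \<le> \<eta> * norm (b - a)" by (intro mult_right_mono near y) simp
    finally have 2: "\<bar>(g y - g y0) \<bullet> (b - a)\<bar> \<le> \<eta> * norm (b - a)" .
    have "g y \<bullet> (b - a) = g y0 \<bullet> (b - a) + (g y - g y0) \<bullet> (b - a)" by (simp add: inner_diff_left)
    hence 3: "\<bar>g y \<bullet> (b - a)\<bar> \<le> 2 * \<eta> * norm (b - a)" using 1 2 by linarith
    have "norm (g y0) \<le> norm (g y) + norm (g y - g y0)"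
      by (metis norm_minus_commute norm_triangle_sub)
    hence "norm (g y) \<ge> norm (g y0) / 2" using near[OF y] unfolding \<eta>_def by linarith
    hence "\<epsilon> * (norm (g y0) / 2) \<le> \<epsilon> * norm (g y)" using \<epsilon> by (intro mult_left_mono) auto
    moreover have "2 * \<eta> \<le> \<epsilon> * (norm (g y0) / 2)" unfolding \<eta>_def by linarith
    ultimately have "2 * \<eta> \<le> \<epsilon> * norm (g y)" by linarith
    hence "2 * \<eta> * norm (b - a) \<le> \<epsilon> * norm (g y) * norm (b - a)" by (rule mult_right_mono) simp
    thus ?thesis using 3 by (simp add: mult.assoc)
  qed
  have "r > 0" using d(1) d'(1) by (simp add: r_def)
  thus ?thesis using sub main by blast
qed

text \<open>The inverse function theorem is applied to \<open>F\<close> completed by two tangential coordinates. The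
  surface becomes a graph over its tangent plane at \<open>y0\<close>: the area element is at least 1, and since
  chords are almost tangent the chart is Lipschitz with constant 2. The last clause comes from
  the vanishing derivative of the squared distance at its minimum in the chart.\<close>

lemma chart:
  assumes y0S: "y0 \<in> S" and y0: "y0 \<in> U" and r1: "r1 > 0"
  shows "\<exists>W V (\<phi> :: real \<times> real \<Rightarrow> real^3) \<phi>'. open W \<and> bounded W \<and> inj_on \<phi> W \<and> \<phi> ` W \<subseteq> S \<and>
    (\<forall>w\<in>W. (\<phi> has_derivative \<phi>' w) (at w) \<and> inj (\<phi>' w)) \<and> (\<forall>v. continuous_on W (\<lambda>w. \<phi>' w v)) \<and>
    (\<forall>w\<in>W. norm (cross3 (\<phi>' w (1, 0)) (\<phi>' w (0, 1))) \<ge> 1) \<and>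
    (\<forall>w\<in>W. \<forall>w'\<in>W. dist (\<phi> w) (\<phi> w') \<le> 2 * dist w w') \<and>
    open V \<and> y0 \<in> V \<and> S \<inter> V \<subseteq> \<phi> ` W \<and> V \<subseteq> ball y0 r1 \<and>
    (\<forall>x. (\<forall>z\<in>S. dist x y0 \<le> dist x z) \<longrightarrow> (\<exists>s. x - y0 = s *\<^sub>R g y0))"
proof -
  obtain r2 where r2: "r2 > 0" "ball y0 r2 \<subseteq> U" "\<And>y a b. y \<in> ball y0 r2 \<Longrightarrow> a \<in> ball y0 r2 \<Longrightarrow>
      b \<in> ball y0 r2 \<Longrightarrow> F a = F b \<Longrightarrow> \<bar>g y \<bullet> (b - a)\<bar> \<le> 1/2 * (norm (g y) * norm (b - a))"
    using chords_almost_tangent[OF y0, of "1/2"] by force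
  define r where "r = min r1 r2"
  have r: "r > 0" "r \<le> r1" using r1 r2 by (simp_all add: r_def)
  have level: "F y = 0" if "y \<in> S" "y \<in> U" for y using SU that by blast
  have chord: "\<bar>g y0 \<bullet> (y - z)\<bar> \<le> 1/2 * (norm (g y0) * norm (y - z))"
    if "y \<in> S" "y \<in> ball y0 r" "z \<in> S" "z \<in> ball y0 r" for y z
  proof -
    have in_ball: "y \<in> ball y0 r2" "z \<in> ball y0 r2" "y0 \<in> ball y0 r2" using that r2(1) by (auto simp: r_def)
    hence "F y = 0" "F z = 0" using level that r2(2) by blast+
    thus ?thesis using r2(3)[OF in_ball(3,2,1)] by simp
  qed
  have g0: "g y0 \<noteq> 0" by (rule regular[OF y0])
  define e where "e = (1 / norm (g y0)) *\<^sub>R g y0"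
  have e1: "norm e = 1" using g0 by (simp add: e_def)
  have ge: "g y0 = norm (g y0) *\<^sub>R e" using g0 by (simp add: e_def)
  obtain E1 E2 where fr: "norm E1 = 1" "norm E2 = 1" "E1 \<bullet> E2 = 0" "E1 \<bullet> e = 0" "E2 \<bullet> e = 0"
    "\<And>x. x = (x \<bullet> E1) *\<^sub>R E1 + (x \<bullet> E2) *\<^sub>R E2 + (x \<bullet> e) *\<^sub>R e"
    using orthonormal_frame_containing[OF e1] by metis
  have uu: "E1 \<bullet> E1 = 1" "E2 \<bullet> E2 = 1" "e \<bullet> e = 1" using fr e1 by (simp_all add: norm_eq_1)
  have ort: "E2 \<bullet> E1 = 0" "e \<bullet> E1 = 0" "e \<bullet> E2 = 0" using fr by (simp_all add: inner_commute)
  note on = uu ort fr(3-5)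
  have ip: "x \<bullet> y = (x \<bullet> E1) * (y \<bullet> E1) + (x \<bullet> E2) * (y \<bullet> E2) + (x \<bullet> e) * (y \<bullet> e)" for x y
  proof -
    have "x \<bullet> y = x \<bullet> ((y \<bullet> E1) *\<^sub>R E1 + (y \<bullet> E2) *\<^sub>R E2 + (y \<bullet> e) *\<^sub>R e)" using fr(6)[of y] by simp
    also have "\<dots> = (x \<bullet> E1) * (y \<bullet> E1) + (x \<bullet> E2) * (y \<bullet> E2) + (x \<bullet> e) * (y \<bullet> e)"
      by (simp add: inner_add_right mult.commute)
    finally show ?thesis .
  qed
  \<comment> \<open>the flattening map: two tangential coordinates and the level function\<close>
  define \<Phi> where "\<Phi> = (\<lambda>z. ((z - y0) \<bullet> E1) *\<^sub>R E1 + ((z - y0) \<bullet> E2) *\<^sub>R E2 + F z *\<^sub>R e)"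
  define d where "d = (\<lambda>z v. (v \<bullet> E1) *\<^sub>R E1 + (v \<bullet> E2) *\<^sub>R E2 + (g z \<bullet> v) *\<^sub>R e)"
  define D where "D = (\<lambda>z. Blinfun (d z))"
  have bl: "bounded_linear (d z)" for z unfolding d_def
    by (intro bounded_linear_intros)
  have Dd: "blinfun_apply (D z) = d z" for z unfolding D_def by (rule bounded_linear_Blinfun_apply[OF bl])
  have contD: "continuous_on U D"
    unfolding continuous_on_eq_continuous_within
  proof
    fix z assume "z \<in> U"
    hence cz: "continuous (at z within U) g" using contg continuous_on_eq_continuous_within by blast
    show "continuous (at z within U) D"
      by (rule continuous_blinfun_componentwiseI1) (auto simp: Dd d_def intro!: continuous_intros cz)
  qed
  have der\<Phi>: "(\<Phi> has_derivative blinfun_apply (D z)) (at z)" if "z \<in> U" for z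
    unfolding Dd \<Phi>_def d_def by (auto intro!: derivative_eq_intros der[OF that])
  define inv0 where "inv0 = Blinfun (\<lambda>u. (u \<bullet> E1) *\<^sub>R E1 + (u \<bullet> E2) *\<^sub>R E2 + (u \<bullet> ((1 / norm (g y0)) *\<^sub>R e)) *\<^sub>R e)"
  have binv: "bounded_linear (\<lambda>u. (u \<bullet> E1) *\<^sub>R E1 + (u \<bullet> E2) *\<^sub>R E2 + (u \<bullet> ((1 / norm (g y0)) *\<^sub>R e)) *\<^sub>R e)"
    by (intro bounded_linear_intros)
  have inv0: "blinfun_apply inv0 u = (u \<bullet> E1) *\<^sub>R E1 + (u \<bullet> E2) *\<^sub>R E2 + (u \<bullet> ((1 / norm (g y0)) *\<^sub>R e)) *\<^sub>R e" for u
    unfolding inv0_def bounded_linear_Blinfun_apply[OF binv] ..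
  have dE: "d z v \<bullet> E1 = v \<bullet> E1" "d z v \<bullet> E2 = v \<bullet> E2" "d z v \<bullet> e = g z \<bullet> v" for z v
    by (simp_all add: d_def inner_add_left on)
  have "blinfun_apply (inv0 o\<^sub>L D y0) v = v" for v
  proof -
    have "(g y0 \<bullet> v) / norm (g y0) = v \<bullet> e" using g0 by (subst ge) (simp add: inner_commute)
    thus ?thesis
      using fr(6)[of v] by (simp add: Dd dE inv0)
  qed
  hence inv: "inv0 o\<^sub>L D y0 = id_blinfun" by (intro blinfun_eqI) simp
  obtain U' V \<Psi> \<Psi>' where IF: "open U'" "U' \<subseteq> U" "y0 \<in> U'" "open V" "\<Phi> y0 \<in> V" "homeomorphism U' V \<Phi> \<Psi>"
    "\<And>y. y \<in> V \<Longrightarrow> (\<Psi> has_derivative (\<Psi>' y)) (at y)"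
    "\<And>y. y \<in> V \<Longrightarrow> \<Psi>' y = inv (blinfun_apply (D (\<Psi> y)))"
    "\<And>y. y \<in> V \<Longrightarrow> bij (blinfun_apply (D (\<Psi> y)))"
    using inverse_function_theorem[OF open_U der\<Phi> contD y0 inv] by metis
  have hom: "\<And>y. y \<in> V \<Longrightarrow> \<Psi> y \<in> U'" "\<And>y. y \<in> V \<Longrightarrow> \<Phi> (\<Psi> y) = y" "\<And>y. y \<in> U' \<Longrightarrow> \<Psi> (\<Phi> y) = y"
    "\<And>y. y \<in> U' \<Longrightarrow> \<Phi> y \<in> V" "continuous_on V \<Psi>"
    using IF(6) by (auto simp: homeomorphism_def)
  define l where "l = (\<lambda>w::real \<times> real. fst w *\<^sub>R E1 + snd w *\<^sub>R E2)"
  have lE: "l w \<bullet> E1 = fst w" "l w \<bullet> E2 = snd w" "l w \<bullet> e = 0" for w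
    by (simp_all add: l_def inner_add_left on)
  define W where "W = l -` (V \<inter> \<Psi> -` ball y0 r)"
  define \<phi> where "\<phi> = (\<lambda>w. \<Psi> (l w))"
  define \<phi>' where "\<phi>' = (\<lambda>w v. \<Psi>' (l w) (l v))"
  have WV: "l w \<in> V" "\<phi> w \<in> ball y0 r" if "w \<in> W" for w using that by (auto simp: W_def \<phi>_def)
  have \<phi>U: "\<phi> w \<in> U" if "w \<in> W" for w using hom(1) WV(1)[OF that] IF(2) unfolding \<phi>_def by blast
  have \<Phi>\<phi>: "\<Phi> (\<phi> w) = l w" if "w \<in> W" for w unfolding \<phi>_def by (rule hom(2)[OF WV(1)[OF that]])
  have \<Phi>E: "\<Phi> z \<bullet> E1 = (z - y0) \<bullet> E1" "\<Phi> z \<bullet> E2 = (z - y0) \<bullet> E2" "\<Phi> z \<bullet> e = F z" for z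
    by (simp_all add: \<Phi>_def inner_add_left on)
  have coord: "(\<phi> w - y0) \<bullet> E1 = fst w" "(\<phi> w - y0) \<bullet> E2 = snd w" "F (\<phi> w) = 0" if "w \<in> W" for w
    using \<Phi>E[of "\<phi> w"] lE[of w] unfolding \<Phi>\<phi>[OF that] by simp_all
  have \<phi>S: "\<phi> w \<in> S" if "w \<in> W" for w using coord(3)[OF that] \<phi>U[OF that] SU by blast
  have oW: "open W" unfolding W_def
  proof (rule open_vimage)
    show "open (V \<inter> \<Psi> -` ball y0 r)" by (intro continuous_open_preimage hom IF) auto
    show "continuous_on UNIV l" unfolding l_def by (intro continuous_intros)
  qed
  have der\<phi>: "(\<phi> has_derivative \<phi>' w) (at w)" if "w \<in> W" for w
  proof -
    have "(l has_derivative l) (at w)" unfolding l_def by (auto intro!: derivative_eq_intros)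
    from diff_chain_at[OF this IF(7)[OF WV(1)[OF that]]] show ?thesis
      unfolding \<phi>_def \<phi>'_def by (simp add: o_def)
  qed
  have bd: "bij (d (\<phi> w))" if "w \<in> W" for w
    using IF(9)[OF WV(1)[OF that]] unfolding Dd by (simp add: \<phi>_def)
  have d\<phi>': "d (\<phi> w) (\<phi>' w v) = l v" if "w \<in> W" for w v
  proof -
    have "\<phi>' w v = inv (d (\<phi> w)) (l v)"
      unfolding \<phi>'_def IF(8)[OF WV(1)[OF that]] Dd by (simp add: \<phi>_def)
    thus ?thesis using bd[OF that] by (simp add: bij_is_surj surj_f_inv_f)
  qed
  have \<phi>'E: "\<phi>' w v \<bullet> E1 = fst v" "\<phi>' w v \<bullet> E2 = snd v" "g (\<phi> w) \<bullet> \<phi>' w v = 0" if "w \<in> W" for w v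
    using dE[of "\<phi> w" "\<phi>' w v"] lE[of v] unfolding d\<phi>'[OF that] by simp_all
  have gE: "g (\<phi> w) \<bullet> e \<noteq> 0" if "w \<in> W" for w
  proof
    assume "g (\<phi> w) \<bullet> e = 0"
    hence "d (\<phi> w) e = d (\<phi> w) 0" by (simp add: d_def on)
    hence "e = 0" using bd[OF that] by (meson bij_def injD)
    thus False using e1 by simp
  qed
  \<comment> \<open>the third component is determined by tangency: \<open>g\<close> is orthogonal to the derivative of the chart\<close>
  have third: "\<phi>' w v \<bullet> e = - (fst v * (g (\<phi> w) \<bullet> E1) + snd v * (g (\<phi> w) \<bullet> E2)) / (g (\<phi> w) \<bullet> e)" if "w \<in> W" for w v
  proof -
    have "0 = (g (\<phi> w) \<bullet> E1) * fst v + (g (\<phi> w) \<bullet> E2) * snd v + (g (\<phi> w) \<bullet> e) * (\<phi>' w v \<bullet> e)"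
      using ip[of "g (\<phi> w)" "\<phi>' w v"] unfolding \<phi>'E[OF that] by simp
    thus ?thesis using gE[OF that] by (simp add: field_simps)
  qed
  have form: "\<phi>' w v = fst v *\<^sub>R E1 + snd v *\<^sub>R E2 +
     (- (fst v * (g (\<phi> w) \<bullet> E1) + snd v * (g (\<phi> w) \<bullet> E2)) / (g (\<phi> w) \<bullet> e)) *\<^sub>R e" if "w \<in> W" for w v
    using fr(6)[of "\<phi>' w v"] unfolding \<phi>'E(1,2)[OF that] third[OF that] .
  have cont\<phi>: "continuous_on W \<phi>"
    by (meson continuous_at_imp_continuous_on der\<phi> has_derivative_continuous)
  have contg\<phi>: "continuous_on W (\<lambda>w. g (\<phi> w))"
    by (rule continuous_on_compose2[OF contg cont\<phi>]) (use \<phi>U in auto)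
  have cont\<phi>': "continuous_on W (\<lambda>w. \<phi>' w v)" for v
  proof -
    have "continuous_on W (\<lambda>w. fst v *\<^sub>R E1 + snd v *\<^sub>R E2 +
     (- (fst v * (g (\<phi> w) \<bullet> E1) + snd v * (g (\<phi> w) \<bullet> E2)) / (g (\<phi> w) \<bullet> e)) *\<^sub>R e)"
      by (intro continuous_intros contg\<phi>) (use gE in auto)
    thus ?thesis by (rule continuous_on_eq) (simp add: form)
  qed
  have cross: "norm (cross3 (\<phi>' w (1, 0)) (\<phi>' w (0, 1))) \<ge> 1" if "w \<in> W" for w
  proof -
    let ?p = "\<phi>' w (1, 0)" and ?q = "\<phi>' w (0, 1)"
    define \<alpha> where "\<alpha> = ?p \<bullet> e" define \<beta> where "\<beta> = ?q \<bullet> e"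
    have "?p \<bullet> ?p = 1 + \<alpha>\<^sup>2" "?q \<bullet> ?q = 1 + \<beta>\<^sup>2" "?p \<bullet> ?q = \<alpha> * \<beta>"
      using ip[of ?p ?p] ip[of ?q ?q] ip[of ?p ?q] unfolding \<phi>'E(1,2)[OF that] \<alpha>_def \<beta>_def
      by (simp_all add: power2_eq_square)
    moreover have "(norm (cross3 ?p ?q))\<^sup>2 = (?p \<bullet> ?p) * (?q \<bullet> ?q) - (?p \<bullet> ?q)\<^sup>2"
      using norm_cross_dot[of ?p ?q] by (simp add: power_mult_distrib power2_norm_eq_inner)
    ultimately have "(norm (cross3 ?p ?q))\<^sup>2 = 1 + \<alpha>\<^sup>2 + \<beta>\<^sup>2" by (simp add: algebra_simps power2_eq_square)
    hence "1\<^sup>2 \<le> (norm (cross3 ?p ?q))\<^sup>2" by simp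
    thus ?thesis by (rule power2_le_imp_le) simp
  qed
  have lip: "dist (\<phi> w) (\<phi> w') \<le> 2 * dist w w'" if w: "w \<in> W" "w' \<in> W" for w w'
  proof -
    define x where "x = \<phi> w - \<phi> w'"
    have "\<bar>g y0 \<bullet> x\<bar> \<le> 1/2 * (norm (g y0) * norm x)"
      unfolding x_def by (intro chord WV(2) \<phi>S w)
    hence "norm (g y0) * \<bar>x \<bullet> e\<bar> \<le> norm (g y0) * (norm x / 2)"
      by (subst (asm) ge) (simp add: abs_mult inner_commute)
    hence "\<bar>x \<bullet> e\<bar> \<le> norm x / 2" using g0 by simp
    hence "(x \<bullet> e)\<^sup>2 \<le> (norm x / 2)\<^sup>2" by (metis abs_ge_zero power2_abs power_mono)
    moreover have "x \<bullet> E1 = fst w - fst w'" "x \<bullet> E2 = snd w - snd w'"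
      using coord(1,2)[OF w(1)] coord(1,2)[OF w(2)] unfolding x_def by (simp_all add: inner_diff_left)
    hence "(norm x)\<^sup>2 = (dist w w')\<^sup>2 + (x \<bullet> e)\<^sup>2"
      using ip[of x x] by (simp add: power2_norm_eq_inner dist_norm norm_prod_def power2_eq_square[symmetric] minus_prod_def)
    ultimately have "(norm x)\<^sup>2 \<le> (dist w w')\<^sup>2 + (norm x)\<^sup>2 / 4" by (simp add: power_divide)
    hence "(norm x)\<^sup>2 \<le> 4 * (dist w w')\<^sup>2" using zero_le_power2[of "dist w w'"] by linarith
    hence "(norm x)\<^sup>2 \<le> (2 * dist w w')\<^sup>2" by (simp add: power_mult_distrib)
    hence "norm x \<le> 2 * dist w w'" by (rule power2_le_imp_le) simp
    thus ?thesis by (simp add: x_def dist_norm)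
  qed
  have bW: "bounded W"
    unfolding bounded_iff
  proof (intro exI[of _ "r + r"] ballI)
    fix w assume w: "w \<in> W"
    have "norm (\<phi> w - y0) \<le> r" using WV(2)[OF w] by (simp add: dist_norm norm_minus_commute)
    moreover have "\<bar>fst w\<bar> \<le> norm (\<phi> w - y0)" "\<bar>snd w\<bar> \<le> norm (\<phi> w - y0)"
      using Cauchy_Schwarz_ineq2[of "\<phi> w - y0" E1] Cauchy_Schwarz_ineq2[of "\<phi> w - y0" E2] fr(1,2)
      unfolding coord(1,2)[OF w] by simp_all
    moreover have "norm w \<le> \<bar>fst w\<bar> + \<bar>snd w\<bar>" using norm_Pair_le[of "fst w" "snd w"] by simp
    ultimately show "norm w \<le> r + r" by linarith
  qed
  have injW: "inj_on \<phi> W"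
    by (rule inj_onI) (metis coord(1,2) prod_eqI)
  have inj': "inj (\<phi>' w)" if "w \<in> W" for w
    by (rule injI) (metis \<phi>'E(1,2)[OF that] prod_eqI)
  define N where "N = U' \<inter> ball y0 r"
  have pre: "\<exists>w\<in>W. y = \<phi> w \<and> fst w = (y - y0) \<bullet> E1 \<and> snd w = (y - y0) \<bullet> E2" if y: "y \<in> S" "y \<in> N" for y
  proof -
    define w where "w = ((y - y0) \<bullet> E1, (y - y0) \<bullet> E2)"
    have yU': "y \<in> U'" using y by (simp add: N_def)
    have "F y = 0" using y yU' IF(2) SU by blast
    hence "\<Phi> y = l w" by (simp add: \<Phi>_def l_def w_def)
    hence lw: "l w \<in> V" "\<Psi> (l w) = y" using hom(3,4)[OF yU'] by simp_all
    hence "\<phi> w = y" by (simp add: \<phi>_def)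
    moreover have "w \<in> W" using y lw by (simp add: W_def N_def)
    ultimately have "w \<in> W" "\<phi> w = y" by simp_all
    thus ?thesis using \<open>\<phi> w = y\<close> by (intro bexI[of _ w]) (auto simp: w_def)
  qed
  have y0N: "y0 \<in> N" using IF(3) r by (simp add: N_def)
  have normal: "\<exists>s. x - y0 = s *\<^sub>R g y0" if x: "\<And>z. z \<in> S \<Longrightarrow> dist x y0 \<le> dist x z" for x
  proof -
    obtain w0 where w0: "w0 \<in> W" "y0 = \<phi> w0" using pre[OF y0S y0N] by blast
    define f where "f = (\<lambda>w. (\<phi> w - x) \<bullet> (\<phi> w - x))"
    have "(f has_derivative (\<lambda>v. (\<phi> w0 - x) \<bullet> \<phi>' w0 v + \<phi>' w0 v \<bullet> (\<phi> w0 - x))) (at w0)"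
      unfolding f_def by (auto intro!: derivative_eq_intros der\<phi>[OF w0(1)])
    moreover have "\<forall>w\<in>W. f w0 \<le> f w"
    proof
      fix w assume "w \<in> W"
      hence "dist x y0 \<le> dist x (\<phi> w)" using x \<phi>S by blast
      hence "(norm (\<phi> w0 - x))\<^sup>2 \<le> (norm (\<phi> w - x))\<^sup>2"
        by (intro power_mono) (auto simp: w0(2) dist_norm norm_minus_commute)
      thus "f w0 \<le> f w" by (simp add: f_def power2_norm_eq_inner)
    qed
    ultimately have dz: "(\<lambda>v. (\<phi> w0 - x) \<bullet> \<phi>' w0 v + \<phi>' w0 v \<bullet> (\<phi> w0 - x)) = (\<lambda>v. 0)"
      using differential_zero_maxmin[OF w0(1) oW] by blast
    have z: "(y0 - x) \<bullet> \<phi>' w0 v = 0" for v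
    proof -
      have "(\<phi> w0 - x) \<bullet> \<phi>' w0 v + \<phi>' w0 v \<bullet> (\<phi> w0 - x) = 0" by (rule fun_cong[OF dz])
      thus ?thesis unfolding w0(2) inner_commute[of "\<phi>' w0 v"] by linarith
    qed
    have "\<phi>' w0 v = fst v *\<^sub>R E1 + snd v *\<^sub>R E2" for v
    proof -
      have "g (\<phi> w0) \<bullet> E1 = 0" "g (\<phi> w0) \<bullet> E2 = 0"
        unfolding w0(2)[symmetric] by (subst ge, simp add: on)+
      thus ?thesis using form[OF w0(1), of v] by simp
    qed
    hence "(y0 - x) \<bullet> E1 = 0" "(y0 - x) \<bullet> E2 = 0" using z[of "(1,0)"] z[of "(0,1)"] by simp_all
    hence "(x - y0) \<bullet> E1 = 0" "(x - y0) \<bullet> E2 = 0" by (simp_all add: inner_diff_left)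
    hence "x - y0 = ((x - y0) \<bullet> e) *\<^sub>R e" using fr(6)[of "x - y0"] by simp
    hence "x - y0 = (((x - y0) \<bullet> e) / norm (g y0)) *\<^sub>R g y0" by (simp add: e_def)
    thus ?thesis by blast
  qed
  have "\<phi> ` W \<subseteq> S" "open N" "N \<subseteq> ball y0 r1"
    using \<phi>S IF(1) r(2) by (auto simp: N_def)
  moreover have "S \<inter> N \<subseteq> \<phi> ` W" using pre by blast
  ultimately show ?thesis
    by (intro exI[of _ W] exI[of _ N] exI[of _ \<phi>] exI[of _ \<phi>'] conjI ballI allI impI
        oW bW injW der\<phi> inj' cont\<phi>' cross lip y0N normal) auto
qed

lemma closest_point_normal:
  assumes "y \<in> S" "y \<in> U" and "\<And>z. z \<in> S \<Longrightarrow> dist x y \<le> dist x z"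
  shows "\<exists>s. x - y = s *\<^sub>R g y"
proof -
  have "\<forall>x. (\<forall>z\<in>S. dist x y \<le> dist x z) \<longrightarrow> (\<exists>s. x - y = s *\<^sub>R g y)"
    using chart[OF assms(1,2) zero_less_one] by (elim exE conjE)
  thus ?thesis using assms(3) by simp
qed

end

section \<open>Fine meshes are transversal to the surface normals\<close>

lemma Ck_on_imp_continuous_on:
  assumes "Ck_on k F U"
  shows "continuous_on U F"
proof (cases k)
  case (Suc j)
  then obtain F' where "\<And>x. x \<in> U \<Longrightarrow> (F has_derivative F' x) (at x)" using assms by auto
  thus ?thesis by (meson continuous_at_imp_continuous_on has_derivative_continuous)
qed (use assms in simp)

lemma C1_imp_lipschitz_on_compact_convex:
  fixes f :: "'a::euclidean_space \<Rightarrow> real"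
  assumes K: "compact K" "convex K" and der: "\<And>x. x \<in> K \<Longrightarrow> (f has_derivative D x) (at x)"
    and cont: "\<And>v. continuous_on K (\<lambda>x. D x v)"
  shows "\<exists>L\<ge>0. \<forall>x\<in>K. \<forall>y\<in>K. \<bar>f x - f y\<bar> \<le> L * dist x y"
proof -
  have "\<exists>B. \<forall>x\<in>K. \<bar>D x b\<bar> \<le> B" for b
    using compact_imp_bounded[OF compact_continuous_image[OF cont[of b] K(1)]] unfolding bounded_iff by auto
  then obtain B where B: "\<And>b x. x \<in> K \<Longrightarrow> \<bar>D x b\<bar> \<le> B b" by metis
  define L where "L = (\<Sum>b\<in>Basis. \<bar>B b\<bar>)"
  have "onorm (D x) \<le> L" if x: "x \<in> K" for x
  proof (rule onorm_le)
    fix v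
    have lin: "linear (D x)" using der[OF x] by (rule has_derivative_linear)
    have "D x v = D x (\<Sum>b\<in>Basis. (v \<bullet> b) *\<^sub>R b)" by (simp add: euclidean_representation)
    also have "\<dots> = (\<Sum>b\<in>Basis. (v \<bullet> b) * D x b)" using lin by (simp add: linear_sum linear_scale)
    also have "\<bar>\<dots>\<bar> \<le> (\<Sum>b\<in>Basis. \<bar>(v \<bullet> b) * D x b\<bar>)" by (rule sum_abs)
    also have "\<dots> \<le> (\<Sum>b\<in>Basis. norm v * \<bar>B b\<bar>)"
    proof (rule sum_mono)
      fix b :: 'a assume "b \<in> Basis"
      thus "\<bar>(v \<bullet> b) * D x b\<bar> \<le> norm v * \<bar>B b\<bar>"
        using B[OF x, of b] Basis_le_norm[of b v] unfolding abs_mult by (intro mult_mono) auto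
    qed
    also have "\<dots> = L * norm v" by (simp add: L_def sum_distrib_left mult.commute)
    finally show "norm (D x v) \<le> L * norm v" by simp
  qed
  hence "norm (f x - f y) \<le> L * norm (x - y)" if "x \<in> K" "y \<in> K" for x y
    using that by (intro differentiable_bound[OF K(2)]) (auto intro: has_derivative_at_withinI der)
  moreover have "L \<ge> 0" unfolding L_def by (intro sum_nonneg) auto
  ultimately show ?thesis by (auto simp: dist_norm)
qed

text \<open>The derivative of \<open>F\<close> is represented by \<open>g\<close>, so two continuous derivatives of \<open>F\<close> make \<open>g\<close>
  locally Lipschitz.
  The normal \<open>\<nu>\<close> is a multiple of \<open>g\<close> of unit length.\<close>

lemma oriented_surface_level_set:
  assumes S: "oriented_surface (Suc (Suc k)) S \<nu>" and y0: "y0 \<in> S"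
  obtains U F g r L where "regular_level_set S U F g" "y0 \<in> U"
    "\<And>y. y \<in> S \<Longrightarrow> y \<in> U \<Longrightarrow> norm (\<nu> y) = 1 \<and> (\<exists>c. \<nu> y = c *\<^sub>R g y)"
    "r > 0" "cball y0 r \<subseteq> U" "L \<ge> 0"
    "\<And>y z. y \<in> cball y0 r \<Longrightarrow> z \<in> cball y0 r \<Longrightarrow> norm (g y - g z) \<le> L * dist y z"
proof -
  obtain U F g where U: "open U" "y0 \<in> U" and Ck: "Ck_on (Suc (Suc k)) (F :: real^3 \<Rightarrow> real) U"
    and der_all: "\<forall>y\<in>U. (F has_derivative (\<lambda>v. g y \<bullet> v)) (at y) \<and> g y \<noteq> 0"
    and SU: "S \<inter> U = {y \<in> U. F y = 0}" and nu_all: "\<forall>y\<in>S \<inter> U. norm (\<nu> y) = 1 \<and> \<nu> y \<in> span {g y}"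
    using bspec[OF conjunct2[OF iffD1[OF oriented_surface_def S]] y0] by (elim exE conjE) (rule that)
  note der = bspec[OF der_all] and nu = bspec[OF nu_all]
  obtain F' where F'_all: "\<forall>x\<in>U. (F has_derivative F' x) (at x)" and Ck'_all: "\<forall>v. Ck_on (Suc k) (\<lambda>x. F' x v) U"
    using iffD1[OF Ck_on.simps(2) Ck] by (elim exE conjE) (rule that)
  note F' = bspec[OF F'_all] and Ck' = spec[OF Ck'_all]
  have F'g: "F' x v = g x \<bullet> v" if "x \<in> U" for x v
    by (rule fun_cong[OF has_derivative_unique[OF F'[OF that] conjunct1[OF der[OF that]]]])
  have cg: "continuous_on U (\<lambda>x. g x \<bullet> v)" for v
    using Ck_on_imp_continuous_on[OF Ck'[of v]] by (rule continuous_on_eq) (rule F'g)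
  have contg: "continuous_on U g"
    by (rule iffD2[OF continuous_on_componentwise]) (intro ballI cg)
  obtain r where r: "r > 0" "cball y0 r \<subseteq> U" using U open_contains_cball by blast
  have "\<exists>L\<ge>0. \<forall>y\<in>cball y0 r. \<forall>z\<in>cball y0 r. \<bar>g y \<bullet> v - g z \<bullet> v\<bar> \<le> L * dist y z" for v :: "real^3"
  proof -
    obtain D where D_all: "\<forall>x\<in>U. ((\<lambda>x. F' x v) has_derivative D x) (at x)" "\<forall>u. Ck_on k (\<lambda>x. D x u) U"
      using iffD1[OF Ck_on.simps(2) Ck'[of v]] by (elim exE conjE) (rule that)
    note D = bspec[OF D_all(1)] spec[OF D_all(2)]
    have "continuous_on (cball y0 r) (\<lambda>x. D x u)" for u
      by (rule continuous_on_subset[OF Ck_on_imp_continuous_on[OF D(2)] r(2)])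
    hence "\<exists>L\<ge>0. \<forall>x\<in>cball y0 r. \<forall>y\<in>cball y0 r. \<bar>F' x v - F' y v\<bar> \<le> L * dist x y"
      by (intro C1_imp_lipschitz_on_compact_convex[where D = D]) (use D(1) r(2) in auto)
    then obtain L where L: "L \<ge> 0" "\<And>x y. x \<in> cball y0 r \<Longrightarrow> y \<in> cball y0 r \<Longrightarrow> \<bar>F' x v - F' y v\<bar> \<le> L * dist x y"
      by blast
    have "\<bar>g y \<bullet> v - g z \<bullet> v\<bar> \<le> L * dist y z" if "y \<in> cball y0 r" "z \<in> cball y0 r" for y z
      using L(2)[OF that] F'g[of y v] F'g[of z v] that r(2) by (simp add: subset_iff)
    thus ?thesis using L(1) by blast
  qed
  hence "\<exists>L. \<forall>v. L v \<ge> 0 \<and> (\<forall>y\<in>cball y0 r. \<forall>z\<in>cball y0 r. \<bar>g y \<bullet> v - g z \<bullet> v\<bar> \<le> L v * dist y z)"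
    by (intro choice allI)
  then obtain L :: "real^3 \<Rightarrow> real" where L: "\<And>v. L v \<ge> 0" "\<And>v y z. y \<in> cball y0 r \<Longrightarrow> z \<in> cball y0 r \<Longrightarrow> \<bar>g y \<bullet> v - g z \<bullet> v\<bar> \<le> L v * dist y z"
    by blast
  have lip: "norm (g y - g z) \<le> (\<Sum>b\<in>Basis. L b) * dist y z" if "y \<in> cball y0 r" "z \<in> cball y0 r" for y z
  proof -
    have "norm (g y - g z) \<le> (\<Sum>b\<in>Basis. \<bar>(g y - g z) \<bullet> b\<bar>)" by (rule norm_le_l1)
    also have "\<dots> \<le> (\<Sum>b\<in>Basis. L b * dist y z)"
      using L(2)[OF that] by (intro sum_mono) (simp add: inner_diff_left)
    finally show ?thesis by (simp add: sum_distrib_right)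
  qed
  have nu': "norm (\<nu> y) = 1 \<and> (\<exists>c. \<nu> y = c *\<^sub>R g y)" if "y \<in> S" "y \<in> U" for y
    using nu[of y] that by (auto simp: span_singleton)
  show ?thesis
  proof (rule that[of U F g r "\<Sum>b\<in>Basis. L b"])
    show "regular_level_set S U F g" by unfold_locales (use U der SU contg in blast)+
    show "(\<Sum>b\<in>Basis. L b) \<ge> 0" by (intro sum_nonneg L(1))
  qed (fact U nu' r lip)+
qed

text \<open>The local estimates become uniform by a Lebesgue number of a covering of the compact
  surface.\<close>

lemma surface_chords_almost_tangent:
  assumes comp: "compact S" and S: "oriented_surface (Suc (Suc k)) S \<nu>" and \<epsilon>: "\<epsilon> > 0"
  obtains r where "r > 0"
    "\<And>y a b. y \<in> S \<Longrightarrow> a \<in> S \<Longrightarrow> b \<in> S \<Longrightarrow> dist y a < r \<Longrightarrow> dist y b < r \<Longrightarrow>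
       \<bar>\<nu> y \<bullet> (b - a)\<bar> \<le> \<epsilon> * norm (b - a)"
proof -
  have "\<exists>r>0. \<forall>y\<in>S \<inter> ball y0 r. \<forall>a\<in>S \<inter> ball y0 r. \<forall>b\<in>S \<inter> ball y0 r. \<bar>\<nu> y \<bullet> (b - a)\<bar> \<le> \<epsilon> * norm (b - a)"
    if y0: "y0 \<in> S" for y0
  proof -
    obtain U F g and r0 L :: real where rl: "regular_level_set S U F g" and y0U: "y0 \<in> U"
      and nu: "\<And>y. y \<in> S \<Longrightarrow> y \<in> U \<Longrightarrow> norm (\<nu> y) = 1 \<and> (\<exists>c. \<nu> y = c *\<^sub>R g y)"
      by (rule oriented_surface_level_set[OF S y0]) blast
    interpret regular_level_set S U F g by (rule rl)
    obtain r where r: "r > 0" "ball y0 r \<subseteq> U"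
      "\<And>y a b. y \<in> ball y0 r \<Longrightarrow> a \<in> ball y0 r \<Longrightarrow> b \<in> ball y0 r \<Longrightarrow> F a = F b \<Longrightarrow>
       \<bar>g y \<bullet> (b - a)\<bar> \<le> \<epsilon> * (norm (g y) * norm (b - a))"
      using chords_almost_tangent[OF y0U \<epsilon>] by blast
    have "\<bar>\<nu> y \<bullet> (b - a)\<bar> \<le> \<epsilon> * norm (b - a)"
      if y: "y \<in> S" "y \<in> ball y0 r" and a: "a \<in> S" "a \<in> ball y0 r" and b: "b \<in> S" "b \<in> ball y0 r" for y a b
    proof -
      have "F a = 0" "F b = 0" using SU a b r(2) by blast+
      hence 1: "\<bar>g y \<bullet> (b - a)\<bar> \<le> \<epsilon> * (norm (g y) * norm (b - a))" using r(3) y a b by simp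
      obtain c where c: "norm (\<nu> y) = 1" "\<nu> y = c *\<^sub>R g y" using nu y r(2) by blast
      have "\<bar>c\<bar> * \<bar>g y \<bullet> (b - a)\<bar> \<le> \<bar>c\<bar> * (\<epsilon> * (norm (g y) * norm (b - a)))" using 1 by (rule mult_left_mono) simp
      also have "\<dots> = \<epsilon> * (norm (\<nu> y) * norm (b - a))" by (simp add: c(2))
      finally show ?thesis unfolding c(1) by (simp add: c(2) abs_mult)
    qed
    thus ?thesis using r(1) by blast
  qed
  then obtain R where R: "\<And>y. y \<in> S \<Longrightarrow> R y > 0" "\<And>y0 y a b. y0 \<in> S \<Longrightarrow> y \<in> S \<inter> ball y0 (R y0) \<Longrightarrow> a \<in> S \<inter> ball y0 (R y0) \<Longrightarrow>
      b \<in> S \<inter> ball y0 (R y0) \<Longrightarrow> \<bar>\<nu> y \<bullet> (b - a)\<bar> \<le> \<epsilon> * norm (b - a)" by metis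
  have cover: "S \<subseteq> \<Union>((\<lambda>y. ball y (R y)) ` S)" using R(1) by fastforce
  obtain e where e: "e > 0" "\<And>x. x \<in> S \<Longrightarrow> \<exists>G\<in>(\<lambda>y. ball y (R y)) ` S. ball x e \<subseteq> G"
    by (rule Heine_Borel_lemma[OF comp cover]) auto
  show ?thesis
  proof (rule that[OF e(1)])
    fix y a b assume y: "y \<in> S" "a \<in> S" "b \<in> S" "dist y a < e" "dist y b < e"
    obtain y0 where y0: "y0 \<in> S" "ball y e \<subseteq> ball y0 (R y0)" using e(2)[OF y(1)] by blast
    have "y \<in> ball y e" "a \<in> ball y e" "b \<in> ball y e" using y e(1) by auto
    hence "y \<in> ball y0 (R y0)" "a \<in> ball y0 (R y0)" "b \<in> ball y0 (R y0)" using y0(2) by blast+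
    thus "\<bar>\<nu> y \<bullet> (b - a)\<bar> \<le> \<epsilon> * norm (b - a)" using R(2)[OF y0(1)] y by blast
  qed
qed

text \<open>A unit vector \<open>e\<close> in the plane of the triangle is \<open>1/(2r)\<close> times the difference of two
  points of the inscribed disc, and differences of points of the triangle have coefficients in
  \<open>[-1, 1]\<close>.\<close>

lemma inball_controls_directions:
  fixes \<tau> :: triangle
  assumes t: "\<tau> = convex hull {a, b, c}" "2 simplex \<tau>" and r: "r > 0"
    and ball: "x0 \<in> \<tau>" "cball x0 r \<inter> affine hull \<tau> \<subseteq> \<tau>"
    and e: "norm e = 1" "e \<bullet> cross3 (b - a) (c - a) = 0"
  obtains \<alpha> \<beta> where "e = \<alpha> *\<^sub>R (b - a) + \<beta> *\<^sub>R (c - a)" "\<bar>\<alpha>\<bar> \<le> 1 / (2 * r)" "\<bar>\<beta>\<bar> \<le> 1 / (2 * r)"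
proof -
  have cr: "cross3 (b - a) (c - a) \<noteq> 0" using two_simplex_cross t by simp
  obtain \<alpha>' \<beta>' where ab: "e = \<alpha>' *\<^sub>R (b - a) + \<beta>' *\<^sub>R (c - a)" using cramer_in_plane[OF cr e(2)] by blast
  have abc: "a \<in> affine hull \<tau>" "b \<in> affine hull \<tau>" "c \<in> affine hull \<tau>"
    using hull_inc[of _ "{a,b,c}" convex] hull_subset[of \<tau> affine] t(1) by blast+
  have "x0 + s *\<^sub>R e \<in> \<tau>" if "\<bar>s\<bar> = r" for s
  proof -
    have x0: "x0 \<in> affine hull \<tau>" using ball(1) hull_subset by fast
    have "x0 + (s * \<alpha>') *\<^sub>R (b - a) \<in> affine hull \<tau>" by (rule mem_affine_3_minus[OF affine_affine_hull x0 abc(2,1)])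
    hence "x0 + (s * \<alpha>') *\<^sub>R (b - a) + (s * \<beta>') *\<^sub>R (c - a) \<in> affine hull \<tau>"
      by (rule mem_affine_3_minus[OF affine_affine_hull _ abc(3,1)])
    hence "x0 + s *\<^sub>R e \<in> affine hull \<tau>" by (simp add: ab algebra_simps)
    moreover have "x0 + s *\<^sub>R e \<in> cball x0 r" using that e(1) by (simp add: dist_norm)
    ultimately show ?thesis using ball(2) by blast
  qed
  from this[of r] this[of "-r"] have "x0 + r *\<^sub>R e \<in> \<tau>" "x0 - r *\<^sub>R e \<in> \<tau>" using r by auto
  then obtain w1 w2 where w: "w1 \<in> ref_triangle" "w2 \<in> ref_triangle" "x0 + r *\<^sub>R e = tri_map a b c w1" "x0 - r *\<^sub>R e = tri_map a b c w2"
    unfolding t(1) convex_hull_tri_map by blast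
  have "(2 * r) *\<^sub>R e = tri_map a b c w1 - tri_map a b c w2"
    unfolding w(3,4)[symmetric] by (simp add: scaleR_2[symmetric])
  also have "\<dots> = (fst w1 - fst w2) *\<^sub>R (b - a) + (snd w1 - snd w2) *\<^sub>R (c - a)"
    by (simp add: tri_map_def algebra_simps)
  finally have "(1 / (2 * r)) *\<^sub>R (2 * r) *\<^sub>R e = (1 / (2 * r)) *\<^sub>R ((fst w1 - fst w2) *\<^sub>R (b - a) + (snd w1 - snd w2) *\<^sub>R (c - a))" by simp
  hence "e = ((fst w1 - fst w2) / (2 * r)) *\<^sub>R (b - a) + ((snd w1 - snd w2) / (2 * r)) *\<^sub>R (c - a)"
    using r by (simp add: scaleR_add_right)
  moreover have "\<bar>fst w1 - fst w2\<bar> \<le> 1" "\<bar>snd w1 - snd w2\<bar> \<le> 1" using w(1,2) by (auto simp: ref_triangle_def)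
  hence "\<bar>(fst w1 - fst w2) / (2 * r)\<bar> \<le> 1 / (2 * r)" "\<bar>(snd w1 - snd w2) / (2 * r)\<bar> \<le> 1 / (2 * r)"
    using r by (auto simp: abs_divide intro!: divide_right_mono)
  ultimately show ?thesis by (rule that)
qed

text \<open>For orthonormal vectors in the plane of the triangle, \<open>1 = \<parallel>e1 \<times> e2\<parallel>\<close> is the area element
  times a determinant of coefficients that are at most \<open>1/(2r)\<close>.\<close>

lemma inball_area_bound:
  fixes \<tau> :: triangle
  assumes t: "2 simplex \<tau>" and r: "r > 0" and ball: "x0 \<in> \<tau>" "cball x0 r \<inter> affine hull \<tau> \<subseteq> \<tau>"
  shows "tri_area \<tau> \<ge> r\<^sup>2 / 2"
proof -
  obtain a b c where abc: "\<tau> = convex hull {a, b, c}" and area: "tri_area \<tau> \<ge> norm (cross3 (b - a) (c - a)) / 4"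
    using tri_area_ge[OF t] .
  define k where "k = cross3 (b - a) (c - a)"
  have k: "k \<noteq> 0" unfolding k_def using two_simplex_cross t abc by simp
  have ba: "b - a \<noteq> 0" using k unfolding k_def by auto
  define e1 where "e1 = (1 / norm (b - a)) *\<^sub>R (b - a)"
  have e1: "norm e1 = 1" "e1 \<bullet> k = 0" using ba unfolding e1_def k_def by (simp_all add: dot_cross_self)
  have "(norm (cross3 k e1))\<^sup>2 = (norm k)\<^sup>2"
    using norm_cross_dot[of k e1] e1 by (simp add: inner_commute)
  hence nk: "norm (cross3 k e1) = norm k" by simp
  define e2 where "e2 = (1 / norm k) *\<^sub>R cross3 k e1"
  have e2: "norm e2 = 1" "e2 \<bullet> k = 0" "e1 \<bullet> e2 = 0" using k nk unfolding e2_def by (simp_all add: dot_cross_self)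
  obtain \<alpha>1 \<beta>1 where 1: "e1 = \<alpha>1 *\<^sub>R (b - a) + \<beta>1 *\<^sub>R (c - a)" "\<bar>\<alpha>1\<bar> \<le> 1 / (2 * r)" "\<bar>\<beta>1\<bar> \<le> 1 / (2 * r)"
    using inball_controls_directions[OF abc t r ball e1(1) e1(2)[unfolded k_def]] .
  obtain \<alpha>2 \<beta>2 where 2: "e2 = \<alpha>2 *\<^sub>R (b - a) + \<beta>2 *\<^sub>R (c - a)" "\<bar>\<alpha>2\<bar> \<le> 1 / (2 * r)" "\<bar>\<beta>2\<bar> \<le> 1 / (2 * r)"
    using inball_controls_directions[OF abc t r ball e2(1) e2(2)[unfolded k_def]] .
  have "(norm (cross3 e1 e2))\<^sup>2 = 1" using norm_cross_dot[of e1 e2] e1 e2 by simp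
  hence "norm (cross3 e1 e2) = 1" using norm_ge_zero[of "cross3 e1 e2"] by (auto simp: power2_eq_1_iff)
  moreover have "cross3 e1 e2 = (\<alpha>1 * \<beta>2 - \<beta>1 * \<alpha>2) *\<^sub>R k"
  proof -
    have "cross3 (\<alpha>1 *\<^sub>R u + \<beta>1 *\<^sub>R w) (\<alpha>2 *\<^sub>R u + \<beta>2 *\<^sub>R w) = (\<alpha>1 * \<beta>2 - \<beta>1 * \<alpha>2) *\<^sub>R cross3 u w" for u w
      by (simp add: cross3_simps forall_3)
    thus ?thesis unfolding 1(1) 2(1) k_def .
  qed
  ultimately have "1 = \<bar>\<alpha>1 * \<beta>2 - \<beta>1 * \<alpha>2\<bar> * norm k" by simp
  also have "\<dots> \<le> (1 / (2 * r) * (1 / (2 * r)) + 1 / (2 * r) * (1 / (2 * r))) * norm k"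
  proof (rule mult_right_mono)
    have "\<bar>\<alpha>1 * \<beta>2\<bar> \<le> 1 / (2 * r) * (1 / (2 * r))" "\<bar>\<beta>1 * \<alpha>2\<bar> \<le> 1 / (2 * r) * (1 / (2 * r))"
      unfolding abs_mult using 1 2 r by (intro mult_mono; simp)+
    thus "\<bar>\<alpha>1 * \<beta>2 - \<beta>1 * \<alpha>2\<bar> \<le> 1 / (2 * r) * (1 / (2 * r)) + 1 / (2 * r) * (1 / (2 * r))"
      by (rule order_trans[OF abs_triangle_ineq4 add_mono])
  qed simp
  finally have "2 * r\<^sup>2 \<le> norm k" using r by (simp add: field_simps power2_eq_square)
  thus ?thesis using area unfolding k_def by linarith
qed

text \<open>If \<open>e\<close> were parallel to the triangle, then expanding \<open>e \<bullet> e\<close> in the edges would give a value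
  below 1, because \<open>e\<close> is almost orthogonal to the edges. This is applied to the normal of
  the surface: on a fine mesh the edges are short chords of \<open>S\<close>, hence almost tangent.\<close>

lemma inball_transversal:
  fixes \<tau> :: triangle
  assumes abc: "\<tau> = convex hull {a, b, c}" and t: "2 simplex \<tau>" and r: "r > 0"
    and ball: "x0 \<in> \<tau>" "cball x0 r \<inter> affine hull \<tau> \<subseteq> \<tau>"
    and m: "norm m = 1" "\<And>x y. x \<in> \<tau> \<Longrightarrow> y \<in> \<tau> \<Longrightarrow> m \<bullet> (x - y) = 0"
    and e: "norm e = 1" "\<bar>e \<bullet> (b - a)\<bar> < r" "\<bar>e \<bullet> (c - a)\<bar> < r"
  shows "m \<bullet> e \<noteq> 0"
proof
  assume 0: "m \<bullet> e = 0"
  define k where "k = cross3 (b - a) (c - a)"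
  have k: "k \<noteq> 0" unfolding k_def using two_simplex_cross t abc by simp
  have pts: "a \<in> \<tau>" "b \<in> \<tau>" "c \<in> \<tau>" unfolding abc by (auto intro: hull_inc)
  have "cross3 k m = (m \<bullet> (b - a)) *\<^sub>R (c - a) - (m \<bullet> (c - a)) *\<^sub>R (b - a)"
    unfolding k_def by (simp add: cross3_simps forall_3)
  hence "cross3 m k = 0" using m(2) pts cross_skew[of m k] by simp
  hence "collinear {0, m, k}" by (simp add: cross_eq_0)
  then obtain s where "k = s *\<^sub>R m" using k m(1) unfolding collinear_lemma by auto
  hence "e \<bullet> k = 0" using 0 by (simp add: inner_commute)
  then obtain \<alpha> \<beta> where ab: "e = \<alpha> *\<^sub>R (b - a) + \<beta> *\<^sub>R (c - a)" "\<bar>\<alpha>\<bar> \<le> 1 / (2 * r)" "\<bar>\<beta>\<bar> \<le> 1 / (2 * r)"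
    using inball_controls_directions[OF abc t r ball e(1)] unfolding k_def by blast
  have "1 = e \<bullet> e" using e(1) by (simp add: norm_eq_1)
  also have "\<dots> = \<alpha> * (e \<bullet> (b - a)) + \<beta> * (e \<bullet> (c - a))"
    by (subst (2) ab(1)) (simp add: inner_add_right)
  also have "\<dots> \<le> \<bar>\<alpha>\<bar> * \<bar>e \<bullet> (b - a)\<bar> + \<bar>\<beta>\<bar> * \<bar>e \<bullet> (c - a)\<bar>"
    unfolding abs_mult[symmetric] by linarith
  also have "\<dots> \<le> 1 / (2 * r) * \<bar>e \<bullet> (b - a)\<bar> + 1 / (2 * r) * \<bar>e \<bullet> (c - a)\<bar>"
    using ab by (intro add_mono mult_right_mono) auto
  also have "\<dots> < 1 / (2 * r) * r + 1 / (2 * r) * r"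
    using e r by (intro add_strict_mono mult_strict_left_mono) auto
  also have "\<dots> = 1" using r by simp
  finally show False by simp
qed

text \<open>Two lines \<open>y + \<real>p\<close> and \<open>y' + \<real>q\<close> are cut by a plane with unit normal \<open>m\<close>. The distance of
  the intersection points is controlled by that of \<open>y\<close> and \<open>y'\<close> when the lines are transversal to the plane
  (\<open>\<mu>\<close>) and their directions vary in a Lipschitz way (\<open>L\<close>).\<close>

lemma normal_lines_meet_plane_lipschitz:
  fixes x x' y y' p q m :: "'a::real_inner"
  assumes x: "x = y + s *\<^sub>R p" "x' = y' + s' *\<^sub>R q" and m: "norm m = 1" "m \<bullet> (x - x') = 0"
    and \<mu>: "\<mu> > 0" "\<bar>m \<bullet> q\<bar> \<ge> \<mu>" and q: "norm q \<le> \<Gamma>" and pq: "norm (p - q) \<le> L * dist y y'"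
    and s: "\<bar>s\<bar> \<le> N"
  shows "dist x x' \<le> (1 + N * L) * (1 + \<Gamma> / \<mu>) * dist y y'"
proof -
  have N: "N \<ge> 0" using s by linarith
  define z where "z = (y - y') + s *\<^sub>R (p - q)"
  have xx: "x - x' = z + (s - s') *\<^sub>R q" unfolding x z_def by (simp add: algebra_simps)
  have nz: "norm z \<le> (1 + N * L) * dist y y'"
  proof -
    have "norm z \<le> norm (y - y') + \<bar>s\<bar> * norm (p - q)" unfolding z_def by (metis norm_scaleR norm_triangle_ineq)
    also have "\<bar>s\<bar> * norm (p - q) \<le> N * (L * dist y y')" using s pq N by (intro mult_mono) auto
    finally show ?thesis by (simp add: dist_norm algebra_simps)
  qed
  have "m \<bullet> z + (s - s') * (m \<bullet> q) = 0" using m(2) unfolding xx by (simp add: inner_add_right)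
  hence "\<bar>s - s'\<bar> * \<bar>m \<bullet> q\<bar> = \<bar>m \<bullet> z\<bar>" unfolding abs_mult[symmetric] by linarith
  also have "\<dots> \<le> norm z" using Cauchy_Schwarz_ineq2[of m z] m(1) by simp
  finally have "\<bar>s - s'\<bar> * \<mu> \<le> norm z" using mult_left_mono[OF \<mu>(2), of "\<bar>s - s'\<bar>"] by simp
  hence ss: "\<bar>s - s'\<bar> \<le> norm z / \<mu>" using \<mu>(1) by (simp add: field_simps)
  have G0: "\<Gamma> \<ge> 0" using q norm_ge_zero order_trans by blast
  have "dist x x' \<le> norm z + \<bar>s - s'\<bar> * norm q" unfolding dist_norm xx by (metis norm_scaleR norm_triangle_ineq)
  also have "\<bar>s - s'\<bar> * norm q \<le> norm z / \<mu> * \<Gamma>" using ss q by (intro mult_mono) (use \<mu> in auto)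
  also have "norm z + norm z / \<mu> * \<Gamma> = norm z * (1 + \<Gamma> / \<mu>)" by (simp add: algebra_simps)
  also have "\<dots> \<le> (1 + N * L) * dist y y' * (1 + \<Gamma> / \<mu>)"
    using nz G0 \<mu> by (intro mult_right_mono) auto
  finally show ?thesis by (simp add: mult_ac)
qed

section \<open>Lifting square integrable functions to a triangle\<close>

lemma tri_map_bounded_below:
  assumes cr: "cross3 (b - a) (c - a) \<noteq> 0"
  obtains \<kappa> where "\<kappa> > 0" "\<And>u w. \<kappa> * dist u w \<le> dist (tri_map a b c u) (tri_map a b c w)"
proof -
  define l where "l = (\<lambda>u::real \<times> real. fst u *\<^sub>R (b - a) + snd u *\<^sub>R (c - a))"
  have lin: "linear l"
    by (rule linearI) (auto simp: l_def algebra_simps)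
  have "u = 0" if "l u = 0" for u
  proof -
    have "cross3 (b - a) (l u) = snd u *\<^sub>R cross3 (b - a) (c - a)"
      "cross3 (l u) (c - a) = fst u *\<^sub>R cross3 (b - a) (c - a)"
      unfolding l_def by (simp_all add: cross_add_left cross_add_right cross_mult_left cross_mult_right)
    hence "fst u = 0" "snd u = 0" using that cr by simp_all
    thus ?thesis by (simp add: prod_eq_iff)
  qed
  hence "inj l" using lin by (simp add: linear_injective_0)
  then obtain B where B: "B > 0" "\<And>u. B * norm u \<le> norm (l u)"
    using linear_inj_bounded_below_pos[OF lin] by blast
  have "B * dist u w \<le> dist (tri_map a b c u) (tri_map a b c w)" for u w
  proof -
    have "tri_map a b c u - tri_map a b c w = l (u - w)" by (simp add: tri_map_def l_def algebra_simps)
    thus ?thesis using B(2)[of "u - w"] by (simp add: dist_norm)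
  qed
  thus ?thesis using that B(1) by blast
qed

text \<open>One triangle of a mesh with unit normal \<open>m\<close> and the closest point map \<open>p\<close> on it. By
  transversality, the normal lines of \<open>S\<close> at the points of \<open>p(\<tau>)\<close> cross the plane of the
  triangle.\<close>

locale projected_triangle =
  fixes S :: "(real^3) set" and \<nu> :: "real^3 \<Rightarrow> real^3" and \<sigma> :: "(real^3) measure" and k :: nat
    and \<tau> :: triangle and m :: "real^3" and p :: "real^3 \<Rightarrow> real^3"
  assumes comp: "compact S" and S: "oriented_surface (Suc (Suc k)) S \<nu>" and \<sigma>: "is_surface_measure S \<sigma>"
    and T: "2 simplex \<tau>"
    and m: "norm m = 1" "x \<in> \<tau> \<Longrightarrow> y \<in> \<tau> \<Longrightarrow> m \<bullet> (x - y) = 0"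
    and p: "continuous_on \<tau> p" "x \<in> \<tau> \<Longrightarrow> p x \<in> S"
      "x \<in> \<tau> \<Longrightarrow> z \<in> S \<Longrightarrow> dist x (p x) \<le> dist x z"
    and transv: "x \<in> \<tau> \<Longrightarrow> m \<bullet> \<nu> (p x) \<noteq> 0"
begin

definition pullback where
  "pullback a b c A = {u \<in> ref_triangle. p (tri_map a b c u) \<in> A}"

lemma pullback_borel:
  assumes t: "\<tau> = convex hull {a, b, c}" and A: "A \<in> sets borel"
  shows "pullback a b c A \<in> sets borel"
proof -
  have "continuous_on ref_triangle (\<lambda>u. p (tri_map a b c u))"
    by (rule continuous_on_compose2[OF p(1) continuous_on_tri_map]) (use convex_hull_tri_map t in auto)
  from measurable_sets[OF borel_measurable_continuous_on_restrict[OF this] A]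
  have "(\<lambda>u. p (tri_map a b c u)) -` A \<inter> ref_triangle \<in> sets (restrict_space borel ref_triangle)"
    by (simp add: space_restrict_space)
  moreover have "(\<lambda>u. p (tri_map a b c u)) -` A \<inter> ref_triangle = pullback a b c A"
    by (auto simp: pullback_def)
  ultimately show ?thesis using sets_ref_triangle by (simp add: sets_restrict_space_iff)
qed

lemma sets_surface_measure: "sets \<sigma> = sets (restrict_space borel S)"
  "A \<in> sets \<sigma> \<longleftrightarrow> A \<subseteq> S \<and> A \<in> sets borel"
  using \<sigma> comp by (auto simp: is_surface_measure_def sets_restrict_space_iff borel_compact)

text \<open>Away from \<open>p(\<tau>)\<close> there is nothing to show. Near a point of \<open>p(\<tau>)\<close>, a point \<open>x\<close> of the
  triangle lies on the line through \<open>y = p x\<close> with direction \<open>g y\<close>, so it is a Lipschitz function of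
  \<open>y\<close>, hence of the chart parameter of \<open>y\<close>, and so are the coordinates of \<open>x\<close> in the triangle. In the chart,
  Lebesgue measure is at most the surface measure, because the area element is at least 1.\<close>

lemma emeasure_pullback_le_local:
  assumes t: "\<tau> = convex hull {a, b, c}" and y0: "y0 \<in> S"
  shows "\<exists>V C. open V \<and> y0 \<in> V \<and> (\<forall>A\<in>sets borel. A \<subseteq> S \<inter> V \<longrightarrow>
     emeasure lborel (pullback a b c A) \<le> ennreal C * emeasure \<sigma> A)"
proof (cases "y0 \<in> p ` \<tau>")
  case False
  have compp: "compact (p ` \<tau>)" using compact_continuous_image[OF p(1)] two_simplex_props(1)[OF T] by blast
  have empty: "pullback a b c A = {}" if "A \<subseteq> S \<inter> - (p ` \<tau>)" for A
    using that convex_hull_tri_map[of a b c] t by (auto simp: pullback_def)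
  have "\<forall>A\<in>sets borel. A \<subseteq> S \<inter> - (p ` \<tau>) \<longrightarrow>
     emeasure lborel (pullback a b c A) \<le> ennreal 0 * emeasure \<sigma> A"
  proof (intro ballI impI)
    fix A assume "A \<subseteq> S \<inter> - (p ` \<tau>)"
    show "emeasure lborel (pullback a b c A) \<le> ennreal 0 * emeasure \<sigma> A"
      unfolding empty[OF \<open>A \<subseteq> S \<inter> - (p ` \<tau>)\<close>] by simp
  qed
  moreover have "open (- (p ` \<tau>))" using compp by (simp add: compact_imp_closed open_Compl)
  ultimately show ?thesis using False by blast
next
  case True
  define \<alpha> where "\<alpha> = tri_map a b c"
  have im: "\<alpha> ` ref_triangle = \<tau>" using convex_hull_tri_map t by (simp add: \<alpha>_def)
  have cpt: "compact \<tau>" by (rule two_simplex_props(1)[OF T])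
  obtain U F g r0 L where rl: "regular_level_set S U F g" and y0U: "y0 \<in> U"
    and nu: "\<And>y. y \<in> S \<Longrightarrow> y \<in> U \<Longrightarrow> norm (\<nu> y) = 1 \<and> (\<exists>c. \<nu> y = c *\<^sub>R g y)"
    and r0: "r0 > 0" "cball y0 r0 \<subseteq> U" and L: "L \<ge> 0"
      "\<And>y z. y \<in> cball y0 r0 \<Longrightarrow> z \<in> cball y0 r0 \<Longrightarrow> norm (g y - g z) \<le> L * dist y z"
    by (rule oriented_surface_level_set[OF S y0]) blast
  interpret regular_level_set S U F g by (rule rl)
  define \<mu> where "\<mu> = \<bar>m \<bullet> g y0\<bar> / 2"
  have \<mu>: "\<mu> > 0"
  proof -
    obtain x where "x \<in> \<tau>" "y0 = p x" using True by blast
    hence "m \<bullet> \<nu> y0 \<noteq> 0" using transv by simp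
    thus ?thesis using nu[OF y0 y0U] by (auto simp: \<mu>_def)
  qed
  \<comment> \<open>so small that \<open>\<bar>m \<bullet> g\<bar> \<ge> \<mu>\<close> persists near \<open>y0\<close>\<close>
  define r where "r = min r0 (\<mu> / (L + 1))"
  have r: "r > 0" "r \<le> r0" using r0 \<mu> L by (auto simp: r_def)
  have Lr: "L * r \<le> \<mu>"
  proof -
    have "L * r \<le> L * (\<mu> / (L + 1))" using L by (intro mult_left_mono) (auto simp: r_def)
    also have "\<dots> \<le> \<mu>" using L \<mu> by (simp add: field_simps)
    finally show ?thesis .
  qed
  have near: "norm (g y - g y0) \<le> \<mu>" if "y \<in> ball y0 r" for y
  proof -
    have "norm (g y - g y0) \<le> L * dist y y0" by (rule L(2)) (use that r in auto)
    also have "\<dots> \<le> L * r" using that L by (intro mult_left_mono) (auto simp: dist_commute)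
    finally show ?thesis using Lr by linarith
  qed
  define \<Gamma> where "\<Gamma> = norm (g y0) + \<mu>"
  have bnds: "\<bar>m \<bullet> g y\<bar> \<ge> \<mu>" "norm (g y) \<le> \<Gamma>" "norm (g y) \<ge> \<mu>" if "y \<in> ball y0 r" for y
  proof -
    have "\<bar>m \<bullet> (g y - g y0)\<bar> \<le> norm (g y - g y0)" using Cauchy_Schwarz_ineq2[of m "g y - g y0"] m(1) by simp
    hence "\<bar>m \<bullet> g y - m \<bullet> g y0\<bar> \<le> \<mu>" using near[OF that] by (simp add: inner_diff_right)
    thus 1: "\<bar>m \<bullet> g y\<bar> \<ge> \<mu>" unfolding \<mu>_def by linarith
    show "norm (g y) \<le> \<Gamma>" using near[OF that] norm_triangle_sub[of "g y" "g y0"] unfolding \<Gamma>_def by linarith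
    show "norm (g y) \<ge> \<mu>" using 1 Cauchy_Schwarz_ineq2[of m "g y"] m(1) by simp
  qed
  have inS: "ball y0 r \<subseteq> U" using r0(2) r(2) by (meson ball_subset_cball order_trans subset_ball)
  obtain W V \<phi> \<phi>' where W: "open W" "bounded W" "inj_on \<phi> W" "\<phi> ` W \<subseteq> S"
    "\<forall>w\<in>W. (\<phi> has_derivative \<phi>' w) (at w) \<and> inj (\<phi>' w)" "\<forall>v. continuous_on W (\<lambda>w. \<phi>' w v)"
    "\<forall>w\<in>W. norm (cross3 (\<phi>' w (1 :: real, 0 :: real)) (\<phi>' w (0, 1))) \<ge> 1"
    "\<forall>w\<in>W. \<forall>w'\<in>W. dist (\<phi> w) (\<phi> w') \<le> 2 * dist w w'"
    "open V" "y0 \<in> V" "S \<inter> V \<subseteq> \<phi> ` W" "V \<subseteq> ball y0 r"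
    using chart[OF y0 y0U r(1)] by (elim exE conjE) (rule that)
  have "continuous_on \<tau> (\<lambda>x. x - p x)" by (intro continuous_intros p)
  hence "bounded ((\<lambda>x. x - p x) ` \<tau>)" using compact_continuous_image[OF _ cpt] compact_imp_bounded by blast
  then obtain M where M: "\<And>x. x \<in> \<tau> \<Longrightarrow> norm (x - p x) \<le> M" unfolding bounded_iff by auto
  have on_normal: "\<exists>s. x = p x + s *\<^sub>R g (p x) \<and> \<bar>s\<bar> \<le> M / \<mu>" if x: "x \<in> \<tau>" "p x \<in> ball y0 r" for x
  proof -
    have pU: "p x \<in> U" using x inS by blast
    have "\<exists>s. x - p x = s *\<^sub>R g (p x)" by (rule closest_point_normal[OF p(2)[OF x(1)] pU p(3)[OF x(1)]])
    then obtain s where s: "x - p x = s *\<^sub>R g (p x)" by blast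
    have "\<bar>s\<bar> * \<mu> \<le> \<bar>s\<bar> * norm (g (p x))" by (intro mult_left_mono bnds x) simp
    also have "\<dots> \<le> M" using M[OF x(1)] unfolding s by simp
    finally have "\<bar>s\<bar> \<le> M / \<mu>" using \<mu> by (simp add: field_simps)
    moreover have "x = p x + s *\<^sub>R g (p x)" using s by (simp add: algebra_simps)
    ultimately show ?thesis by blast
  qed
  define K where "K = (1 + M / \<mu> * L) * (1 + \<Gamma> / \<mu>)"
  have lipx: "dist x x' \<le> K * dist (p x) (p x')"
    if x: "x \<in> \<tau>" "p x \<in> ball y0 r" "x' \<in> \<tau>" "p x' \<in> ball y0 r" for x x'
  proof -
    obtain s where s: "x = p x + s *\<^sub>R g (p x)" "\<bar>s\<bar> \<le> M / \<mu>" using on_normal[OF x(1,2)] by blast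
    obtain s' where s': "x' = p x' + s' *\<^sub>R g (p x')" using on_normal[OF x(3,4)] by blast
    have "p x \<in> cball y0 r0" "p x' \<in> cball y0 r0" using x r by auto
    hence "norm (g (p x) - g (p x')) \<le> L * dist (p x) (p x')" by (rule L(2))
    thus ?thesis unfolding K_def
      by (intro normal_lines_meet_plane_lipschitz[OF s(1) s' m(1) m(2)[OF x(1,3)] \<mu> bnds(1)[OF x(4)] bnds(2)[OF x(4)] _ s(2)])
  qed
  have cr: "cross3 (b - a) (c - a) \<noteq> 0" using two_simplex_cross t T by simp
  obtain \<kappa> where \<kappa>: "\<kappa> > 0" "\<And>u w. \<kappa> * dist u w \<le> dist (\<alpha> u) (\<alpha> w)"
    using tri_map_bounded_below[OF cr] unfolding \<alpha>_def by metis
  have M0: "M \<ge> 0" using True M norm_ge_zero order_trans by blast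
  have K0: "K \<ge> 0" unfolding K_def using M0 \<mu> L by (intro mult_nonneg_nonneg add_nonneg_nonneg) (auto simp: \<Gamma>_def)
  define \<Lambda> where "\<Lambda> = K * 2 / \<kappa>"
  have \<Lambda>0: "\<Lambda> \<ge> 0" using K0 \<kappa> by (simp add: \<Lambda>_def)
  define C where "C = (2 * \<Lambda> * DIM(real \<times> real)) ^ DIM(real \<times> real)"
  have bound: "emeasure lborel (pullback a b c A) \<le> ennreal C * emeasure \<sigma> A"
    if A: "A \<in> sets borel" "A \<subseteq> S \<inter> V" for A
  proof -
    \<comment> \<open>only points in the image of the triangle have a preimage to which \<open>f\<close> can send them\<close>
    define A' where "A' = A \<inter> p ` \<tau>"
    have A': "A' \<in> sets borel" "A' \<subseteq> \<phi> ` W" "A' \<subseteq> ball y0 r" "A' \<subseteq> A"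
      using A W(11,12) compact_continuous_image[OF p(1) cpt] by (auto simp: A'_def borel_compact)
    define B where "B = {w \<in> W. \<phi> w \<in> A'}"
    define X where "X = pullback a b c A"
    have X: "u \<in> X \<longleftrightarrow> u \<in> ref_triangle \<and> p (\<alpha> u) \<in> A" for u by (simp add: X_def pullback_def \<alpha>_def)
    have cont\<phi>: "continuous_on W \<phi>"
      by (meson W(5) continuous_at_imp_continuous_on has_derivative_continuous)
    have Bm: "B \<in> sets borel"
    proof -
      have "\<phi> -` A' \<inter> space (restrict_space borel W) \<in> sets (restrict_space borel W)"
        by (rule measurable_sets[OF borel_measurable_continuous_on_restrict[OF cont\<phi>] A'(1)])
      moreover have "\<phi> -` A' \<inter> space (restrict_space borel W) = B" by (auto simp: B_def space_restrict_space)
      ultimately show ?thesis using W(1) by (simp add: sets_restrict_space_iff)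
    qed
    have "\<exists>u\<in>ref_triangle. p (\<alpha> u) = \<phi> w" if "w \<in> B" for w
      using that im unfolding B_def A'_def by (auto simp: image_iff)
    then obtain f where f: "\<And>w. w \<in> B \<Longrightarrow> f w \<in> ref_triangle" "\<And>w. w \<in> B \<Longrightarrow> p (\<alpha> (f w)) = \<phi> w" by metis
    have lipu: "dist u u' \<le> K / \<kappa> * dist (p (\<alpha> u)) (p (\<alpha> u'))"
      if u: "u \<in> ref_triangle" "p (\<alpha> u) \<in> ball y0 r" "u' \<in> ref_triangle" "p (\<alpha> u') \<in> ball y0 r" for u u'
    proof -
      have "\<alpha> u \<in> \<tau>" "\<alpha> u' \<in> \<tau>" using im u by auto
      hence "\<kappa> * dist u u' \<le> K * dist (p (\<alpha> u)) (p (\<alpha> u'))"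
        using \<kappa>(2)[of u u'] lipx[of "\<alpha> u" "\<alpha> u'"] u by linarith
      thus ?thesis using \<kappa>(1) by (simp add: field_simps)
    qed
    have inball: "\<phi> w \<in> ball y0 r" if "w \<in> B" for w using that A'(3) by (auto simp: B_def)
    have lipf: "dist (f w) (f w') \<le> \<Lambda> * dist w w'" if w: "w \<in> B" "w' \<in> B" for w w'
    proof -
      have "dist (f w) (f w') \<le> K / \<kappa> * dist (\<phi> w) (\<phi> w')"
        using lipu[of "f w" "f w'"] f w inball by simp
      also have "\<dots> \<le> K / \<kappa> * (2 * dist w w')"
        using W(8) w K0 \<kappa>(1) by (intro mult_left_mono) (auto simp: B_def)
      finally show ?thesis by (simp add: \<Lambda>_def)
    qed
    have XB: "X \<subseteq> f ` B"
    proof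
      fix u assume u: "u \<in> X"
      have pA: "p (\<alpha> u) \<in> A'" using u im by (auto simp: X A'_def)
      then obtain w where w: "w \<in> W" "\<phi> w = p (\<alpha> u)" using A'(2) by (metis imageE subsetD)
      have wB: "w \<in> B" using w pA by (simp add: B_def)
      have "dist u (f w) \<le> K / \<kappa> * dist (p (\<alpha> u)) (p (\<alpha> (f w)))"
      proof (rule lipu)
        show "u \<in> ref_triangle" "p (\<alpha> u) \<in> ball y0 r" using u pA A'(3) by (auto simp: X)
        show "f w \<in> ref_triangle" "p (\<alpha> (f w)) \<in> ball y0 r" using f[OF wB] inball[OF wB] by simp_all
      qed
      hence "u = f w" using f(2)[OF wB] w(2) by simp
      thus "u \<in> f ` B" using wB by blast
    qed
    have Bb: "bounded B" using W(2) by (rule bounded_subset) (auto simp: B_def)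
    have "emeasure lborel X \<le> ennreal C * emeasure lborel B"
      unfolding C_def by (rule emeasure_lipschitz_image_le[OF Bm Bb pullback_borel[OF t A(1), folded X_def] XB lipf \<Lambda>0])
    also have "emeasure lborel B \<le> emeasure \<sigma> A'"
    proof -
      have "emeasure \<sigma> A' = (\<integral>\<^sup>+ w \<in> {w \<in> W. \<phi> w \<in> A'}. ennreal (norm (cross3 (\<phi>' w (1, 0)) (\<phi>' w (0, 1)))) \<partial>lborel)"
        using \<sigma> W A'(1,2) unfolding is_surface_measure_def by blast
      moreover have "emeasure lborel B = (\<integral>\<^sup>+ w. indicator B w \<partial>lborel)" using Bm by simp
      moreover have "(\<integral>\<^sup>+ w. indicator B w \<partial>lborel) \<le>
          (\<integral>\<^sup>+ w \<in> B. ennreal (norm (cross3 (\<phi>' w (1, 0)) (\<phi>' w (0, 1)))) \<partial>lborel)"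
      proof (rule nn_integral_mono)
        fix w
        have "ennreal 1 \<le> ennreal (norm (cross3 (\<phi>' w (1, 0)) (\<phi>' w (0, 1))))" if "w \<in> B"
          using that W(7) by (intro ennreal_leI) (auto simp: B_def)
        thus "indicator B w \<le> ennreal (norm (cross3 (\<phi>' w (1, 0)) (\<phi>' w (0, 1)))) * indicator B w"
          by (auto simp: indicator_def)
      qed
      ultimately show ?thesis by (simp add: B_def)
    qed
    also have "emeasure \<sigma> A' \<le> emeasure \<sigma> A"
      by (rule emeasure_mono[OF A'(4)]) (use A sets_surface_measure(2) in auto)
    finally show ?thesis unfolding X_def by (simp add: mult_left_mono)
  qed
  show ?thesis
    using W(9,10) bound by blast
qed

lemma emeasure_pullback_le:
  assumes t: "\<tau> = convex hull {a, b, c}"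
  shows "\<exists>C\<ge>0. \<forall>A\<in>sets borel. A \<subseteq> S \<longrightarrow>
     emeasure lborel (pullback a b c A) \<le> ennreal C * emeasure \<sigma> A"
proof -
  define P where "P = (\<lambda>y0 V C. open V \<and> y0 \<in> V \<and> (\<forall>A\<in>sets borel. A \<subseteq> S \<inter> V \<longrightarrow>
     emeasure lborel (pullback a b c A) \<le> ennreal C * emeasure \<sigma> A))"
  have "\<exists>V C. P y0 V C" if "y0 \<in> S" for y0
    unfolding P_def by (rule emeasure_pullback_le_local[OF t that])
  then obtain V C where "\<And>y. y \<in> S \<Longrightarrow> P y (V y) (C y)" by metis
  hence V: "\<And>y. y \<in> S \<Longrightarrow> open (V y)" "\<And>y. y \<in> S \<Longrightarrow> y \<in> V y"
    and VC: "\<And>y A. y \<in> S \<Longrightarrow> A \<in> sets borel \<Longrightarrow> A \<subseteq> S \<inter> V y \<Longrightarrow>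
      emeasure lborel (pullback a b c A) \<le> ennreal (C y) * emeasure \<sigma> A"
    unfolding P_def by blast+
  have cov: "S \<subseteq> (\<Union>y\<in>S. V y)" using V(2) by blast
  obtain D where D: "D \<subseteq> S" "finite D" "S \<subseteq> (\<Union>y\<in>D. V y)"
    by (rule compactE_image[OF comp V(1) cov])
  define C' where "C' = (\<Sum>y\<in>D. \<bar>C y\<bar>)"
  have "emeasure lborel (pullback a b c A) \<le> ennreal C' * emeasure \<sigma> A"
    if A: "A \<in> sets borel" "A \<subseteq> S" for A
  proof -
    have AV: "A \<inter> V y \<in> sets borel" if "y \<in> D" for y using A V(1) D(1) that by (intro sets.Int) auto
    have "pullback a b c A = (\<Union>y\<in>D. pullback a b c (A \<inter> V y))"
      using A(2) D(3) unfolding pullback_def by blast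
    hence "emeasure lborel (pullback a b c A) = emeasure lborel (\<Union>y\<in>D. pullback a b c (A \<inter> V y))" by simp
    also have "\<dots> \<le> (\<Sum>y\<in>D. emeasure lborel (pullback a b c (A \<inter> V y)))"
      by (rule emeasure_subadditive_finite[OF D(2)]) (use pullback_borel[OF t AV] in auto)
    also have "\<dots> \<le> (\<Sum>y\<in>D. ennreal \<bar>C y\<bar> * emeasure \<sigma> A)"
    proof (rule sum_mono)
      fix y assume y: "y \<in> D"
      have "emeasure lborel (pullback a b c (A \<inter> V y)) \<le> ennreal (C y) * emeasure \<sigma> (A \<inter> V y)"
        by (rule VC) (use y D(1) AV A in auto)
      also have "\<dots> \<le> ennreal \<bar>C y\<bar> * emeasure \<sigma> A"
        by (intro mult_mono emeasure_mono ennreal_leI) (use A sets_surface_measure(2) in auto)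
      finally show "emeasure lborel (pullback a b c (A \<inter> V y)) \<le> ennreal \<bar>C y\<bar> * emeasure \<sigma> A" .
    qed
    also have "\<dots> = ennreal C' * emeasure \<sigma> A"
      unfolding C'_def sum_distrib_right[symmetric] by (subst sum_ennreal) auto
    finally show ?thesis .
  qed
  moreover have "C' \<ge> 0" unfolding C'_def by (intro sum_nonneg) auto
  ultimately show ?thesis by blast
qed

text \<open>The push-forward of the measure of the triangle under \<open>p\<close> is dominated by a multiple of
  \<open>\<sigma>\<close>. Thus the lift is square integrable, and it is integrable because the triangle has finite
  measure.\<close>

lemma square_integrable_lift_integrable:
  fixes f :: "real^3 \<Rightarrow> real"
  assumes f: "f \<in> borel_measurable \<sigma>" "integrable \<sigma> (\<lambda>x. (f x)\<^sup>2)"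
  shows "integrable (tri_measure \<tau>) (\<lambda>x. f (p x))"
proof -
  obtain a b c J where abc: "\<tau> = convex hull {a, b, c}" and J: "J > 0"
    and im: "tri_map a b c ` ref_triangle = \<tau>"
    and M: "tri_measure \<tau> = distr (ref_measure J) (restrict_space borel \<tau>) (tri_map a b c)"
    and meas: "tri_map a b c \<in> measurable (ref_measure J) (restrict_space borel \<tau>)"
    and moc: "measure_on_compact (tri_measure \<tau>) \<tau>"
    by (rule tri_measure_parametrised[OF T])
  let ?M = "tri_measure \<tau>"
  have sp: "space ?M = \<tau>" by (rule measure_on_compact_space[OF moc])
  have sM: "sets ?M = sets (restrict_space borel \<tau>)" and "finite_measure ?M"
    using moc by (auto simp: measure_on_compact_def)
  interpret finite_measure ?M by fact
  have pm: "p \<in> measurable ?M \<sigma>"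
  proof -
    have "p \<in> borel_measurable (restrict_space borel \<tau>)" by (rule borel_measurable_continuous_on_restrict[OF p(1)])
    hence "p \<in> measurable (restrict_space borel \<tau>) (restrict_space borel S)"
      by (intro measurable_restrict_space2) (auto simp: space_restrict_space p(2))
    thus ?thesis using measurable_cong_sets[OF sM sets_surface_measure(1)] by blast
  qed
  obtain C where C: "C \<ge> 0" "\<And>A. A \<in> sets borel \<Longrightarrow> A \<subseteq> S \<Longrightarrow>
     emeasure lborel (pullback a b c A) \<le> ennreal C * emeasure \<sigma> A"
    using emeasure_pullback_le[OF abc] by blast
  define N where "N = distr ?M \<sigma> p"
  have le: "N \<le> scale_measure (ennreal (J * C)) \<sigma>"
  proof (subst le_measure)
    show "sets N = sets (scale_measure (ennreal (J * C)) \<sigma>)" by (simp add: N_def)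
    show "\<forall>A\<in>sets N. emeasure N A \<le> emeasure (scale_measure (ennreal (J * C)) \<sigma>) A"
    proof
      fix A assume "A \<in> sets N"
      hence A: "A \<in> sets \<sigma>" by (simp add: N_def)
      let ?X = "pullback a b c A"
      have pA: "p -` A \<inter> \<tau> \<in> sets (restrict_space borel \<tau>)" using measurable_sets[OF pm A] by (simp add: sp sM)
      have pre: "tri_map a b c -` (p -` A \<inter> \<tau>) \<inter> ref_triangle = ?X" using im by (auto simp: pullback_def)
      have "emeasure N A = emeasure ?M (p -` A \<inter> \<tau>)"
        unfolding N_def using pm A by (simp add: emeasure_distr sp)
      also have "\<dots> = emeasure (ref_measure J) ?X"
        unfolding M using meas pA pre
        by (subst emeasure_distr) (auto simp: space_restrict_space ref_measure_def)
      also have "\<dots> = ennreal J * emeasure (restrict_space lborel ref_triangle) ?X"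
        unfolding ref_measure_def
      proof (rule emeasure_density_const)
        show "?X \<in> sets (restrict_space lborel ref_triangle)"
          using measurable_sets[OF meas pA] pre by (simp add: space_restrict_space ref_measure_def)
      qed
      also have "emeasure (restrict_space lborel ref_triangle) ?X = emeasure lborel ?X"
        by (rule emeasure_restrict_space) (auto simp: pullback_def)
      also have "ennreal J * emeasure lborel ?X \<le> ennreal J * (ennreal C * emeasure \<sigma> A)"
        using C(2) A sets_surface_measure(2) by (intro mult_left_mono) auto
      also have "\<dots> = emeasure (scale_measure (ennreal (J * C)) \<sigma>) A"
        using C(1) J by (simp add: ennreal_mult mult.assoc)
      finally show "emeasure N A \<le> emeasure (scale_measure (ennreal (J * C)) \<sigma>) A" .
    qed
  qed
  have "(\<integral>\<^sup>+ x. ennreal ((f (p x))\<^sup>2) \<partial>?M) = (\<integral>\<^sup>+ y. ennreal ((f y)\<^sup>2) \<partial>N)"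
    unfolding N_def using pm f(1) by (subst nn_integral_distr) auto
  also have "\<dots> \<le> (\<integral>\<^sup>+ y. ennreal ((f y)\<^sup>2) \<partial>scale_measure (ennreal (J * C)) \<sigma>)"
    by (rule nn_integral_mono_measure[OF _ le]) (simp add: N_def)
  also have "\<dots> = ennreal (J * C) * (\<integral>\<^sup>+ y. ennreal ((f y)\<^sup>2) \<partial>\<sigma>)"
    by (rule nn_integral_scale_measure) (use f(1) in simp)
  also have "\<dots> < \<infinity>"
    using f(2) by (simp add: integrable_iff_bounded ennreal_mult_less_top)
  finally have fin: "(\<integral>\<^sup>+ x. ennreal ((f (p x))\<^sup>2) \<partial>?M) < \<infinity>" .
  have fpm: "(\<lambda>x. f (p x)) \<in> borel_measurable ?M" by (rule measurable_compose[OF pm f(1)])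
  have sq: "integrable ?M (\<lambda>x. (f (p x))\<^sup>2)"
    using fin fpm by (simp add: integrable_iff_bounded)
  show ?thesis
  proof (rule Bochner_Integration.integrable_bound[of ?M "\<lambda>x. 1 + (f (p x))\<^sup>2"])
    show "integrable ?M (\<lambda>x. 1 + (f (p x))\<^sup>2)" using sq by simp
    show "AE x in ?M. norm (f (p x)) \<le> norm (1 + (f (p x))\<^sup>2)"
    proof (rule AE_I2)
      fix x
      have "0 \<le> (\<bar>f (p x)\<bar> - 1)\<^sup>2" by simp
      hence "2 * \<bar>f (p x)\<bar> \<le> 1 + (f (p x))\<^sup>2" by (simp add: power2_diff)
      thus "norm (f (p x)) \<le> norm (1 + (f (p x))\<^sup>2)" by simp
    qed
  qed (rule fpm)
qed

end

section \<open>The discrete problem\<close>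

text \<open>The graph of the closest point map is closed, since uniqueness characterises it by
  inequalities between continuous functions, and the target \<open>S\<close> is compact.\<close>

lemma continuous_on_closest_point_of_unique:
  fixes S :: "(real^3) set"
  assumes S: "compact S" "S \<noteq> {}" and U: "closest_point_well_defined_on S U"
  shows "continuous_on U (closest_point S)"
proof -
  have cl: "closed S" using S(1) by (rule compact_imp_closed)
  have p: "closest_point S x \<in> S" "\<And>z. z \<in> S \<Longrightarrow> dist x (closest_point S x) \<le> dist x z" for x
    using closest_point_in_set[OF cl S(2)] closest_point_le[OF cl] by auto
  define Z where "Z = (\<Inter>w\<in>S. {z::(real^3) \<times> (real^3). dist (fst z) (snd z) \<le> dist (fst z) w})"
  have "closed Z" unfolding Z_def by (intro closed_INT ballI closed_Collect_le continuous_intros)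
  moreover have "(\<lambda>x. Pair x (closest_point S x)) ` U = (U \<times> S) \<inter> Z"
  proof
    show "(\<lambda>x. Pair x (closest_point S x)) ` U \<subseteq> (U \<times> S) \<inter> Z" using p by (auto simp: Z_def)
    show "(U \<times> S) \<inter> Z \<subseteq> (\<lambda>x. Pair x (closest_point S x)) ` U"
    proof
      fix z assume z: "z \<in> (U \<times> S) \<inter> Z"
      obtain x y where xy: "z = (x, y)" by (cases z)
      have x: "x \<in> U" and y: "y \<in> S \<and> (\<forall>w\<in>S. dist x y \<le> dist x w)" using z by (auto simp: xy Z_def)
      have "closest_point S x \<in> S \<and> (\<forall>w\<in>S. dist x (closest_point S x) \<le> dist x w)" using p by blast
      hence "y = closest_point S x" using U x y unfolding closest_point_well_defined_on_def by blast
      thus "z \<in> (\<lambda>x. Pair x (closest_point S x)) ` U" using x xy by blast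
    qed
  qed
  ultimately have "closedin (top_of_set (U \<times> S)) ((\<lambda>x. Pair x (closest_point S x)) ` U)"
    by (simp add: closedin_closed_Int)
  moreover have "closest_point S \<in> U \<rightarrow> S" using p by auto
  ultimately show ?thesis using continuous_closed_graph_eq[OF S(1)] by blast
qed

context mesh_with_normals
begin

lemma mesh_size_pos:
  assumes "T \<noteq> {}"
  shows "mesh_size T > 0"
proof -
  obtain \<tau> where t: "\<tau> \<in> T" using assms by blast
  obtain a b c where abc: "\<tau> = convex hull {a, b, c}" using two_simplex_vertices[OF simplex[OF t]] .
  have "a \<noteq> b" using two_simplex_affine_independent(2)[of a b c] simplex[OF t] abc by simp
  moreover have "a \<in> \<tau>" "b \<in> \<tau>" unfolding abc by (auto intro: hull_inc)
  hence "dist a b \<le> mesh_size T" by (rule dist_le_mesh_size[OF t])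
  ultimately show ?thesis using zero_less_dist_iff[of a b] by linarith
qed

lemma function_subspace_fe_space: "function_subspace (fe_space T)"
  unfolding function_subspace_def using fe_space_zero fe_space_lincomb by blast

lemma mean_linear: "linear_functional_on (fe_space T) (\<lambda>v. surf_integral T (\<lambda>\<tau>. v))"
  unfolding linear_functional_on_def
proof (intro ballI allI)
  fix u v a c assume uv: "u \<in> fe_space T" "v \<in> fe_space T"
  have "continuous_on \<tau> w" if "w \<in> fe_space T" "\<tau> \<in> T" for w \<tau>
    by (rule continuous_on_subset[OF fe_space_continuous[OF that(1)]]) (use that(2) in auto)
  from surf_integral_lincomb[OF subset_refl this[OF uv(1)] this[OF uv(2)], of a c]
  show "surf_integral T (\<lambda>\<tau> x. a * u x + c * v x) = a * surf_integral T (\<lambda>\<tau>. u) + c * surf_integral T (\<lambda>\<tau>. v)"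
    by simp
qed

lemma function_subspace_fe_space0: "function_subspace (fe_space0 T)"
  unfolding function_subspace_def
proof (intro conjI ballI allI)
  show "(\<lambda>x. 0) \<in> fe_space0 T" using fe_space_zero by (simp add: fe_space0_def surf_integral_def)
  fix u v a c assume uv: "u \<in> fe_space0 T" "v \<in> fe_space0 T"
  hence uv': "u \<in> fe_space T" "v \<in> fe_space T" by (auto simp: fe_space0_def)
  have "surf_integral T (\<lambda>\<tau> x. a * u x + c * v x) = a * surf_integral T (\<lambda>\<tau>. u) + c * surf_integral T (\<lambda>\<tau>. v)"
    by (rule linear_functional_onD[OF mean_linear uv'])
  thus "(\<lambda>x. a * u x + c * v x) \<in> fe_space0 T"
    using uv fe_space_lincomb[OF uv'] by (simp add: fe_space0_def)
qed

text \<open>The nodal basis functions minus their means span the functions of zero mean; they are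
  linearly dependent, as they sum to zero.\<close>

lemma fe_space0_spanned:
  assumes ne: "T \<noteq> {}"
  obtains b where "\<And>P. P \<in> nodes T \<Longrightarrow> b P \<in> fe_space0 T"
    "\<And>v. v \<in> fe_space0 T \<Longrightarrow> \<exists>c. v = (\<lambda>x. \<Sum>P\<in>nodes T. c P * b P x)"
proof -
  define one where "one = (\<lambda>x. if x \<in> \<Union>T then 1 else 0 :: real)"
  define \<mu> where "\<mu> = (\<lambda>v. surf_integral T (\<lambda>\<tau>. v) :: real)"
  have one: "one \<in> fe_space T" unfolding one_def by (rule fe_space_one)
  have area: "surf_area T > 0" by (rule surf_area_pos[OF ne])
  have \<mu>1: "\<mu> one = surf_area T" unfolding \<mu>_def
    by (subst surf_integral_constant[where c = 1]) (auto simp: one_def)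
  define b where "b = (\<lambda>P x. 1 * nodal_basis T P x + (- \<mu> (nodal_basis T P) / surf_area T) * one x)"
  have "b P \<in> fe_space0 T" if P: "P \<in> nodes T" for P
  proof -
    have "b P \<in> fe_space T" unfolding b_def by (rule fe_space_lincomb[OF nodal_basis(1)[OF P] one])
    moreover have "\<mu> (b P) = 1 * \<mu> (nodal_basis T P) + (- \<mu> (nodal_basis T P) / surf_area T) * \<mu> one"
      unfolding b_def \<mu>_def by (rule linear_functional_onD[OF mean_linear nodal_basis(1)[OF P] one])
    hence "\<mu> (b P) = 0" using area by (simp add: \<mu>1)
    ultimately show ?thesis by (simp add: fe_space0_def \<mu>_def)
  qed
  moreover have "\<exists>c. v = (\<lambda>x. \<Sum>P\<in>nodes T. c P * b P x)" if v: "v \<in> fe_space0 T" for v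
  proof (intro exI[of _ v] ext)
    fix x
    have vf: "v \<in> fe_space T" and v0: "\<mu> v = 0" using v by (auto simp: fe_space0_def \<mu>_def)
    have "\<mu> (\<lambda>x. \<Sum>P\<in>nodes T. v P * nodal_basis T P x) = (\<Sum>P\<in>nodes T. v P * \<mu> (nodal_basis T P))"
      unfolding \<mu>_def
      by (rule linear_functional_on_sum[OF function_subspace_fe_space mean_linear finite_nodes nodal_basis(1)])
    hence z: "(\<Sum>P\<in>nodes T. v P * \<mu> (nodal_basis T P)) = 0" using nodal_expansion[OF vf] v0 by metis
    have "(\<Sum>P\<in>nodes T. v P * b P x) = (\<Sum>P\<in>nodes T. v P * nodal_basis T P x - (v P * \<mu> (nodal_basis T P)) * (one x / surf_area T))"
      by (rule sum.cong) (auto simp: b_def algebra_simps)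
    also have "\<dots> = (\<Sum>P\<in>nodes T. v P * nodal_basis T P x) - (\<Sum>P\<in>nodes T. v P * \<mu> (nodal_basis T P)) * (one x / surf_area T)"
      by (simp only: sum_subtractf sum_distrib_right)
    also have "\<dots> = v x" unfolding z using fun_cong[OF nodal_expansion[OF vf], of x] by simp
    finally show "v x = (\<Sum>P\<in>nodes T. v P * b P x)" by simp
  qed
  ultimately show ?thesis by (rule that)
qed

lemma l_h_linear:
  assumes int: "\<And>\<tau>. \<tau> \<in> T \<Longrightarrow> integrable (tri_measure \<tau>) (\<lambda>x. f (closest_point S x))"
  shows "linear_functional_on (fe_space T) (l_h S T f)"
  unfolding linear_functional_on_def
proof (intro ballI allI)
  fix u v a c assume uv: "u \<in> fe_space T" "v \<in> fe_space T"
  have prod: "integrable (tri_measure \<tau>) (\<lambda>x. f_h S T f x * w x)" if w: "w \<in> fe_space T" and t: "\<tau> \<in> T" for w \<tau>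
  proof -
    have moc: "measure_on_compact (tri_measure \<tau>) \<tau>" by (rule tri_measure_on_compact[OF simplex[OF t]])
    have "finite_measure (tri_measure \<tau>)" using moc by (simp add: measure_on_compact_def)
    then interpret finite_measure "tri_measure \<tau>" .
    have fh: "integrable (tri_measure \<tau>) (f_h S T f)"
      unfolding f_h_def using int[OF t] by simp
    have cw: "continuous_on \<tau> w" by (rule continuous_on_subset[OF fe_space_continuous[OF w]]) (use t in auto)
    hence "bounded (w ` \<tau>)" using compact_continuous_image[OF _ tri_compact[OF t]] compact_imp_bounded by blast
    then obtain B where B: "\<And>x. x \<in> \<tau> \<Longrightarrow> \<bar>w x\<bar> \<le> B" unfolding bounded_iff by auto
    have wm: "w \<in> borel_measurable (tri_measure \<tau>)"
      using tri_integrable[OF t cw] by (rule borel_measurable_integrable)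
    show ?thesis
    proof (rule Bochner_Integration.integrable_bound[of _ "\<lambda>x. B * f_h S T f x"])
      show "integrable (tri_measure \<tau>) (\<lambda>x. B * f_h S T f x)" using fh by simp
      show "(\<lambda>x. f_h S T f x * w x) \<in> borel_measurable (tri_measure \<tau>)"
        using borel_measurable_integrable[OF fh] wm by simp
      show "AE x in tri_measure \<tau>. norm (f_h S T f x * w x) \<le> norm (B * f_h S T f x)"
      proof (rule AE_I2)
        fix x assume "x \<in> space (tri_measure \<tau>)"
        hence "\<bar>w x\<bar> \<le> \<bar>B\<bar>" using B[of x] space_tri_measure[OF t] by auto
        hence "\<bar>f_h S T f x\<bar> * \<bar>w x\<bar> \<le> \<bar>f_h S T f x\<bar> * \<bar>B\<bar>" by (rule mult_left_mono) simp
        thus "norm (f_h S T f x * w x) \<le> norm (B * f_h S T f x)" by (simp add: abs_mult mult.commute)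
      qed
    qed
  qed
  have "(\<integral>x. f_h S T f x * (a * u x + c * v x) \<partial>tri_measure \<tau>) =
      a * (\<integral>x. f_h S T f x * u x \<partial>tri_measure \<tau>) + c * (\<integral>x. f_h S T f x * v x \<partial>tri_measure \<tau>)" if t: "\<tau> \<in> T" for \<tau>
  proof -
    have "(\<integral>x. f_h S T f x * (a * u x + c * v x) \<partial>tri_measure \<tau>) =
      (\<integral>x. a * (f_h S T f x * u x) + c * (f_h S T f x * v x) \<partial>tri_measure \<tau>)"
      by (rule Bochner_Integration.integral_cong) (auto simp: algebra_simps)
    thus ?thesis using prod[OF uv(1) t] prod[OF uv(2) t] by simp
  qed
  thus "l_h S T f (\<lambda>x. a * u x + c * v x) = a * l_h S T f u + c * l_h S T f v"
    unfolding l_h_def surf_inner_def surf_integral_def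
    by (simp add: sum.distrib sum_distrib_left)
qed

lemma discrete_problem_uniquely_solvable:
  assumes ne: "T \<noteq> {}" and con: "connected (\<Union>T)"
    and coer: "\<rho> > 0" "\<And>v. v \<in> fe_space0 T \<Longrightarrow> a_h \<gamma> s T n v v \<ge> \<rho> * (energy_norm T n v)\<^sup>2"
    and int: "\<And>\<tau>. \<tau> \<in> T \<Longrightarrow> integrable (tri_measure \<tau>) (\<lambda>x. f (closest_point S x))"
  shows "\<exists>!u. u \<in> fe_space0 T \<and> (\<forall>v\<in>fe_space0 T. a_h \<gamma> s T n u v = l_h S T f v)"
proof -
  have sub: "fe_space0 T \<subseteq> fe_space T" by (auto simp: fe_space0_def)
  obtain b where b: "\<And>P. P \<in> nodes T \<Longrightarrow> b P \<in> fe_space0 T"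
    "\<And>v. v \<in> fe_space0 T \<Longrightarrow> \<exists>c. v = (\<lambda>x. \<Sum>P\<in>nodes T. c P * b P x)"
    by (rule fe_space0_spanned[OF ne]) blast
  have B1: "linear_functional_on (fe_space0 T) (\<lambda>u. a_h \<gamma> s T n u w)" if "w \<in> fe_space0 T" for w
    unfolding linear_functional_on_def
    by (intro ballI allI a_h_lincomb) (use that sub in blast)+
  have B2: "linear_functional_on (fe_space0 T) (a_h \<gamma> s T n u)" if "u \<in> fe_space0 T" for u
    using B1[OF that] unfolding linear_functional_on_def a_h_commute[of \<gamma> s u] .
  have pos: "v = (\<lambda>x. 0)" if v: "v \<in> fe_space0 T" "a_h \<gamma> s T n v v = 0" for v
  proof -
    have vf: "v \<in> fe_space T" using v(1) sub by blast
    have "\<rho> * (energy_norm T n v)\<^sup>2 \<le> 0" using coer(2)[OF v(1)] v(2) by simp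
    hence "(energy_norm T n v)\<^sup>2 \<le> 0" using coer(1) by (simp add: mult_le_0_iff)
    hence "stab v v \<le> 0" "stab v v \<ge> 0" using energy_norm_squared[OF vf mesh_size_pos[OF ne]] by linarith+
    thus ?thesis using stab_form_definite[OF con v(1)] by simp
  qed
  have l: "linear_functional_on (fe_space0 T) (l_h S T f)"
    using l_h_linear[of f S] int sub unfolding linear_functional_on_def by blast
  show ?thesis
    by (rule definite_form_unique_solution[where b = b, OF function_subspace_fe_space0 B1 B2 pos finite_nodes b l])
qed

end

text \<open>A continuous bijection from a compact space is a homeomorphism, so connectedness is
  inherited from \<open>S\<close>.\<close>

lemma approximating_mesh_connected:
  assumes S: "compact S" "connected S" "S \<noteq> {}" and U: "closest_point_well_defined_on S (tubular_nbhd S \<delta>)"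
    and T: "approximating_mesh S \<delta> T" and comp: "compact (\<Union>T)"
  shows "connected (\<Union>T)"
proof -
  have bij: "bij_betw (closest_point S) (\<Union>T) S" and sub: "\<Union>T \<subseteq> tubular_nbhd S \<delta>"
    using T by (auto simp: approximating_mesh_def)
  have cont: "continuous_on (\<Union>T) (closest_point S)"
    by (rule continuous_on_subset[OF continuous_on_closest_point_of_unique[OF S(1,3) U] sub])
  obtain q where "homeomorphism (\<Union>T) S (closest_point S) q"
    using homeomorphism_compact[OF comp cont bij_betw_imp_surj_on[OF bij] bij_betw_imp_inj_on[OF bij]] by (elim exE) (rule that)
  hence "continuous_on S q" "q ` S = \<Union>T" by (auto simp: homeomorphism_def)
  thus ?thesis using connected_continuous_image[of S q] S(2) by simp
qed

theorem lemma4p3: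
  fixes S :: "(real^3) set" and \<nu> :: "real^3 \<Rightarrow> real^3" and \<sigma> :: "(real^3) measure"
    and \<delta> \<gamma>stab :: real
    and \<T> :: "mesh set" and n :: "mesh \<Rightarrow> triangle \<Rightarrow> real^3"
  assumes "compact S" and "connected S" and "S \<noteq> {}" and "oriented_surface 4 S \<nu>"
    and "is_surface_measure S \<sigma>"
    and "\<delta> > 0" and "closest_point_well_defined_on S (tubular_nbhd S \<delta>)"
    and "\<And>T. T \<in> \<T> \<Longrightarrow> approximating_mesh S \<delta> T"
    and "\<And>T. T \<in> \<T> \<Longrightarrow> unit_outer_normal T (n T)"
    and "quasi_uniform \<T>"
    and "\<gamma>stab > 0"
  shows "\<exists>h0>0. \<exists>\<gamma>0>0. \<forall>\<gamma>\<ge>\<gamma>0. \<exists>\<rho>>0. \<forall>T\<in>\<T>. mesh_size T \<le> h0 \<longrightarrow>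
           (\<forall>v\<in>fe_space0 T. a_h \<gamma> \<gamma>stab T (n T) v v \<ge> \<rho> * (energy_norm T (n T) v)\<^sup>2) \<and>
           (\<forall>f. f \<in> borel_measurable \<sigma> \<and> integrable \<sigma> (\<lambda>x. (f x)\<^sup>2) \<and> (\<integral>x. f x \<partial>\<sigma>) = 0 \<longrightarrow>
              (\<exists>!u. u \<in> fe_space0 T \<and>
                 (\<forall>v\<in>fe_space0 T. a_h \<gamma> \<gamma>stab T (n T) u v = l_h S T f v)))"
proof -
  have S4: "oriented_surface (Suc (Suc 2)) S \<nu>" using assms(4) by (simp add: eval_nat_numeral)
  have cl: "closed S" using assms(1) by (rule compact_imp_closed)
  obtain c where c: "c > 0" and inball: "\<And>T \<tau>. T \<in> \<T> \<Longrightarrow> \<tau> \<in> T \<Longrightarrow> \<exists>x\<in>\<tau>. cball x (c * mesh_size T) \<inter> affine hull \<tau> \<subseteq> \<tau>"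
    using assms(10) unfolding quasi_uniform_def by blast
  obtain r where r: "r > 0" and tang: "\<And>y a b. y \<in> S \<Longrightarrow> a \<in> S \<Longrightarrow> b \<in> S \<Longrightarrow> dist y a < r \<Longrightarrow> dist y b < r \<Longrightarrow>
       \<bar>\<nu> y \<bullet> (b - a)\<bar> \<le> c / 2 * norm (b - a)"
    by (rule surface_chords_almost_tangent[OF assms(1) S4, of "c / 2"]) (use c in auto)
  have \<nu>1: "norm (\<nu> y) = 1" if "y \<in> S" for y
    using assms(4) that unfolding oriented_surface_def by blast
  \<comment> \<open>area at least \<open>r\<^sup>2/2\<close> for the inradius bound \<open>r = c h\<close>\<close>
  define \<kappa> where "\<kappa> = c\<^sup>2 / 2"
  have \<kappa>: "\<kappa> > 0" using c by (simp add: \<kappa>_def)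
  define \<rho> where "\<rho> = min (min (1/4) (\<kappa>/16)) (min 1 \<gamma>stab)"
  have \<rho>: "\<rho> > 0" using \<kappa> assms(11) by (simp add: \<rho>_def)
  \<comment> \<open>\<open>h \<le> r/3\<close> places the vertices of a triangle within \<open>2h < r\<close> of the closest point of each of its points\<close>
  have main: "(\<forall>v\<in>fe_space0 T. a_h \<gamma> \<gamma>stab T (n T) v v \<ge> \<rho> * (energy_norm T (n T) v)\<^sup>2) \<and>
           (\<forall>f. f \<in> borel_measurable \<sigma> \<and> integrable \<sigma> (\<lambda>x. (f x)\<^sup>2) \<and> (\<integral>x. f x \<partial>\<sigma>) = 0 \<longrightarrow>
              (\<exists>!u. u \<in> fe_space0 T \<and> (\<forall>v\<in>fe_space0 T. a_h \<gamma> \<gamma>stab T (n T) u v = l_h S T f v)))"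
    if T: "T \<in> \<T>" and hT: "mesh_size T \<le> r / 3" and \<gamma>: "\<gamma> \<ge> 8 / \<kappa> + 1" for T \<gamma>
  proof -
    have app: "approximating_mesh S \<delta> T" and nor: "unit_outer_normal T (n T)" using assms(8,9) T by auto
    interpret mesh_with_normals T "n T"
      by unfold_locales (use app nor in \<open>auto simp: approximating_mesh_def unit_outer_normal_def\<close>)
    have bij: "bij_betw (closest_point S) (\<Union>T) S" and nodesS: "nodes T \<subseteq> S" and sub: "\<Union>T \<subseteq> tubular_nbhd S \<delta>"
      using app by (auto simp: approximating_mesh_def)
    have ne: "T \<noteq> {}" using bij assms(3) by (auto simp: bij_betw_def)
    have h: "mesh_size T > 0" by (rule mesh_size_pos[OF ne])
    have ch: "c * mesh_size T > 0" using c h by simp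
    have con: "connected (\<Union>T)"
      by (rule approximating_mesh_connected[OF assms(1-3,7) app compact_mesh_union])
    have area: "\<kappa> * (mesh_size T)\<^sup>2 \<le> tri_area \<tau>" if t: "\<tau> \<in> T" for \<tau>
    proof -
      obtain x0 where "x0 \<in> \<tau>" "cball x0 (c * mesh_size T) \<inter> affine hull \<tau> \<subseteq> \<tau>" using inball[OF T t] by blast
      from inball_area_bound[OF simplex[OF t] ch this] show ?thesis by (simp add: \<kappa>_def power_mult_distrib)
    qed
    have coer: "a_h \<gamma> \<gamma>stab T (n T) v v \<ge> \<rho> * (energy_norm T (n T) v)\<^sup>2" if "v \<in> fe_space0 T" for v
      unfolding \<rho>_def by (rule a_h_coercive[OF \<kappa> area h \<gamma> assms(11)]) (use that in \<open>auto simp: fe_space0_def\<close>)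
    have p: "closest_point S x \<in> S" "z \<in> S \<Longrightarrow> dist x (closest_point S x) \<le> dist x z" for x z
      using closest_point_in_set[OF cl assms(3)] closest_point_le[OF cl] by auto
    have transv: "n T \<tau> \<bullet> \<nu> (closest_point S x) \<noteq> 0" if t: "\<tau> \<in> T" and x: "x \<in> \<tau>" for \<tau> x
    proof -
      obtain x0 where x0: "x0 \<in> \<tau>" "cball x0 (c * mesh_size T) \<inter> affine hull \<tau> \<subseteq> \<tau>" using inball[OF T t] by blast
      obtain a b d where abd: "\<tau> = convex hull {a, b, d}" using two_simplex_vertices[OF simplex[OF t]] .
      have v\<tau>: "q \<in> \<tau>" "q \<in> S" if "q \<in> {a, b, d}" for q
      proof -
        have "q extreme_point_of \<tau>" using two_simplex_extreme_points[of a b d] simplex[OF t] abd that by simp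
        thus "q \<in> \<tau>" "q \<in> S" using t nodesS by (auto simp: nodes_def extreme_point_of_def)
      qed
      have near: "dist (closest_point S x) q < r" if "q \<in> {a, b, d}" for q
      proof -
        have "dist (closest_point S x) q \<le> dist x (closest_point S x) + dist x q" by (metis dist_commute dist_triangle)
        also have "\<dots> \<le> dist x q + dist x q" using p(2)[OF v\<tau>(2)[OF that]] by simp
        also have "\<dots> < r" using dist_le_mesh_size[OF t x v\<tau>(1)[OF that]] hT r by linarith
        finally show ?thesis .
      qed
      have small: "\<bar>\<nu> (closest_point S x) \<bullet> (q - a)\<bar> < c * mesh_size T" if q: "q \<in> {a, b, d}" for q
      proof -
        have "\<bar>\<nu> (closest_point S x) \<bullet> (q - a)\<bar> \<le> c / 2 * norm (q - a)"
          by (rule tang) (use p v\<tau> near q in auto)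
        also have "\<dots> \<le> c / 2 * mesh_size T"
          using dist_le_mesh_size[OF t v\<tau>(1)[OF q] v\<tau>(1)[of a]] c by (intro mult_left_mono) (auto simp: dist_norm)
        also have "\<dots> < c * mesh_size T" using ch by simp
        finally show ?thesis .
      qed
      show ?thesis
        by (rule inball_transversal[OF abd simplex[OF t] ch x0 unit_normal[OF t] _ \<nu>1[OF p(1)] small small])
           (use normal_orthogonal[OF t] in auto)
    qed
    have int: "integrable (tri_measure \<tau>) (\<lambda>x. f (closest_point S x))"
      if t: "\<tau> \<in> T" and f: "f \<in> borel_measurable \<sigma>" "integrable \<sigma> (\<lambda>x. (f x)\<^sup>2)"
      for \<tau> and f :: "real^3 \<Rightarrow> real"
    proof -
      have cont: "continuous_on \<tau> (closest_point S)"
        using continuous_on_closest_point_of_unique[OF assms(1,3,7)] sub t continuous_on_subset by blast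
      interpret projected_triangle S \<nu> \<sigma> 2 \<tau> "n T \<tau>" "closest_point S"
        by unfold_locales
          (rule assms(1) S4 assms(5) simplex[OF t] unit_normal[OF t] normal_orthogonal[OF t] cont p transv[OF t]; assumption)+
      show ?thesis by (rule square_integrable_lift_integrable[OF f])
    qed
    show ?thesis
    proof (intro conjI ballI allI impI)
      fix f :: "real^3 \<Rightarrow> real"
      assume f: "f \<in> borel_measurable \<sigma> \<and> integrable \<sigma> (\<lambda>x. (f x)\<^sup>2) \<and> (\<integral>x. f x \<partial>\<sigma>) = 0"
      show "\<exists>!u. u \<in> fe_space0 T \<and> (\<forall>v\<in>fe_space0 T. a_h \<gamma> \<gamma>stab T (n T) u v = l_h S T f v)"
      proof (rule discrete_problem_uniquely_solvable[OF ne con \<rho>])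
        show "integrable (tri_measure \<tau>) (\<lambda>x. f (closest_point S x))" if "\<tau> \<in> T" for \<tau>
          using int[OF that] f by blast
      qed (rule coer)
    qed (rule coer)
  qed
  have "r / 3 > 0" "8 / \<kappa> + 1 > 0" using r \<kappa> by (simp_all add: add_pos_pos)
  thus ?thesis
    by - (rule exI[of _ "r / 3"], rule conjI, assumption, rule exI[of _ "8 / \<kappa> + 1"], rule conjI, assumption,
        intro allI impI, rule exI[of _ \<rho>], rule conjI, rule \<rho>, intro ballI impI, rule main; assumption)
qed

end
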